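(* Let $r\ge1$, let $N$ be a non-negative integer, and let $a,b,c_1,\dots,c_r,x_1,\dots,x_r$ be generic nonzero complex parameters. Then $$\sum_{\substack{k_1,\dots,k_r\ge0\\ |\mathbf k|\le N}}\frac{\Delta(\mathbf xq^{2\mathbf k};p)}{\Delta(\mathbf x;p)}q^{|\mathbf k|-e_2(\mathbf k)}\prod_{1\le i<j\le r}\frac1{(a^2x_ix_jq^{2N+1};q^2,p)_{k_i+k_j}}$$ $$\times\prod_{i=1}^r\left(\frac{\theta(ax_iq^{2k_i+|\mathbf k|};p)}{\theta(ax_i;p)}\frac{(ax_i;q,p)_{|\mathbf k|}\,(q^{-2N}/ax_i;q,p)_{|\mathbf k|-k_i}}{(aq/c_i,c_iq^{-2N}/a;q,p)_{|\mathbf k|}\,(q^{2N+1+k_i-|\mathbf k|}ax_i;q,p)_{k_i}}\right)$$ $$\times\frac{(b,q/b;q,p)_{|\mathbf k|}\,(q^{-2N};q^2,p)_{|\mathbf k|}}{\prod_{i=1}^r(abx_iq,ax_iq^2/b;q^2,p)_{k_i}}\prod_{i,j=1}^r\frac{(c_jx_i,a^2q^{2N+1}x_i/c_j;q^2,p)_{k_i}}{(q^2x_i/x_j;q^2,p)_{k_i}}$$ $$=\prod_{i=1}^r\frac{(ax_iq;q,p)_{2N}\,(abq/c_i,aq^2/bc_i;q^2,p)_N}{(aq/c_i;q,p)_{2N}\,(ax_iq^2/b,abx_iq;q^2,p)_N}.$$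
   Context: $p,q$ are complex numbers with $|p|<1$, $q\ne0$, and $q^k\notin p^{\mathbb Z}$ for all integers $k>0$ (if $p=0$: $q^k\ne1$). For $x\ne0$, $\theta(x;p)=\prod_{j=0}^\infty(1-p^jx)(1-p^{j+1}/x)$. Elliptic shifted factorials: $(a;q,p)_k=\prod_{j=0}^{k-1}\theta(aq^j;p)$ for $k\in\mathbb Z_{\ge0}$ (similarly with base $q^2$), and $(a_1,\dots,a_m;q,p)_k=(a_1;q,p)_k\cdots(a_m;q,p)_k$. For $\mathbf k=(k_1,\dots,k_r)$, $|\mathbf k|=k_1+\cdots+k_r$ and $e_2(\mathbf k)=\sum_{1\le i<j\le r}k_ik_j$. For $\mathbf x=(x_1,\dots,x_r)$, $\Delta(\mathbf x;p)=\prod_{1\le i<j\le r}x_j\theta(x_i/x_j;p)$, and $\mathbf xq^{2\mathbf k}=(x_1q^{2k_1},\dots,x_rq^{2k_r})$. In expressions such as $q^{-2N}/ax_i$, everything after the slash is in the denominator. All parameters are assumed generic so that no denominator vanishes. *)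

theory Defs
  imports "HOL-Analysis.Analysis"
begin

text \<open>
  Modified theta function. For \<open>\<bar>p\<bar> < 1\<close> and \<open>x \<noteq> 0\<close> the product converges, possibly to 0 because
  of finitely many vanishing factors (which \<^const>\<open>prodinf\<close> allows). Since \<open>0 ^ 0 = 1\<close>, the case
  \<open>p = 0\<close> gives \<open>1 - x\<close>.
\<close>

definition theta :: "complex \<Rightarrow> complex \<Rightarrow> complex" where
  "theta x p = (\<Prod>j. (1 - p ^ j * x) * (1 - p ^ (j + 1) / x))"

definition ell_fact :: "complex \<Rightarrow> complex \<Rightarrow> complex \<Rightarrow> nat \<Rightarrow> complex" where
  "ell_fact a q p k = (\<Prod>j<k. theta (a * q ^ j) p)"

text \<open>\<open>ell_facts [a\<^sub>1, \<dots>, a\<^sub>m] q p k\<close> is \<open>(a\<^sub>1, \<dots>, a\<^sub>m; q, p)\<^sub>k\<close>.\<close>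

definition ell_facts :: "complex list \<Rightarrow> complex \<Rightarrow> complex \<Rightarrow> nat \<Rightarrow> complex" where
  "ell_facts as q p k = (\<Prod>a\<leftarrow>as. ell_fact a q p k)"

text \<open>Vectors of length \<open>r\<close> are functions on \<^typ>\<open>nat\<close> of which only the values on \<open>{1..r}\<close> matter.\<close>

definition vsum :: "nat \<Rightarrow> (nat \<Rightarrow> nat) \<Rightarrow> nat" where
  "vsum r k = (\<Sum>i\<in>{1..r}. k i)"

definition e2 :: "nat \<Rightarrow> (nat \<Rightarrow> nat) \<Rightarrow> nat" where
  "e2 r k = (\<Sum>i\<in>{1..r}. \<Sum>j\<in>{i<..r}. k i * k j)"

definition Delta :: "nat \<Rightarrow> (nat \<Rightarrow> complex) \<Rightarrow> complex \<Rightarrow> complex" where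
  "Delta r x p = (\<Prod>i\<in>{1..r}. \<Prod>j\<in>{i<..r}. x j * theta (x i / x j) p)"

text \<open>
  The extensional function space contains each vector \<open>(k\<^sub>1, \<dots>, k\<^sub>r)\<close> exactly once.
\<close>

definition multi_indices :: "nat \<Rightarrow> nat \<Rightarrow> (nat \<Rightarrow> nat) set" where
  "multi_indices r N = {k \<in> {1..r} \<rightarrow>\<^sub>E UNIV. vsum r k \<le> N}"

lemma finite_multi_indices: "finite (multi_indices r N)"
proof (rule finite_subset)
  show "multi_indices r N \<subseteq> {1..r} \<rightarrow>\<^sub>E {..N}"
  proof
    fix k assume k: "k \<in> multi_indices r N"
    have "k i \<le> N" if "i \<in> {1..r}" for i
      using k member_le_sum[of i "{1..r}" k] that
      by (force simp: multi_indices_def vsum_def)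
    with k show "k \<in> {1..r} \<rightarrow>\<^sub>E {..N}"
      by (auto simp: multi_indices_def PiE_iff)
  qed
qed (auto intro: finite_PiE)

end

theory Submission
  imports Defs
begin

text \<open>
  Multiply by the denominators that depend on \<open>b\<close>. By the Jacobi triple product,
  \<open>\<theta>(x y) \<theta>(x / y) = A\<^sub>0(x) B\<^sub>0(y) + A\<^sub>1(x) B\<^sub>1(y)\<close>, so every \<open>\<theta>(A b) \<theta>(A q / b)\<close> is a linear
  form in two fixed functions \<open>u(b)\<close>, \<open>v(b)\<close>, and both sides of the identity are binary forms of
  degree \<open>r N\<close> in \<open>u\<close>, \<open>v\<close>. It therefore suffices to compare them at \<open>r N + 1\<close> values of \<open>b\<close>.
  At \<open>b = 1\<close> only the term \<open>k = 0\<close> survives. At \<open>b = q\<^bsup>1 - 2J\<^esup> / (a x\<^sub>i)\<close> with \<open>1 \<le> J \<le> N\<close> only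
  the terms with \<open>k\<^sub>i \<ge> J\<close> survive, and the substitution \<open>k\<^sub>i \<mapsto> k\<^sub>i + J\<close> turns the identity
  into a multiple of itself with \<open>N - J\<close>, \<open>a q\<^sup>J\<close>, \<open>x\<^sub>i q\<^bsup>2J\<^esup>\<close>, \<open>b q\<^sup>J\<close> in place of
  \<open>N\<close>, \<open>a\<close>, \<open>x\<^sub>i\<close>, \<open>b\<close>, so that induction on \<open>N\<close> applies. This argument needs \<open>a\<close> to
  avoid countably many values; the remaining \<open>a\<close> follow by continuity.
\<close>

section \<open>The theta function and the Jacobi triple product\<close>

text \<open>The points b attached to J are zeros of the cleared denominators: the quotient of
  \<open>(a b x_i q; q^2)_N\<close> by its part of length k_i contains \<open>theta 1\<close> when
  k_i < J. J = 0 would return the identity unchanged, so r N nodes are usable and b = 1 supplies the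
  missing point. The summand reproduces itself because \<open>a ^ 2 * q ^ (2 * N + 1)\<close> is
  invariant, so that no c_j moves, and because the powers \<open>q ^ (J * k_m)\<close> that e_2(k)
  costs are returned by reversing \<open>(q^{-2N} / a x_i; q)\<close>. Interpolation needs values of
  b with pairwise independent vectors (u, v). The forms are unchanged under b -> q / b, so nodes
  must also be kept apart from each other's reflections; that is a condition on
  \<open>a ^ 2 * x i * x j\<close> times odd powers of q which the nonvanishing of the denominators
  does not give in general. Hence the excluded values of a. The triple product serves twice:
  separating parities in a double series gives the two-dimensional space explicitly, without
  counting zeros and including p = 0, and the Laurent series gives continuity of theta.\<close>

lemma summable_theta_bound:
  fixes R y :: real
  assumes "0 \<le> R" "R < 1" "0 \<le> y"
  shows "summable (\<lambda>n. R ^ (n * (n - 1) div 2) * y ^ n)"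
proof -
  \<comment> \<open>The triangular exponent grows by n, so the ratio of consecutive terms is
    \<open>R ^ n * y\<close>.\<close>
  have "(\<lambda>n. R ^ n * y) \<longlonglongrightarrow> 0 * y"
    using assms by (intro tendsto_intros) auto
  then have "eventually (\<lambda>n. R ^ n * y < 1/2) sequentially"
    by (rule order_tendstoD) auto
  then obtain n0 where n0: "\<And>n. n \<ge> n0 \<Longrightarrow> R ^ n * y < 1/2"
    by (auto simp: eventually_sequentially)
  show ?thesis
  proof (rule summable_ratio_test[of "1/2" n0])
    fix n assume n: "n0 \<le> n"
    have e: "Suc n * (Suc n - 1) div 2 = n * (n - 1) div 2 + n"
      by (cases n) (simp_all add: algebra_simps)
    show "norm (R ^ (Suc n * (Suc n - 1) div 2) * y ^ Suc n)
        \<le> 1/2 * norm (R ^ (n * (n - 1) div 2) * y ^ n)"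
      unfolding e using n0[OF n] assms mult_right_mono[of "R ^ n * y" "1/2" "R ^ (n * (n - 1) div 2) * y ^ n"]
      by (simp add: abs_mult power_add mult_ac)
  qed simp
qed

lemma summable_theta_bound':
  fixes R y :: real
  assumes "0 \<le> R" "R < 1" "0 \<le> y"
  shows "summable (\<lambda>n. R ^ (n * (n + 1) div 2) * y ^ n)"
proof (rule summable_comparison_test'[OF summable_theta_bound[OF assms]])
  fix n :: nat
  have "R ^ (n * (n + 1) div 2) \<le> R ^ (n * (n - 1) div 2)"
    using assms by (intro power_decreasing div_le_mono mult_le_mono) auto
  then show "norm (R ^ (n * (n + 1) div 2) * y ^ n) \<le> R ^ (n * (n - 1) div 2) * y ^ n"
    using assms by (simp add: abs_mult mult_right_mono)
qed

lemma convergent_prod_theta: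
  assumes "norm p < 1"
  shows "convergent_prod (\<lambda>j. (1 - p ^ j * x) * (1 - p ^ (j + 1) / x :: complex))"
proof (rule convergent_prod_mult)
  have s: "summable (\<lambda>j. norm (p ^ j * c))" for c
    using assms by (auto simp: norm_mult norm_power intro!: summable_mult2 summable_geometric)
  show "convergent_prod (\<lambda>j. 1 - p ^ j * x)"
    using s[of x] by (intro abs_convergent_prod_imp_convergent_prod)
       (simp add: abs_convergent_prod_conv_summable)
  show "convergent_prod (\<lambda>j. 1 - p ^ (j + 1) / x)"
    using s[of "p / x"] by (intro abs_convergent_prod_imp_convergent_prod)
       (simp add: abs_convergent_prod_conv_summable mult_ac)
qed

lemma theta_LIMSEQ:
  assumes "norm p < 1"
  shows "(\<lambda>n. \<Prod>j<n. (1 - p ^ j * x) * (1 - p ^ (j + 1) / x)) \<longlonglongrightarrow> theta x p"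
proof -
  have "(\<lambda>n. \<Prod>j\<le>n. (1 - p ^ j * x) * (1 - p ^ (j + 1) / x)) \<longlonglongrightarrow> theta x p"
    unfolding theta_def by (rule convergent_prod_LIMSEQ[OF convergent_prod_theta[OF assms]])
  then show ?thesis
    by (subst filterlim_sequentially_Suc[symmetric]) (simp only: lessThan_Suc_atMost)
qed

text \<open>A convergent infinite product vanishes only through one of its factors.\<close>

lemma theta_eq_0_iff:
  assumes "norm p < 1"
  shows "theta x p = 0 \<longleftrightarrow> (\<exists>j. p ^ j * x = 1 \<or> p ^ (j + 1) / x = 1)"
proof -
  have "(\<lambda>j. (1 - p ^ j * x) * (1 - p ^ (j + 1) / x)) has_prod theta x p"
    unfolding theta_def by (rule convergent_prod_has_prod[OF convergent_prod_theta[OF assms]])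
  from has_prod_eq_0_iff[OF this] show ?thesis by auto
qed

lemma theta_one [simp]: "norm p < 1 \<Longrightarrow> theta 1 p = 0"
  by (subst theta_eq_0_iff) (auto intro!: exI[of _ 0])

text \<open>Exchanging x and 1 / x only replaces the factor 1 - x by 1 - 1 / x. With truncations of
  unequal lengths n + 1 and n for the two halves of the product, this is exact before the limit is
  taken.\<close>

lemma theta_inverse:
  assumes p: "norm p < 1" and x: "x \<noteq> 0"
  shows "theta (1 / x) p = - theta x p / x"
proof -
  define A where "A y n = (\<Prod>j<n. 1 - p ^ j * y)" for y :: complex and n
  have th: "(\<Prod>j<n. (1 - p ^ j * y) * (1 - p ^ (j + 1) / y)) = A y n * A (p / y) n" for y n
    by (simp add: A_def prod.distrib mult_ac)
  have s: "A y (Suc n) = (1 - y) * A (p * y) n" for y n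
    unfolding A_def by (subst prod.lessThan_Suc_shift) (simp add: mult_ac)
  have eq: "A (1/x) (Suc n) * A (p * x) n = - (A x (Suc n) * A (p / x) n) / x" for n
    unfolding s using x by (simp add: field_simps)
  have lim: "(\<lambda>n. A y n) \<longlonglongrightarrow> prodinf (\<lambda>j. 1 - p ^ j * y)" for y
  proof -
    have "summable (\<lambda>j. norm (p ^ j * y))"
      using p by (auto simp: norm_mult norm_power intro!: summable_mult2 summable_geometric)
    then have "convergent_prod (\<lambda>j. 1 - p ^ j * y)"
      by (intro abs_convergent_prod_imp_convergent_prod) (simp add: abs_convergent_prod_conv_summable)
    from convergent_prod_LIMSEQ[OF this] show ?thesis
      unfolding A_def by (subst filterlim_sequentially_Suc[symmetric]) (simp only: lessThan_Suc_atMost)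
  qed
  define P where "P y = prodinf (\<lambda>j. 1 - p ^ j * y)" for y :: complex
  note lim = lim[folded P_def]
  have thP: "theta y p = P y * P (p / y)" for y
    using LIMSEQ_unique[OF theta_LIMSEQ[OF p, of y, unfolded th] tendsto_mult[OF lim lim]] .
  have "(\<lambda>n. A (1/x) (Suc n) * A (p * x) n) \<longlonglongrightarrow> P (1 / x) * P (p * x)"
    by (intro tendsto_mult lim LIMSEQ_Suc)
  moreover have "(\<lambda>n. - (A x (Suc n) * A (p / x) n) / x) \<longlonglongrightarrow> - (P x * P (p / x)) / x"
    by (intro tendsto_intros lim LIMSEQ_Suc x)
  ultimately have "P (1 / x) * P (p * x) = - (P x * P (p / x)) / x"
    unfolding eq by (rule LIMSEQ_unique)
  then show ?thesis
    by (simp add: thP)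
qed

section \<open>Finite form of the Jacobi triple product\<close>

definition qfact :: "complex \<Rightarrow> nat \<Rightarrow> complex" where
  "qfact p n = (\<Prod>j<n. 1 - p ^ (j + 1))"

definition qfact_inf :: "complex \<Rightarrow> complex" where
  "qfact_inf p = prodinf (\<lambda>j. 1 - p ^ (j + 1))"

lemma qfact_Suc: "qfact p (Suc n) = (1 - p ^ (n + 1)) * qfact p n"
  by (simp add: qfact_def)

lemma qfact_0: "qfact p 0 = 1"
  by (simp add: qfact_def)

lemma one_minus_power_nonzero:
  fixes p :: complex
  assumes "norm p < 1"
  shows "1 - p ^ (j + 1) \<noteq> 0"
proof
  assume "1 - p ^ (j + 1) = 0"
  then have "norm (p ^ (j + 1)) = 1"
    by simp
  moreover have "norm p ^ (j + 1) < 1"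
    using assms by (intro power_less_one_iff[THEN iffD2]) auto
  ultimately show False
    by (simp only: norm_power)
qed

lemma qfact_nonzero: "norm p < 1 \<Longrightarrow> qfact p n \<noteq> 0"
  using one_minus_power_nonzero by (auto simp: qfact_def)

lemma qfact_LIMSEQ:
  assumes "norm p < 1"
  shows "qfact p \<longlonglongrightarrow> qfact_inf p" and "qfact_inf p \<noteq> 0"
proof -
  have "summable (\<lambda>j. norm (p ^ j * p))"
    using assms by (auto simp: norm_mult norm_power intro!: summable_mult2 summable_geometric)
  then have c: "convergent_prod (\<lambda>j. 1 - p ^ (j + 1))"
    by (intro abs_convergent_prod_imp_convergent_prod)
       (simp add: abs_convergent_prod_conv_summable mult_ac)
  from convergent_prod_LIMSEQ[OF this] show "qfact p \<longlonglongrightarrow> qfact_inf p"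
    unfolding qfact_def [abs_def] qfact_inf_def
    by (subst filterlim_sequentially_Suc[symmetric]) (simp only: lessThan_Suc_atMost)
  show "qfact_inf p \<noteq> 0"
    unfolding qfact_inf_def using one_minus_power_nonzero[OF assms] prodinf_nonzero[OF c] by blast
qed

text \<open>The reciprocal \<open>1 / (p; p)\<^sub>m\<close> is naturally 0 for negative \<open>m\<close>.\<close>

definition rqfact :: "complex \<Rightarrow> int \<Rightarrow> complex" where
  "rqfact p m = (if m < 0 then 0 else 1 / qfact p (nat m))"

lemma rqfact_nat: "rqfact p (int m) = 1 / qfact p m"
  by (simp add: rqfact_def)

lemma rqfact_neg: "m < 0 \<Longrightarrow> rqfact p m = 0"
  by (simp add: rqfact_def)

lemma rqfact_rec:
  assumes "norm p < 1" "m \<ge> 0"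
  shows "rqfact p (m - 1) = (1 - p ^ nat m) * rqfact p m"
proof (cases "m = 0")
  case False
  then obtain k where k: "m = int (Suc k)"
    using assms by (metis gr0_implies_Suc nat_0_le nat_0_iff not_gr_zero order_antisym)
  have "1 - p ^ Suc k \<noteq> 0"
    using one_minus_power_nonzero[OF assms(1), of k] by (simp only: Suc_eq_plus1) simp
  then show ?thesis
    using k qfact_nonzero[OF assms(1)] by (simp add: rqfact_def qfact_Suc field_simps nat_add_distrib)
qed (simp add: rqfact_def)

definition tri :: "int \<Rightarrow> nat" where
  "tri k = nat (k * (k - 1) div 2)"

lemma tri_eq: "2 * int (tri k) = k * (k - 1)"
proof -
  have "even (k * (k - 1))" by simp
  moreover have "k * (k - 1) \<ge> 0"
    by (cases "k \<ge> 1") (auto simp: mult_nonpos_nonpos)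
  ultimately show ?thesis
    by (simp add: tri_def)
qed

definition theta_coeff :: "complex \<Rightarrow> int \<Rightarrow> complex" where
  "theta_coeff p k = (-1) powi k * p ^ tri k"

text \<open>The bracket is the Gaussian binomial coefficient of 2 n over n + k in base p. The zero
  convention of \<open>rqfact\<close> lets k range over all integers, so that sums can be shifted
  without boundary terms.\<close>

definition theta_coeff_fin :: "complex \<Rightarrow> nat \<Rightarrow> int \<Rightarrow> complex" where
  "theta_coeff_fin p n k =
     theta_coeff p k * (qfact p (2 * n) * rqfact p (int n - k) * rqfact p (int n + k))"

lemma theta_coeff_fin_eq_0: "\<bar>k\<bar> > int n \<Longrightarrow> theta_coeff_fin p n k = 0"
  by (auto simp: theta_coeff_fin_def rqfact_def)

text \<open>Passing from n to n + 1 multiplies the product by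
  \<open>(1 - p ^ n * x) * (1 - p ^ (n + 1) / x)\<close>, that is by
  \<open>1 + p ^ (2 * n + 1) - p ^ n * x - p ^ (n + 1) / x\<close>. The recurrence is the comparison
  of coefficients of \<open>x powi k\<close>.\<close>

lemma theta_coeff_fin_rec:
  assumes p: "norm p < 1"
  shows "theta_coeff_fin p (Suc n) k = (1 + p ^ (2 * n + 1)) * theta_coeff_fin p n k
     - p ^ n * theta_coeff_fin p n (k - 1) - p ^ (n + 1) * theta_coeff_fin p n (k + 1)"
proof -
  have half: "a = b" if "2 * int a = 2 * int b" for a b
    using that by simp
  \<comment> \<open>At distance n + 1 from 0 a single term survives on the right. These two cases
    are kept apart because \<open>rqfact_rec\<close> is available for nonnegative arguments
    only.\<close>
  consider "\<bar>k\<bar> > int n + 1" | "k = int n + 1" | "k = - int n - 1" | "\<bar>k\<bar> \<le> int n"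
    by linarith
  then show ?thesis
  proof cases
    case 1
    then show ?thesis by (simp add: theta_coeff_fin_eq_0)
  next
    case 2
    have "2 * int (tri (int n + 1)) = 2 * int (n + tri (int n))"
      using tri_eq[of "int n + 1"] tri_eq[of "int n"] by (simp add: algebra_simps)
    then have t: "tri (int n + 1) = n + tri (int n)" by (rule half)
    have a: "int (Suc n) - k = int 0" "int (Suc n) + k = int (2 * Suc n)" "int n - k < 0"
      "int n - (k - 1) = int 0" "int n + (k - 1) = int (2 * n)" "int n - (k + 1) < 0"
      using 2 by simp_all
    show ?thesis
      unfolding theta_coeff_fin_def a(1,2,4,5) rqfact_nat rqfact_neg[OF a(3)] rqfact_neg[OF a(6)]
      using 2 qfact_nonzero[OF p]
      by (simp add: theta_coeff_def t power_add power_int_add qfact_0 del: mult_Suc_right of_nat_mult)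
  next
    case 3
    have "2 * int (tri (- int n - 1)) = 2 * int (n + 1 + tri (- int n))"
      using tri_eq[of "- int n - 1"] tri_eq[of "- int n"] by (simp add: algebra_simps)
    then have t: "tri (- int n - 1) = n + 1 + tri (- int n)" by (rule half)
    have a: "int (Suc n) + k = int 0" "int (Suc n) - k = int (2 * Suc n)" "int n + k < 0"
      "int n + (k + 1) = int 0" "int n - (k + 1) = int (2 * n)" "int n + (k - 1) < 0"
      using 3 by simp_all
    show ?thesis
      unfolding theta_coeff_fin_def a(1,2,4,5) rqfact_nat rqfact_neg[OF a(3)] rqfact_neg[OF a(6)]
      using 3 qfact_nonzero[OF p]
      by (simp add: theta_coeff_def t power_add power_int_diff qfact_0 del: mult_Suc_right of_nat_mult)
  next
    case 4
    define s t where "s = nat (int n - k)" and "t = nat (int n + k)"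
    have st: "int n - k = int s" "int n + k = int t"
      using 4 by (auto simp: s_def t_def)
    have n2: "2 * n = s + t" using st by linarith
    have "2 * int (n + tri (k - 1)) = 2 * int (tri k + (s + 1))"
      using tri_eq[of "k - 1"] tri_eq[of k] st by (simp add: algebra_simps)
    then have t1: "n + tri (k - 1) = tri k + (s + 1)" by (rule half)
    have "2 * int (n + 1 + tri (k + 1)) = 2 * int (tri k + (t + 1))"
      using tri_eq[of "k + 1"] tri_eq[of k] st by (simp add: algebra_simps)
    then have t2: "n + 1 + tri (k + 1) = tri k + (t + 1)" by (rule half)
    have c1: "p ^ n * theta_coeff p (k - 1) = - theta_coeff p k * p ^ (s + 1)"
      by (simp add: theta_coeff_def power_int_diff power_add[symmetric] t1)
    have c2: "p ^ (n + 1) * theta_coeff p (k + 1) = - theta_coeff p k * p ^ (t + 1)"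
    proof -
      have "p ^ (n + 1) * theta_coeff p (k + 1) = - ((-1) powi k) * p ^ (n + 1 + tri (k + 1))"
        by (simp add: theta_coeff_def power_int_add power_add)
      then show ?thesis
        unfolding t2 by (simp add: theta_coeff_def power_add mult_ac)
    qed
    define u v where "u = rqfact p (int s + 1)" and "v = rqfact p (int t + 1)"
    have r1: "rqfact p (int s) = (1 - p ^ (s + 1)) * u"
      using rqfact_rec[OF p, of "int s + 1"] by (simp add: u_def nat_add_distrib)
    have r2: "rqfact p (int t) = (1 - p ^ (t + 1)) * v"
      using rqfact_rec[OF p, of "int t + 1"] by (simp add: v_def nat_add_distrib)
    have r3: "rqfact p (int s - 1) = (1 - p ^ s) * rqfact p (int s)"
      using rqfact_rec[OF p, of "int s"] by simp
    have r4: "rqfact p (int t - 1) = (1 - p ^ t) * rqfact p (int t)"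
      using rqfact_rec[OF p, of "int t"] by simp
    have q: "qfact p (2 * Suc n) = (1 - p ^ (s + t + 2)) * (1 - p ^ (s + t + 1)) * qfact p (s + t)"
    proof -
      have e: "2 * Suc n = Suc (Suc (s + t))" using n2 by simp
      show ?thesis unfolding e qfact_Suc by (simp add: mult_ac)
    qed
    have a: "int (Suc n) - k = int s + 1" "int (Suc n) + k = int t + 1"
      "int n - (k - 1) = int s + 1" "int n + (k - 1) = int t - 1"
      "int n - (k + 1) = int s - 1" "int n + (k + 1) = int t + 1"
      using st by linarith+
    \<comment> \<open>All four coefficients are multiples of \<open>Q\<close>, which carries the
      largest denominators, of lengths \<open>s + 1\<close> and \<open>t + 1\<close>. What remains
      is a polynomial identity in p, \<open>p ^ s\<close> and \<open>p ^ t\<close>.\<close>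
    define Q where "Q = theta_coeff p k * qfact p (s + t) * u * v"
    have L: "theta_coeff_fin p (Suc n) k = Q * ((1 - p ^ (s + t + 2)) * (1 - p ^ (s + t + 1)))"
      unfolding theta_coeff_fin_def a q Q_def u_def v_def by (simp add: mult_ac)
    have M0: "theta_coeff_fin p n k = Q * ((1 - p ^ (s + 1)) * (1 - p ^ (t + 1)))"
      unfolding theta_coeff_fin_def n2 st r1 r2 Q_def by (simp add: mult_ac)
    have M1: "p ^ n * theta_coeff_fin p n (k - 1) = - (p ^ (s + 1)) * Q * ((1 - p ^ t) * (1 - p ^ (t + 1)))"
    proof -
      have "p ^ n * theta_coeff_fin p n (k - 1) = (p ^ n * theta_coeff p (k - 1)) *
          (qfact p (s + t) * u * rqfact p (int t - 1))"
        unfolding theta_coeff_fin_def n2 a u_def by (simp add: mult_ac)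
      then show ?thesis
        unfolding c1 r4 r2 Q_def by (simp add: mult_ac)
    qed
    have M2: "p ^ (n + 1) * theta_coeff_fin p n (k + 1) = - (p ^ (t + 1)) * Q * ((1 - p ^ s) * (1 - p ^ (s + 1)))"
    proof -
      have "p ^ (n + 1) * theta_coeff_fin p n (k + 1) = (p ^ (n + 1) * theta_coeff p (k + 1)) *
          (qfact p (s + t) * rqfact p (int s - 1) * v)"
        unfolding theta_coeff_fin_def n2 a v_def by (simp add: mult_ac)
      then show ?thesis
        unfolding c2 r3 r1 Q_def by (simp add: mult_ac)
    qed
    show ?thesis
      unfolding L M0 M1 M2 n2 by (simp add: power_add algebra_simps power2_eq_square)
  qed
qed

lemma theta_finite_sum:
  assumes p: "norm p < 1" and x: "x \<noteq> 0"
  shows "(\<Prod>j<n. (1 - p ^ j * x) * (1 - p ^ (j + 1) / x)) =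
         (\<Sum>k\<in>{-int n..int n}. theta_coeff_fin p n k * x powi k)"
proof (induction n)
  case 0
  show ?case by (simp add: theta_coeff_fin_def theta_coeff_def tri_def rqfact_def qfact_def)
next
  case (Suc n)
  let ?c = "theta_coeff_fin p n" and ?I = "{- int (Suc n)..int (Suc n)}"
  have ext: "(\<Sum>k\<in>{-int n..int n}. ?c k * x powi k) = (\<Sum>k\<in>?I. ?c k * x powi k)"
    by (rule sum.mono_neutral_left) (auto simp: theta_coeff_fin_eq_0)
  have s1: "(\<Sum>k\<in>{-int n..int n}. ?c k * x powi k) * x = (\<Sum>k\<in>?I. ?c (k - 1) * x powi k)"
  proof -
    have "(\<Sum>k\<in>{-int n..int n}. ?c k * x powi k) * x
        = (\<Sum>k\<in>{-int n+1..int n+1}. ?c (k - 1) * x powi k)"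
      unfolding sum_distrib_right
      by (rule sum.reindex_bij_witness[of _ "\<lambda>k. k - 1" "\<lambda>k. k + 1"])
         (use x in \<open>auto simp: power_int_add\<close>)
    also have "\<dots> = (\<Sum>k\<in>?I. ?c (k - 1) * x powi k)"
      by (rule sum.mono_neutral_left) (auto simp: theta_coeff_fin_eq_0)
    finally show ?thesis .
  qed
  have s2: "(\<Sum>k\<in>{-int n..int n}. ?c k * x powi k) / x = (\<Sum>k\<in>?I. ?c (k + 1) * x powi k)"
  proof -
    have "(\<Sum>k\<in>{-int n..int n}. ?c k * x powi k) / x
        = (\<Sum>k\<in>{-int n-1..int n-1}. ?c (k + 1) * x powi k)"
      unfolding sum_divide_distrib
      by (rule sum.reindex_bij_witness[of _ "\<lambda>k. k + 1" "\<lambda>k. k - 1"])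
         (use x in \<open>auto simp: power_int_diff\<close>)
    also have "\<dots> = (\<Sum>k\<in>?I. ?c (k + 1) * x powi k)"
      by (rule sum.mono_neutral_left) (auto simp: theta_coeff_fin_eq_0)
    finally show ?thesis .
  qed
  let ?S = "\<Sum>k\<in>{-int n..int n}. ?c k * x powi k"
  have "(\<Prod>j<Suc n. (1 - p ^ j * x) * (1 - p ^ (j + 1) / x))
      = (1 + p ^ (2 * n + 1)) * ?S - p ^ n * (?S * x) - p ^ (n + 1) * (?S / x)"
    unfolding prod.lessThan_Suc Suc.IH using x
    by (simp add: field_simps power_add mult_2 power_mult power2_eq_square mult_2_right)
  also have "\<dots> = (\<Sum>k\<in>?I. theta_coeff_fin p (Suc n) k * x powi k)"
    unfolding s1 s2 unfolding ext theta_coeff_fin_rec[OF p]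
    by (simp add: sum_distrib_left sum_subtractf[symmetric] sum.distrib[symmetric] algebra_simps)
  finally show ?case .
qed

section \<open>Passage to the infinite triple product\<close>

lemma norm_theta_coeff: "norm (theta_coeff p k * x powi k) = norm p ^ tri k * norm x powi k"
  by (simp add: theta_coeff_def norm_mult norm_power norm_power_int)

lemma tri_of_nat: "tri (int n) = n * (n - 1) div 2"
proof -
  have "int n * (int n - 1) = int (n * (n - 1))"
    by (cases n) (simp_all add: algebra_simps)
  then show ?thesis
    by (simp only: tri_def)
qed

lemma tri_neg_of_nat: "tri (- int n) = n * (n + 1) div 2"
proof -
  have "- int n * (- int n - 1) = int (n * (n + 1))"
    by (simp add: algebra_simps)
  then show ?thesis
    by (simp only: tri_def)
qed

lemma summable_norm_theta_coeff_pos: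
  assumes "norm p < 1"
  shows "summable (\<lambda>n. norm p ^ tri (int n) * norm x powi int n)"
  using summable_theta_bound[of "norm p" "norm x"] assms by (simp add: tri_of_nat)

lemma summable_norm_theta_coeff_neg:
  assumes "norm p < 1"
  shows "summable (\<lambda>n. norm p ^ tri (- int n) * norm x powi (- int n))"
  using summable_theta_bound'[of "norm p" "1 / norm x"] assms
  by (simp add: tri_neg_of_nat power_int_minus inverse_eq_divide power_one_over)

lemma int_nonneg_neg_decomp: "(UNIV :: int set) = range int \<union> range (\<lambda>n. - int (Suc n))"
proof -
  have "k \<in> range int \<union> range (\<lambda>n. - int (Suc n))" for k
    by (cases k rule: int_cases) auto
  then show ?thesis by blast
qed

lemma has_sum_int_split:
  fixes f :: "int \<Rightarrow> 'a :: banach"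
  assumes "summable (\<lambda>n. norm (f (int n)))" "summable (\<lambda>n. norm (f (- int (Suc n))))"
  shows "(f has_sum (\<Sum>n. f (int n)) + (\<Sum>n. f (- int (Suc n)))) UNIV"
  unfolding int_nonneg_neg_decomp
proof (rule has_sum_Un_disjoint)
  show "(f has_sum (\<Sum>n. f (int n))) (range int)"
    by (subst has_sum_reindex) (use assms in \<open>auto intro!: norm_summable_imp_has_sum summable_norm_cancel simp: o_def\<close>)
  show "(f has_sum (\<Sum>n. f (- int (Suc n)))) (range (\<lambda>n. - int (Suc n)))"
    by (subst has_sum_reindex) (use assms in \<open>auto intro!: norm_summable_imp_has_sum summable_norm_cancel simp: o_def inj_on_def\<close>)
qed auto

lemma abs_summable_theta_coeff:
  assumes "norm p < 1"
  shows "(\<lambda>k. norm (theta_coeff p k * x powi k)) summable_on UNIV"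
proof -
  have "summable (\<lambda>n. norm (norm (theta_coeff p (int n) * x powi int n)))"
    unfolding real_norm_def abs_norm_cancel unfolding norm_theta_coeff
    by (rule summable_norm_theta_coeff_pos[OF assms])
  moreover have "summable (\<lambda>n. norm (norm (theta_coeff p (- int (Suc n)) * x powi (- int (Suc n)))))"
    unfolding real_norm_def abs_norm_cancel unfolding norm_theta_coeff
    by (subst summable_Suc_iff[where f = "\<lambda>n. norm p ^ tri (- int n) * norm x powi (- int n)"])
       (rule summable_norm_theta_coeff_neg[OF assms])
  ultimately show ?thesis
    by (blast intro: has_sum_imp_summable has_sum_int_split)
qed

text \<open>Dominated convergence in the triple product requires a bound uniform in both n and k. It
  exists because \<open>qfact p\<close> has a nonzero limit, so that it and its reciprocal are
  bounded.\<close>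

lemma qfact_ratio_bounded:
  assumes p: "norm p < 1"
  obtains C where "\<And>n k. norm (qfact p (2 * n) * rqfact p (int n - k) * rqfact p (int n + k)) \<le> C"
proof -
  have "Bseq (qfact p)"
    using qfact_LIMSEQ(1)[OF p] by (intro convergent_imp_Bseq) (auto simp: convergent_def)
  then obtain A where A: "A > 0" "\<And>n. norm (qfact p n) \<le> A"
    by (auto simp: Bseq_def)
  have "(\<lambda>n. 1 / qfact p n) \<longlonglongrightarrow> 1 / qfact_inf p"
    using qfact_LIMSEQ[OF p] by (intro tendsto_intros)
  then have "Bseq (\<lambda>n. 1 / qfact p n)"
    by (intro convergent_imp_Bseq) (auto simp: convergent_def)
  then obtain B where B: "B > 0" "\<And>n. norm (1 / qfact p n) \<le> B"
    by (auto simp: Bseq_def)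
  have B': "norm (rqfact p m) \<le> B" for m
    using B(1) B(2)[of "nat m"] by (auto simp: rqfact_def)
  show ?thesis
  proof (rule that[of "A * B * B"])
    fix n k
    show "norm (qfact p (2 * n) * rqfact p (int n - k) * rqfact p (int n + k)) \<le> A * B * B"
      unfolding norm_mult using A B(1) B' by (intro mult_mono) auto
  qed
qed

lemma theta_coeff_fin_LIMSEQ:
  assumes p: "norm p < 1"
  shows "(\<lambda>n. theta_coeff_fin p n k) \<longlonglongrightarrow> theta_coeff p k / qfact_inf p"
proof -
  note P = qfact_LIMSEQ[OF p]
  have ev: "(\<lambda>n. rqfact p (int n + l)) \<longlonglongrightarrow> 1 / qfact_inf p" for l
  proof -
    have "filterlim (\<lambda>n. nat (int n + l)) at_top sequentially"
      unfolding filterlim_at_top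
    proof
      fix Z show "eventually (\<lambda>n. Z \<le> nat (int n + l)) sequentially"
        using eventually_ge_at_top[of "Z + nat \<bar>l\<bar>"] by eventually_elim linarith
    qed
    then have "(\<lambda>n. 1 / qfact p (nat (int n + l))) \<longlonglongrightarrow> 1 / qfact_inf p"
      by (intro tendsto_intros filterlim_compose[OF P(1)] P(2))
    moreover have "eventually (\<lambda>n. 1 / qfact p (nat (int n + l)) = rqfact p (int n + l)) sequentially"
      using eventually_ge_at_top[of "nat \<bar>l\<bar>"] by eventually_elim (simp add: rqfact_def)
    ultimately show ?thesis
      by (rule Lim_transform_eventually)
  qed
  have "(\<lambda>n. qfact p (2 * n)) \<longlonglongrightarrow> qfact_inf p"
    by (rule filterlim_compose[OF P(1)]) (auto intro!: filterlim_subseq simp: strict_mono_def)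
  then have "(\<lambda>n. theta_coeff p k * (qfact p (2 * n) * rqfact p (int n + (- k)) * rqfact p (int n + k)))
      \<longlonglongrightarrow> theta_coeff p k * (qfact_inf p * (1 / qfact_inf p) * (1 / qfact_inf p))"
    by (intro tendsto_mult tendsto_const ev)
  then show ?thesis
    using P(2) by (simp add: theta_coeff_fin_def)
qed

text \<open>Termwise limit of the finite identity, justified by Tannery's theorem with majorant
  \<open>C * (norm p ^ tri k * norm x powi k)\<close>. Splitting the integers into two one-sided
  ranges makes that theorem, which concerns series over the naturals, applicable.\<close>

theorem Jacobi_triple_product:
  assumes p: "norm p < 1" and x: "x \<noteq> 0"
  shows "qfact_inf p * theta x p
     = (\<Sum>n. theta_coeff p (int n) * x powi int n)
       + (\<Sum>n. theta_coeff p (- int (Suc n)) * x powi (- int (Suc n)))"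
proof -
  let ?f = "\<lambda>n k. theta_coeff_fin p n k * x powi k"
  let ?g = "\<lambda>k. theta_coeff p k / qfact_inf p * x powi k"
  obtain C where C: "\<And>n k. norm (qfact p (2 * n) * rqfact p (int n - k) * rqfact p (int n + k)) \<le> C"
    using qfact_ratio_bounded[OF p] by blast
  have bd: "norm (?f n k) \<le> C * (norm p ^ tri k * norm x powi k)" for n k
  proof -
    have "norm (?f n k) = norm (qfact p (2 * n) * rqfact p (int n - k) * rqfact p (int n + k))
        * norm (theta_coeff p k * x powi k)"
      by (simp add: theta_coeff_fin_def norm_mult mult_ac)
    then show ?thesis
      unfolding norm_theta_coeff using C[of n k] by (simp add: mult_right_mono)
  qed
  have lim: "(\<lambda>n. ?f n k) \<longlonglongrightarrow> ?g k" for k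
    by (intro tendsto_intros theta_coeff_fin_LIMSEQ p)
  have T: "(\<lambda>n. \<Sum>k. ?f n (h k)) \<longlonglongrightarrow> (\<Sum>k. ?g (h k))"
    if "summable (\<lambda>k. norm p ^ tri (h k) * norm x powi h k)" for h :: "nat \<Rightarrow> int"
  proof (rule tannerys_theorem[THEN conjunct2, THEN conjunct2])
    show "eventually (\<lambda>(k, n). norm (?f n (h k)) \<le> C * (norm p ^ tri (h k) * norm x powi h k))
       (at_top \<times>\<^sub>F sequentially)"
      by (rule always_eventually) (use bd in auto)
    show "summable (\<lambda>k. C * (norm p ^ tri (h k) * norm x powi h k))"
      using that by (rule summable_mult)
  qed (use lim in auto)
  have s: "(\<Sum>k\<in>{- int n..int n}. ?f n k) = (\<Sum>k. ?f n (int k)) + (\<Sum>k. ?f n (- int (Suc k)))" for n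
  proof -
    have "{- int n..int n} = int ` {..n} \<union> (\<lambda>k. - int (Suc k)) ` {..<n}" (is "_ = ?A \<union> ?B")
    proof (intro equalityI subsetI)
      fix k assume k: "k \<in> {- int n..int n}"
      show "k \<in> ?A \<union> ?B"
      proof (cases k rule: int_cases)
        case (nonneg m)
        with k show ?thesis by auto
      next
        case (neg m)
        with k have "m < n" by auto
        with neg show ?thesis by blast
      qed
    qed auto
    then have "(\<Sum>k\<in>{- int n..int n}. ?f n k) = sum (?f n) ?A + sum (?f n) ?B"
      by (simp only:) (rule sum.union_disjoint, auto)
    also have "sum (?f n) ?A = (\<Sum>k\<le>n. ?f n (int k))"
      by (subst sum.reindex) auto
    also have "\<dots> = (\<Sum>k. ?f n (int k))"
      by (rule suminf_finite[symmetric]) (auto simp: theta_coeff_fin_eq_0)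
    also have "sum (?f n) ?B = (\<Sum>k<n. ?f n (- int (Suc k)))"
      by (subst sum.reindex) (auto simp: inj_on_def)
    also have "\<dots> = (\<Sum>k. ?f n (- int (Suc k)))"
      by (rule suminf_finite[symmetric]) (auto simp: theta_coeff_fin_eq_0)
    finally show ?thesis .
  qed
  have sneg: "summable (\<lambda>k. norm p ^ tri (- int (Suc k)) * norm x powi (- int (Suc k)))"
    by (subst summable_Suc_iff[where f = "\<lambda>n. norm p ^ tri (- int n) * norm x powi (- int n)"])
       (rule summable_norm_theta_coeff_neg[OF p])
  have "(\<lambda>n. \<Sum>k\<in>{- int n..int n}. ?f n k) \<longlonglongrightarrow> (\<Sum>k. ?g (int k)) + (\<Sum>k. ?g (- int (Suc k)))"
    unfolding s by (intro tendsto_add T summable_norm_theta_coeff_pos p sneg)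
  from LIMSEQ_unique[OF theta_LIMSEQ[OF p, of x, unfolded theta_finite_sum[OF p x]] this]
  have th: "theta x p = (\<Sum>k. ?g (int k)) + (\<Sum>k. ?g (- int (Suc k)))" .
  have g: "(\<Sum>k. ?g (h k)) = (\<Sum>k. theta_coeff p (h k) * x powi h k) / qfact_inf p"
    if "summable (\<lambda>k. norm p ^ tri (h k) * norm x powi h k)" for h :: "nat \<Rightarrow> int"
  proof -
    have "summable (\<lambda>k. theta_coeff p (h k) * x powi h k)"
      by (rule summable_norm_cancel) (use that in \<open>simp add: norm_theta_coeff\<close>)
    from suminf_divide[OF this, of "qfact_inf p"] show ?thesis
      by simp
  qed
  show ?thesis
    unfolding th g[of int, OF summable_norm_theta_coeff_pos[OF p]] g[OF sneg]
    using qfact_LIMSEQ(2)[OF p] by (simp only: add_divide_distrib[symmetric]) simp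
qed

lemma theta_has_sum:
  assumes p: "norm p < 1" and x: "x \<noteq> 0"
  shows "((\<lambda>k. theta_coeff p k * x powi k) has_sum (qfact_inf p * theta x p)) UNIV"
  unfolding Jacobi_triple_product[OF assms]
proof (rule has_sum_int_split)
  show "summable (\<lambda>n. norm (theta_coeff p (int n) * x powi int n))"
    unfolding norm_theta_coeff by (rule summable_norm_theta_coeff_pos[OF p])
  show "summable (\<lambda>n. norm (theta_coeff p (- int (Suc n)) * x powi (- int (Suc n))))"
    unfolding norm_theta_coeff
    by (subst summable_Suc_iff[where f = "\<lambda>n. norm p ^ tri (- int n) * norm x powi (- int n)"])
       (rule summable_norm_theta_coeff_neg[OF p])
qed

section \<open>Continuity of theta\<close>

lemma isCont_theta:
  assumes p: "norm p < 1" and x: "x \<noteq> 0"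
  shows "isCont (\<lambda>x. theta x p) x"
proof -
  let ?P = "qfact_inf p"
  \<comment> \<open>The Laurent series is split into power series in y and in 1 / y, both convergent
    everywhere. The second starts at exponent -1, which accounts for the extra division by
    y.\<close>
  define F where "F y = (\<Sum>n. theta_coeff p (int n) * y ^ n)" for y
  define G where "G y = (\<Sum>n. theta_coeff p (- int (Suc n)) * y ^ n)" for y
  have eq: "theta y p = (F y + G (1 / y) / y) / ?P" if "y \<noteq> 0" for y
  proof -
    have s: "summable (\<lambda>n. theta_coeff p (- int (Suc n)) * (1 / y) ^ n)"
    proof -
      have "summable (\<lambda>n. norm p ^ tri (- int (Suc n)) * norm y powi (- int (Suc n)))"
        by (subst summable_Suc_iff[where f = "\<lambda>n. norm p ^ tri (- int n) * norm y powi (- int n)"])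
           (rule summable_norm_theta_coeff_neg[OF p])
      then have "summable (\<lambda>n. theta_coeff p (- int (Suc n)) * y powi (- int (Suc n)))"
        by (intro summable_norm_cancel[where f = "\<lambda>n. theta_coeff p (- int (Suc n)) * y powi (- int (Suc n))"])
           (simp add: norm_theta_coeff)
      then have "summable (\<lambda>n. theta_coeff p (- int (Suc n)) * y powi (- int (Suc n)) * y)"
        by (rule summable_mult2)
      then show ?thesis
        using that by (simp add: power_int_minus power_one_over field_simps power_int_diff power_int_add)
    qed
    have "?P * theta y p = F y + (\<Sum>n. theta_coeff p (- int (Suc n)) * (1 / y) ^ n / y)"
      unfolding Jacobi_triple_product[OF p that] F_def using that
      by (simp add: power_int_minus power_one_over field_simps power_int_diff power_int_add)
    also have "(\<Sum>n. theta_coeff p (- int (Suc n)) * (1 / y) ^ n / y) = G (1 / y) / y"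
      unfolding G_def by (rule suminf_divide[OF s])
    finally show ?thesis
      using qfact_LIMSEQ(2)[OF p] by (simp add: field_simps)
  qed
  have F: "isCont F y" for y
    unfolding F_def
  proof (rule isCont_powser_converges_everywhere)
    fix z :: complex
    show "summable (\<lambda>n. theta_coeff p (int n) * z ^ n)"
      using summable_norm_theta_coeff_pos[OF p, of z] 
      by (intro summable_norm_cancel[where f = "\<lambda>n. theta_coeff p (int n) * z ^ n"])
         (simp add: theta_coeff_def norm_mult norm_power norm_power_int)
  qed
  have G: "isCont G y" for y
    unfolding G_def
  proof (rule isCont_powser_converges_everywhere)
    fix z :: complex
    have le: "norm p ^ tri (- int (Suc n)) \<le> norm p ^ tri (- int n)" for n
      using p unfolding tri_neg_of_nat by (intro power_decreasing div_le_mono mult_le_mono) auto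
    have "summable (\<lambda>n. norm p ^ tri (- int n) * norm z ^ n)"
      using summable_theta_bound'[of "norm p" "norm z"] p by (simp add: tri_neg_of_nat)
    then show "summable (\<lambda>n. theta_coeff p (- int (Suc n)) * z ^ n)"
    proof (rule summable_comparison_test'[where N = 0])
      fix n
      show "norm (theta_coeff p (- int (Suc n)) * z ^ n) \<le> norm p ^ tri (- int n) * norm z ^ n"
        using mult_right_mono[OF le[of n], of "norm z ^ n"]
        by (simp add: theta_coeff_def norm_mult norm_power norm_power_int)
    qed
  qed
  have "isCont (\<lambda>y. (F y + G (1 / y) / y) / ?P) x"
    using x qfact_LIMSEQ(2)[OF p]
    by (intro continuous_intros isCont_o2[OF _ F] isCont_o2[OF _ G]) auto
  moreover have "eventually (\<lambda>y. (F y + G (1 / y) / y) / ?P = theta y p) (nhds x)"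
    using t1_space_nhds[OF x] by eventually_elim (simp add: eq)
  ultimately show ?thesis
    by (subst isCont_cong[symmetric]) auto
qed

section \<open>Products of two theta functions\<close>

lemma infsum_product_banach:
  fixes F G :: "'a \<Rightarrow> 'b :: {banach, real_normed_div_algebra}"
  assumes "(\<lambda>(x, y). F x * G y) summable_on A \<times> B"
  shows "infsum (\<lambda>(x, y). F x * G y) (A \<times> B) = infsum F A * infsum G B"
  using infsum_Sigma_banach[OF assms]
  by (simp add: infsum_cmult_right' infsum_cmult_left')

lemma summable_on_theta_coeff_product:
  assumes p: "norm p < 1"
  shows "(\<lambda>(m, n). (theta_coeff p m * x powi m) * (theta_coeff p n * y powi n)) summable_on UNIV \<times> UNIV"
proof -
  define F where "F m = theta_coeff p m * x powi m" for m
  define G where "G m = theta_coeff p m * y powi m" for m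
  have F: "(\<lambda>m. norm (F m)) summable_on UNIV" and G: "(\<lambda>m. norm (G m)) summable_on UNIV"
    unfolding F_def G_def using abs_summable_theta_coeff[OF p] by auto
  have "(\<lambda>z. norm ((\<lambda>(m, n). F m * G n) z)) summable_on UNIV \<times> UNIV"
  proof (rule Infinite_Sum.abs_summable_on_Sigma_iff[THEN iffD2], intro conjI ballI)
    show "(\<lambda>n. norm (case (m, n) of (m, n) \<Rightarrow> F m * G n)) summable_on UNIV" for m
      using G by (simp add: norm_mult summable_on_cmult_right)
    show "(\<lambda>m. norm (\<Sum>\<^sub>\<infinity>n. norm (case (m, n) of (m, n) \<Rightarrow> F m * G n))) summable_on UNIV"
      using F by (simp add: norm_mult infsum_cmult_right' abs_mult summable_on_cmult_left infsum_nonneg)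
  qed
  then have "(\<lambda>(m, n). F m * G n) summable_on UNIV \<times> UNIV"
    by (rule abs_summable_summable)
  then show ?thesis
    by (simp only: F_def G_def)
qed

text \<open>Up to constants and a monomial, this series and the next three are theta functions of
  base p^2. The exponents \<open>s ^ 2 - s\<close> and \<open>d ^ 2 + d\<close> are nonnegative at
  all integers, so \<open>nat\<close> truncates nothing. The normalization, one
  \<open>qfact_inf p\<close> for each of the two theta functions multiplied, is put into the A
  series.\<close>

definition thetaA0 :: "complex \<Rightarrow> complex \<Rightarrow> complex" where
  "thetaA0 p x = (\<Sum>\<^sub>\<infinity>s. p ^ nat (s ^ 2 - s) * x powi (2 * s)) / qfact_inf p ^ 2"

definition thetaB0 :: "complex \<Rightarrow> complex \<Rightarrow> complex" where
  "thetaB0 p y = (\<Sum>\<^sub>\<infinity>d. p ^ nat (d ^ 2) * y powi (2 * d))"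

definition thetaA1 :: "complex \<Rightarrow> complex \<Rightarrow> complex" where
  "thetaA1 p x = - (\<Sum>\<^sub>\<infinity>s. p ^ nat (s ^ 2) * x powi (2 * s + 1)) / qfact_inf p ^ 2"

definition thetaB1 :: "complex \<Rightarrow> complex \<Rightarrow> complex" where
  "thetaB1 p y = (\<Sum>\<^sub>\<infinity>d. p ^ nat (d ^ 2 + d) * y powi (2 * d + 1))"

text \<open>
  In the double series for the left-hand side, \<open>x\<close> occurs with exponent \<open>m + n\<close> and \<open>y\<close> with
  exponent \<open>m - n\<close>. These have the same parity, and each parity contributes a product of
  two single series.
\<close>

lemma theta_mult_rank_two:
  assumes p: "norm p < 1" and x: "x \<noteq> 0" and y: "y \<noteq> 0"
  shows "theta (x * y) p * theta (x / y) p = thetaA0 p x * thetaB0 p y + thetaA1 p x * thetaB1 p y"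
proof -
  define f where "f = (\<lambda>(m, n). (theta_coeff p m * (x * y) powi m) * (theta_coeff p n * (x / y) powi n))"
  define e o' where "e = (\<lambda>(s, d). (s + d, s - d) :: int \<times> int)"
    and "o' = (\<lambda>(s, d). (s + d + 1, s - d) :: int \<times> int)"
  have sf: "f summable_on UNIV \<times> UNIV"
    unfolding f_def by (rule summable_on_theta_coeff_product[OF p])
  have "infsum f (UNIV \<times> UNIV)
      = (\<Sum>\<^sub>\<infinity>m. theta_coeff p m * (x * y) powi m) * (\<Sum>\<^sub>\<infinity>m. theta_coeff p m * (x / y) powi m)"
    unfolding f_def by (rule infsum_product_banach[OF sf[unfolded f_def]])
  also have "\<dots> = (qfact_inf p * theta (x * y) p) * (qfact_inf p * theta (x / y) p)"
    using infsumI[OF theta_has_sum[OF p, of "x * y"]] infsumI[OF theta_has_sum[OF p, of "x / y"]] x y by simp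
  finally have L: "infsum f (UNIV \<times> UNIV) = qfact_inf p ^ 2 * (theta (x * y) p * theta (x / y) p)"
    by (simp add: power2_eq_square mult_ac)
  have inj: "inj e" "inj o'"
    by (auto simp: inj_on_def e_def o'_def)
  have un: "(UNIV :: (int \<times> int) set) = range e \<union> range o'"
  proof -
    have "(m, n) \<in> range e \<union> range o'" for m n :: int
    proof (cases "even (m + n)")
      case True
      then obtain s where s: "m + n = 2 * s" by (rule evenE)
      then have "(m, n) = e (s, m - s)" by (simp add: e_def)
      then show ?thesis by blast
    next
      case False
      then obtain s where s: "m + n = 2 * s + 1" by (rule oddE)
      then have "(m, n) = o' (s, m - s - 1)" by (simp add: o'_def)
      then show ?thesis by blast
    qed
    then show ?thesis by auto
  qed
  have disj: "range e \<inter> range o' = {}"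
  proof -
    have False if "e a = o' b" for a b
    proof -
      have "fst (e a) + snd (e a) = fst (o' b) + snd (o' b)" using that by simp
      then have "2 * fst a = 2 * fst b + 1" by (simp add: e_def o'_def case_prod_beta)
      then show False by presburger
    qed
    then show ?thesis by blast
  qed
  have se: "f summable_on range e" and so: "f summable_on range o'"
    using sf by (auto intro: summable_on_subset_banach)
  have fe: "f (e z) = (case z of (s, d) \<Rightarrow> (p ^ nat (s ^ 2 - s) * x powi (2 * s)) * (p ^ nat (d ^ 2) * y powi (2 * d)))" for z
  proof (cases z)
    case (Pair s d)
    have nn: "s ^ 2 - s \<ge> 0"
      using tri_eq[of s] by (simp add: power2_eq_square algebra_simps)
    have "2 * int (tri (s + d) + tri (s - d)) = 2 * int (nat (s ^ 2 - s) + nat (d ^ 2))"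
      using tri_eq[of "s + d"] tri_eq[of "s - d"] nn by (simp add: algebra_simps power2_eq_square)
    then have t: "tri (s + d) + tri (s - d) = nat (s ^ 2 - s) + nat (d ^ 2)"
      by (simp only: mult_cancel_left of_nat_eq_iff) simp
    have "f (e z) = ((-1) powi (s + d) * (-1) powi (s - d)) * p ^ (tri (s + d) + tri (s - d))
        * ((x powi (s + d) * x powi (s - d)) * (y powi (s + d) / y powi (s - d)))"
      by (simp add: Pair f_def e_def theta_coeff_def power_add power_int_mult_distrib power_int_divide_distrib mult_ac)
    also have "(-1 :: complex) powi (s + d) * (-1) powi (s - d) = 1"
      by (simp add: power_int_add[symmetric] power_int_mult)
    also have "x powi (s + d) * x powi (s - d) = x powi (2 * s)"
      using x by (simp add: power_int_add[symmetric])
    also have "y powi (s + d) / y powi (s - d) = y powi (2 * d)"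
      using y by (simp add: power_int_diff[symmetric])
    finally show ?thesis
      by (simp add: Pair t power_add mult_ac)
  qed
  have fo: "f (o' z) = - (case z of (s, d) \<Rightarrow> (p ^ nat (s ^ 2) * x powi (2 * s + 1)) * (p ^ nat (d ^ 2 + d) * y powi (2 * d + 1)))" for z
  proof (cases z)
    case (Pair s d)
    have nn: "d ^ 2 + d \<ge> 0"
      using tri_eq[of "d + 1"] by (simp add: power2_eq_square algebra_simps)
    have "2 * int (tri (s + d + 1) + tri (s - d)) = 2 * int (nat (s ^ 2) + nat (d ^ 2 + d))"
      using tri_eq[of "s + d + 1"] tri_eq[of "s - d"] nn by (simp add: algebra_simps power2_eq_square)
    then have t: "tri (s + d + 1) + tri (s - d) = nat (s ^ 2) + nat (d ^ 2 + d)"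
      by (simp only: mult_cancel_left of_nat_eq_iff) simp
    have "f (o' z) = ((-1) powi (s + d + 1) * (-1) powi (s - d)) * p ^ (tri (s + d + 1) + tri (s - d))
        * ((x powi (s + d + 1) * x powi (s - d)) * (y powi (s + d + 1) / y powi (s - d)))"
      by (simp add: Pair f_def o'_def theta_coeff_def power_add power_int_mult_distrib power_int_divide_distrib mult_ac)
    also have "(-1 :: complex) powi (s + d + 1) * (-1) powi (s - d) = - 1"
      by (simp add: power_int_add[symmetric])
    also have "x powi (s + d + 1) * x powi (s - d) = x powi (2 * s + 1)"
      using x by (simp add: power_int_add[symmetric])
    also have "y powi (s + d + 1) / y powi (s - d) = y powi (2 * d + 1)"
      using y by (simp add: power_int_diff[symmetric])
    finally show ?thesis
      by (simp add: Pair t power_add mult_ac)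
  qed
  have "infsum f (range e) = infsum (f \<circ> e) (UNIV \<times> UNIV)"
    using inj by (simp add: infsum_reindex)
  also have "\<dots> = qfact_inf p ^ 2 * thetaA0 p x * thetaB0 p y"
  proof -
    have "(f \<circ> e) summable_on (UNIV \<times> UNIV)"
      using se inj by (simp add: summable_on_reindex)
    from infsum_product_banach[OF this[unfolded fe o_def]] show ?thesis
      unfolding fe o_def thetaA0_def thetaB0_def using qfact_LIMSEQ(2)[OF p] by simp
  qed
  finally have Ev: "infsum f (range e) = qfact_inf p ^ 2 * thetaA0 p x * thetaB0 p y" .
  have "infsum f (range o') = infsum (f \<circ> o') (UNIV \<times> UNIV)"
    using inj by (simp add: infsum_reindex)
  also have "\<dots> = qfact_inf p ^ 2 * thetaA1 p x * thetaB1 p y"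
  proof -
    have "(f \<circ> o') summable_on (UNIV \<times> UNIV)"
      using so inj by (simp add: summable_on_reindex)
    then have "(\<lambda>z. - (f (o' z))) summable_on (UNIV \<times> UNIV)"
      by (simp add: o_def summable_on_uminus)
    from infsum_product_banach[OF this[unfolded fo minus_minus]] show ?thesis
      unfolding fo o_def thetaA1_def thetaB1_def infsum_uminus using qfact_LIMSEQ(2)[OF p] by simp
  qed
  finally have Od: "infsum f (range o') = qfact_inf p ^ 2 * thetaA1 p x * thetaB1 p y" .
  have "infsum f (UNIV \<times> UNIV) = infsum f (range e) + infsum f (range o')"
    using arg_cong[OF un, of "infsum f"] unfolding infsum_Un_disjoint[OF se so disj] UNIV_Times_UNIV .
  then have "qfact_inf p ^ 2 * (theta (x * y) p * theta (x / y) p)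
      = qfact_inf p ^ 2 * (thetaA0 p x * thetaB0 p y + thetaA1 p x * thetaB1 p y)"
    unfolding L Ev Od by (simp only: distrib_left mult.assoc)
  then show ?thesis
    using qfact_LIMSEQ(2)[OF p] by simp
qed

section \<open>Binary forms\<close>

text \<open>The functions u and v are arbitrary and the coefficients need not be unique; the degree
  is formal, so the zero function is a form of every degree. S will be the set of nonzero b, where
  the theta decomposition is available.\<close>

definition binary_form :: "'b set \<Rightarrow> ('b \<Rightarrow> complex) \<Rightarrow> ('b \<Rightarrow> complex) \<Rightarrow> nat \<Rightarrow> ('b \<Rightarrow> complex) \<Rightarrow> bool" where
  "binary_form S u v n f \<longleftrightarrow> (\<exists>c. \<forall>b\<in>S. f b = (\<Sum>i\<le>n. c i * u b ^ i * v b ^ (n - i)))"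

lemma binary_form_monomial:
  assumes "i \<le> n"
  shows "binary_form S u v n (\<lambda>b. k * u b ^ i * v b ^ (n - i))"
  unfolding binary_form_def
proof (intro exI ballI)
  fix b
  have "(\<Sum>j\<le>n. (if j = i then k else 0) * u b ^ j * v b ^ (n - j))
      = (\<Sum>j\<le>n. if j = i then k * u b ^ i * v b ^ (n - i) else 0)"
    by (intro sum.cong) auto
  then show "k * u b ^ i * v b ^ (n - i)
      = (\<Sum>j\<le>n. (if j = i then k else 0) * u b ^ j * v b ^ (n - j))"
    using assms by simp
qed

lemma binary_form_cong:
  "\<lbrakk>binary_form S u v n f; \<And>b. b \<in> S \<Longrightarrow> g b = f b\<rbrakk> \<Longrightarrow> binary_form S u v n g"
  by (auto simp: binary_form_def)

lemma binary_form_sum: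
  assumes "\<And>k. k \<in> K \<Longrightarrow> binary_form S u v n (f k)"
  shows "binary_form S u v n (\<lambda>b. \<Sum>k\<in>K. f k b)"
proof -
  from assms obtain c where c: "\<And>k b. \<lbrakk>k \<in> K; b \<in> S\<rbrakk> \<Longrightarrow> f k b = (\<Sum>i\<le>n. c k i * u b ^ i * v b ^ (n - i))"
    unfolding binary_form_def by metis
  show ?thesis
    unfolding binary_form_def
  proof (intro exI ballI)
    fix b assume b: "b \<in> S"
    have "(\<Sum>k\<in>K. f k b) = (\<Sum>k\<in>K. \<Sum>i\<le>n. c k i * u b ^ i * v b ^ (n - i))"
      using c b by simp
    also have "\<dots> = (\<Sum>i\<le>n. (\<Sum>k\<in>K. c k i) * u b ^ i * v b ^ (n - i))"
      by (subst sum.swap) (simp add: sum_distrib_right)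
    finally show "(\<Sum>k\<in>K. f k b) = (\<Sum>i\<le>n. (\<Sum>k\<in>K. c k i) * u b ^ i * v b ^ (n - i))" .
  qed
qed

lemma binary_form_add:
  assumes "binary_form S u v n f" "binary_form S u v n g"
  shows "binary_form S u v n (\<lambda>b. f b + g b)"
  using binary_form_sum[of "UNIV :: bool set" S u v n "\<lambda>t. if t then f else g"] assms
  by (simp add: UNIV_bool add.commute)

lemma binary_form_mult:
  assumes "binary_form S u v m f" "binary_form S u v n g"
  shows "binary_form S u v (m + n) (\<lambda>b. f b * g b)"
proof -
  from assms obtain c d where
    c: "\<And>b. b \<in> S \<Longrightarrow> f b = (\<Sum>i\<le>m. c i * u b ^ i * v b ^ (m - i))" and
    d: "\<And>b. b \<in> S \<Longrightarrow> g b = (\<Sum>i\<le>n. d i * u b ^ i * v b ^ (n - i))"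
    unfolding binary_form_def by metis
  have "binary_form S u v (m + n) (\<lambda>b. \<Sum>i\<le>m. \<Sum>j\<le>n. (c i * d j) * u b ^ (i + j) * v b ^ (m + n - (i + j)))"
    by (intro binary_form_sum binary_form_monomial) auto
  then show ?thesis
  proof (rule binary_form_cong)
    fix b assume b: "b \<in> S"
    show "f b * g b = (\<Sum>i\<le>m. \<Sum>j\<le>n. (c i * d j) * u b ^ (i + j) * v b ^ (m + n - (i + j)))"
      unfolding c[OF b] d[OF b] sum_product
    proof (intro sum.cong refl)
      fix i j assume "i \<in> {..m}" "j \<in> {..n}"
      then have "m + n - (i + j) = (m - i) + (n - j)" by simp
      then show "c i * u b ^ i * v b ^ (m - i) * (d j * u b ^ j * v b ^ (n - j))
          = c i * d j * u b ^ (i + j) * v b ^ (m + n - (i + j))"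
        by (simp only: power_add mult_ac)
    qed
  qed
qed

lemma binary_form_const: "binary_form S u v 0 (\<lambda>b. k)"
  using binary_form_monomial[of 0 0 S u v k] by simp

lemma binary_form_linear: "binary_form S u v 1 (\<lambda>b. \<alpha> * u b + \<beta> * v b)"
  unfolding binary_form_def
  by (intro exI[of _ "\<lambda>i. if i = 0 then \<beta> else \<alpha>"]) simp

lemma binary_form_cmult: "binary_form S u v n f \<Longrightarrow> binary_form S u v n (\<lambda>b. k * f b)"
  using binary_form_mult[OF binary_form_const[of S u v k]] by simp

lemma binary_form_prod:
  assumes "finite I" "\<And>i. i \<in> I \<Longrightarrow> binary_form S u v (d i) (f i)"
  shows "binary_form S u v (\<Sum>i\<in>I. d i) (\<lambda>b. \<Prod>i\<in>I. f i b)"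
  using assms
proof (induction I rule: finite_induct)
  case empty
  then show ?case using binary_form_const[of S u v 1] by simp
next
  case (insert i I)
  then show ?case
    using binary_form_mult[of S u v "d i" "f i" "sum d I" "\<lambda>b. \<Prod>i\<in>I. f i b"] by simp
qed

text \<open>
  Dehomogenizing by \<open>z = u / v\<close> turns the form into a polynomial of degree at most \<open>n\<close>; at most
  one of the given zeros has \<open>v = 0\<close>, and that zero kills the leading coefficient.
\<close>

lemma binary_form_eq_0:
  assumes f: "binary_form S u v n f"
    and T: "finite T" "card T = Suc n" "T \<subseteq> S" "\<And>t. t \<in> T \<Longrightarrow> f t = 0"
    and indep: "\<And>s t. \<lbrakk>s \<in> T; t \<in> T; s \<noteq> t\<rbrakk> \<Longrightarrow> u s * v t \<noteq> u t * v s"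
    and b: "b \<in> S"
  shows "f b = 0"
proof -
  from f obtain c where c: "\<And>b. b \<in> S \<Longrightarrow> f b = (\<Sum>i\<le>n. c i * u b ^ i * v b ^ (n - i))"
    unfolding binary_form_def by metis
  define T' where "T' = {t \<in> T. v t \<noteq> 0}"
  have hom: "(\<Sum>i\<le>m. c i * (u t / v t) ^ i) = 0"
    if "t \<in> T'" and z: "(\<Sum>i\<le>m. c i * u t ^ i * v t ^ (m - i)) = 0" for t m
  proof -
    have "(\<Sum>i\<le>m. c i * (u t / v t) ^ i) * v t ^ m = (\<Sum>i\<le>m. c i * u t ^ i * v t ^ (m - i))"
      unfolding sum_distrib_right using that(1)
      by (intro sum.cong) (auto simp: T'_def power_divide power_diff)
    then show ?thesis
      using z that(1) by (auto simp: T'_def)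
  qed
  have zero: "\<forall>i\<le>m. c i = 0"
    if z: "\<And>t. t \<in> T' \<Longrightarrow> (\<Sum>i\<le>m. c i * u t ^ i * v t ^ (m - i)) = 0" and card: "card T' > m" for m
  proof (rule ccontr)
    assume "\<not> (\<forall>i\<le>m. c i = 0)"
    then have "\<exists>k\<le>m. c k \<noteq> 0" by auto
    from polyfun_rootbound[OF this] have fin: "finite {z. (\<Sum>i\<le>m. c i * z ^ i) = 0}"
      and le: "card {z. (\<Sum>i\<le>m. c i * z ^ i) = 0} \<le> m" by auto
    have "inj_on (\<lambda>t. u t / v t) T'"
      using indep by (auto simp: inj_on_def T'_def field_simps)
    then have "card T' = card ((\<lambda>t. u t / v t) ` T')"
      by (simp add: card_image)
    also have "\<dots> \<le> card {z. (\<Sum>i\<le>m. c i * z ^ i) = 0}"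
      using hom z by (intro card_mono fin) auto
    finally show False using le card by simp
  qed
  have zT: "(\<Sum>i\<le>n. c i * u t ^ i * v t ^ (n - i)) = 0" if "t \<in> T" for t
    using c T that by (metis subsetD)
  have "\<forall>i\<le>n. c i = 0"
  proof (cases "T' = T")
    case True
    with zT T show ?thesis by (intro zero) auto
  next
    case False
    then obtain t0 where t0: "t0 \<in> T" "v t0 = 0" by (auto simp: T'_def)
    have T': "T' = T - {t0}"
      using indep t0 by (force simp: T'_def)
    have cn: "c n * u t0 ^ n = 0"
    proof -
      have "(\<Sum>i\<le>n. c i * u t0 ^ i * v t0 ^ (n - i)) = (\<Sum>i\<le>n. if i = n then c n * u t0 ^ n else 0)"
        by (intro sum.cong) (auto simp: t0)
      then show ?thesis using zT[OF t0(1)] by simp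
    qed
    show ?thesis
    proof (cases n)
      case 0
      with cn show ?thesis by simp
    next
      case (Suc m)
      \<comment> \<open>Independence excludes \<open>u t0 = 0\<close> only by comparison with a
        second zero, and one exists as soon as n > 0.\<close>
      then have "card T' > 0" using T' T t0 by simp
      then obtain t where "t \<in> T'" by (metis card_gt_0_iff ex_in_conv)
      then have "u t0 \<noteq> 0"
        using indep[of t0 t] t0 T' by auto
      with cn have c0: "c n = 0" by simp
      have "\<forall>i\<le>m. c i = 0"
      proof (rule zero)
        fix t assume t: "t \<in> T'"
        have "(\<Sum>i\<le>n. c i * u t ^ i * v t ^ (n - i)) = (\<Sum>i\<le>m. c i * u t ^ i * v t ^ (n - i))"
          using c0 by (simp add: Suc)
        also have "\<dots> = (\<Sum>i\<le>m. c i * u t ^ i * v t ^ (m - i)) * v t"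
          unfolding sum_distrib_right by (intro sum.cong) (auto simp: Suc Suc_diff_le)
        finally show "(\<Sum>i\<le>m. c i * u t ^ i * v t ^ (m - i)) = 0"
          using zT[of t] t by (auto simp: T'_def)
      qed (use T' T t0 Suc in simp)
      with c0 Suc show ?thesis by (auto simp: le_Suc_eq)
    qed
  qed
  then show ?thesis
    using c[OF b] by simp
qed

section \<open>Elliptic shifted factorials\<close>

lemma ell_fact_0 [simp]: "ell_fact A Q p 0 = 1"
  by (simp add: ell_fact_def)

lemma ell_fact_add: "ell_fact A Q p (m + n) = ell_fact A Q p m * ell_fact (A * Q ^ m) Q p n"
  by (simp add: ell_fact_def prod.nat_group[symmetric] lessThan_atLeast0 prod.atLeastLessThan_shift_0[of _ m]
      prod.atLeastLessThan_concat[symmetric, of 0 m "m + n"] power_add mult_ac)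

lemma ell_fact_one [simp]: "ell_fact A Q p (Suc 0) = theta A p"
  by (simp add: ell_fact_def)

lemma ell_fact_shift:
  "ell_fact A Q p n * theta (A * Q ^ n) p = theta A p * ell_fact (A * Q) Q p n"
  using ell_fact_add[of A Q p n 1] ell_fact_add[of A Q p 1 n] by simp

text \<open>Equal to (-1)^n Q^{-n(n-1)/2}. It never has to be evaluated: it always cancels against
  another copy of itself when the shift constants are compared.\<close>

definition reversal_factor :: "complex \<Rightarrow> nat \<Rightarrow> complex" where
  "reversal_factor Q n = (\<Prod>j<n. - 1 / Q ^ j)"

lemma reversal_factor_nonzero: "Q \<noteq> 0 \<Longrightarrow> reversal_factor Q n \<noteq> 0"
  by (simp add: reversal_factor_def)

text \<open>The base \<open>Q / (B * Q ^ n)\<close> is such that the factors, read backwards, are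
  theta values at the reciprocals of \<open>B * Q ^ j\<close>; the inversion formula then applies to
  each of them.\<close>

lemma ell_fact_reverse:
  assumes p: "norm p < 1" and Q: "Q \<noteq> 0" and B: "B \<noteq> 0"
  shows "ell_fact (Q / (B * Q ^ n)) Q p n = reversal_factor Q n * ell_fact B Q p n / B ^ n"
proof -
  have "ell_fact (Q / (B * Q ^ n)) Q p n = (\<Prod>j<n. theta (Q / (B * Q ^ n) * Q ^ (n - Suc j)) p)"
    unfolding ell_fact_def
    by (rule prod.nat_diff_reindex[of "\<lambda>j. theta (Q / (B * Q ^ n) * Q ^ j) p", symmetric])
  also have "\<dots> = (\<Prod>j<n. (- 1 / Q ^ j) * theta (B * Q ^ j) p / B)"
  proof (rule prod.cong[OF refl])
    fix j assume "j \<in> {..<n}"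
    then have "n = (n - Suc j) + Suc j"
      by simp
    then have "Q ^ n = Q ^ (n - Suc j) * (Q ^ j * Q)"
      by (metis power_add power_Suc2)
    then have e: "Q / (B * Q ^ n) * Q ^ (n - Suc j) = 1 / (B * Q ^ j)"
      using Q by simp
    show "theta (Q / (B * Q ^ n) * Q ^ (n - Suc j)) p = (- 1 / Q ^ j) * theta (B * Q ^ j) p / B"
      unfolding e using theta_inverse[OF p, of "B * Q ^ j"] B Q by (simp add: field_simps)
  qed
  also have "\<dots> = (\<Prod>j<n. - 1 / Q ^ j) * (\<Prod>j<n. theta (B * Q ^ j) p) * (\<Prod>j<n. 1 / B)"
    unfolding prod.distrib[symmetric] by simp
  also have "\<dots> = reversal_factor Q n * ell_fact B Q p n / B ^ n"
    by (simp add: reversal_factor_def ell_fact_def power_one_over divide_inverse power_inverse)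
  finally show ?thesis .
qed

section \<open>Zeros of theta and theta pairs for fixed p and q\<close>

locale elliptic_base =
  fixes p q :: complex
  assumes p: "norm p < 1" and q: "q \<noteq> 0"
    and q_generic: "\<And>k::nat. k > 0 \<Longrightarrow> (if p = 0 then q ^ k \<noteq> 1 else (\<forall>m::int. q ^ k \<noteq> p powi m))"
begin

abbreviation th :: "complex \<Rightarrow> complex" where "th z \<equiv> theta z p"
abbreviation ef :: "complex \<Rightarrow> nat \<Rightarrow> complex" where "ef A n \<equiv> ell_fact A q p n"
abbreviation ef2 :: "complex \<Rightarrow> nat \<Rightarrow> complex" where "ef2 A n \<equiv> ell_fact A (q ^ 2) p n"

lemma theta_eq_0_cases:
  assumes "z \<noteq> 0" "th z = 0"
  shows "z = 1 \<or> (p \<noteq> 0 \<and> (\<exists>m::int. z = p powi m))"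
proof -
  obtain j where j: "p ^ j * z = 1 \<or> p ^ (j + 1) / z = 1"
    using assms theta_eq_0_iff[OF p] by blast
  then show ?thesis
  proof
    assume *: "p ^ j * z = 1"
    show ?thesis
    proof (cases "p = 0")
      case True
      with * show ?thesis by (cases j) auto
    next
      case False
      with * have "z = p powi (- int j)"
        by (simp add: power_int_minus field_simps)
      with False show ?thesis by blast
    qed
  next
    assume *: "p ^ (j + 1) / z = 1"
    then have z: "z = p powi int (j + 1)"
      unfolding power_int_of_nat using assms by (simp only: divide_eq_1_iff)
    with assms have "p \<noteq> 0" by auto
    with z show ?thesis by blast
  qed
qed

lemma theta_q_power_nonzero: "n > 0 \<Longrightarrow> th (q ^ n) \<noteq> 0"
  using theta_eq_0_cases[of "q ^ n"] q q_generic[of n] power_int_0_right[of p]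
  by (metis power_not_zero)

lemma ef2_q2_nonzero: "ef2 (q ^ 2) n \<noteq> 0"
proof -
  have "q ^ 2 * (q ^ 2) ^ j = q ^ (2 * j + 2)" for j
    by (simp add: power_add power_mult power2_eq_square power_mult_distrib mult_ac)
  then show ?thesis
    by (simp add: ell_fact_def theta_q_power_nonzero del: power_Suc add_2_eq_Suc')
qed

lemma countable_theta_zeros: "countable {z. z \<noteq> 0 \<and> th z = 0}"
  by (rule countable_subset[of _ "insert 1 (range (\<lambda>m::int. p powi m))"])
     (use theta_eq_0_cases in blast, simp)

lemma theta_minus: "z \<noteq> 0 \<Longrightarrow> th (1 / z) = - th z / z"
  by (rule theta_inverse[OF p])

lemma theta_inverse_eq_0: "z \<noteq> 0 \<Longrightarrow> th (1 / z) = 0 \<longleftrightarrow> th z = 0"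
  by (simp add: theta_minus)

lemma ef_reverse: "B \<noteq> 0 \<Longrightarrow> C = q / (B * q ^ n) \<Longrightarrow> ef C n = reversal_factor q n * ef B n / B ^ n"
  using ell_fact_reverse[OF p q] by simp

lemma ef2_reverse: "B \<noteq> 0 \<Longrightarrow> C = q ^ 2 / (B * (q ^ 2) ^ n) \<Longrightarrow>
    ef2 C n = reversal_factor (q ^ 2) n * ef2 B n / B ^ n"
  using ell_fact_reverse[OF p, of "q ^ 2"] q by simp

lemma ef_split: "n = m + l \<Longrightarrow> C = B * q ^ m \<Longrightarrow> ef B n = ef B m * ef C l"
  by (simp add: ell_fact_add)

lemma ef2_split: "n = m + l \<Longrightarrow> C = B * q ^ (2 * m) \<Longrightarrow> ef2 B n = ef2 B m * ef2 C l"
  by (simp add: ell_fact_add power_mult)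

text \<open>
  The rank two decomposition at \<open>x = A \<surd>q\<close>, \<open>y = b / \<surd>q\<close> makes \<open>\<theta>(A b) \<theta>(A q / b)\<close>
  a linear form in two functions of \<open>b\<close> that do not depend on \<open>A\<close>.
\<close>

definition uform :: "complex \<Rightarrow> complex" where "uform b = thetaB0 p (b / csqrt q)"
definition vform :: "complex \<Rightarrow> complex" where "vform b = thetaB1 p (b / csqrt q)"

lemma theta_pair_linear:
  assumes "A \<noteq> 0" "b \<noteq> 0"
  shows "th (A * b) * th (A * q / b)
    = thetaA0 p (A * csqrt q) * uform b + thetaA1 p (A * csqrt q) * vform b"
proof -
  have s: "csqrt q * csqrt q = q"
    using power2_csqrt[of q] by (simp add: power2_eq_square)
  have e: "A * csqrt q * (b / csqrt q) = A * b" "A * csqrt q / (b / csqrt q) = A * q / b"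
    using q s by (simp_all add: field_simps)
  show ?thesis
    using theta_mult_rank_two[OF p, of "A * csqrt q" "b / csqrt q"] assms q
    unfolding e uform_def vform_def by simp
qed

lemma binary_form_theta_pair:
  assumes "A \<noteq> 0"
  shows "binary_form (- {0}) uform vform 1 (\<lambda>b. th (A * b) * th (A * q / b))"
  by (rule binary_form_cong[OF binary_form_linear]) (use theta_pair_linear assms in auto)

text \<open>The form \<theta>(b / s) \<theta>(q / (s b)) vanishes at b = s but not at b = t, and
  exchanging s and t gives a second such form. The condition on \<open>q / (s * t)\<close> enters
  because all these forms are invariant under b -> q / b.\<close>

lemma form_indep:
  assumes "s \<noteq> 0" "t \<noteq> 0" "th (t / s) \<noteq> 0" "th (q / (s * t)) \<noteq> 0"
  shows "uform s * vform t \<noteq> uform t * vform s"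
proof
  assume eq: "uform s * vform t = uform t * vform s"
  have st: "th (s / t) \<noteq> 0"
    using theta_inverse_eq_0[of "t / s"] assms by simp
  define \<alpha> \<beta> where "\<alpha> = thetaA0 p (1 / s * csqrt q)" and "\<beta> = thetaA1 p (1 / s * csqrt q)"
  define \<gamma> \<delta> where "\<gamma> = thetaA0 p (1 / t * csqrt q)" and "\<delta> = thetaA1 p (1 / t * csqrt q)"
  have 1: "\<alpha> * uform s + \<beta> * vform s = 0"
    using theta_pair_linear[of "1 / s" s] assms p by (simp add: \<alpha>_def \<beta>_def)
  have 2: "\<alpha> * uform t + \<beta> * vform t \<noteq> 0"
    unfolding \<alpha>_def \<beta>_def by (subst theta_pair_linear[symmetric]) (use assms in auto)
  have 3: "\<gamma> * uform s + \<delta> * vform s \<noteq> 0"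
    unfolding \<gamma>_def \<delta>_def
    by (subst theta_pair_linear[symmetric]) (use assms st in \<open>auto simp: mult.commute\<close>)
  \<comment> \<open>Proportionality would also hold if one of the two vectors were zero. Using both
    forms in one determinant identity covers that case.\<close>
  have "(\<alpha> * uform t + \<beta> * vform t) * (\<gamma> * uform s + \<delta> * vform s)
      = (\<alpha> * uform s + \<beta> * vform s) * (\<gamma> * uform t + \<delta> * vform t)
        + (\<alpha> * \<delta> - \<beta> * \<gamma>) * (uform t * vform s - uform s * vform t)"
    by (simp add: algebra_simps)
  then show False
    using 1 2 3 eq by simp
qed

section \<open>Shifting one summation index\<close>

text \<open>
  The summand factors into \<open>pair_factor\<close>, symmetric in the two indices, \<open>inner_factor\<close> with
  \<open>A = a x\<^sub>i\<close>, \<open>C = a / c\<^sub>i\<close>, \<open>b_factor\<close>, \<open>x_factor\<close> with \<open>X = x\<^sub>i\<close>, \<open>Y = x\<^sub>j\<close>, \<open>c = c\<^sub>j\<close>,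
  and \<open>size_factor\<close>, which depends only on \<open>K = |k|\<close>. The power \<open>q\<^bsup>-e\<^sub>2(k)\<^esup>\<close> is
  distributed over the pairs.
\<close>

definition pair_factor :: "nat \<Rightarrow> complex \<Rightarrow> complex \<Rightarrow> complex \<Rightarrow> nat \<Rightarrow> nat \<Rightarrow> complex" where
  "pair_factor N a X Y k l =
     Y * q ^ (2 * l) * th (X * q ^ (2 * k) / (Y * q ^ (2 * l))) / (Y * th (X / Y))
       / q ^ (k * l) / ef2 (a ^ 2 * X * Y * q ^ (2 * N + 1)) (k + l)"

text \<open>Negative powers of q are written as denominators. The exponent
  \<open>2 * N + 1 - (K - k)\<close> is free of truncation for \<open>k \<le> K \<le> N\<close>, the
  range of the summation.\<close>

definition inner_factor :: "nat \<Rightarrow> complex \<Rightarrow> complex \<Rightarrow> nat \<Rightarrow> nat \<Rightarrow> complex" where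
  "inner_factor N A C k K = th (A * q ^ (2 * k + K)) / th A
     * (ef A K * ef (1 / (A * q ^ (2 * N))) (K - k)
        / (ef (C * q) K * ef (1 / (C * q ^ (2 * N))) K * ef (A * q ^ (2 * N + 1 - (K - k))) k))"

text \<open>The quotient of \<open>(A b q, A q^2 / b; q^2)\<close> at lengths N and k, written
  without division: the b-dependent denominators of the summand are already cleared here.\<close>

definition b_factor :: "nat \<Rightarrow> complex \<Rightarrow> complex \<Rightarrow> nat \<Rightarrow> complex" where
  "b_factor N A b k = ef2 (A * b * q ^ (1 + 2 * k)) (N - k) * ef2 (A * q ^ (2 + 2 * k) / b) (N - k)"

definition x_factor :: "nat \<Rightarrow> complex \<Rightarrow> complex \<Rightarrow> complex \<Rightarrow> complex \<Rightarrow> nat \<Rightarrow> complex" where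
  "x_factor N a c X Y k = ef2 (c * X) k * ef2 (a ^ 2 * q ^ (2 * N + 1) * X / c) k / ef2 (q ^ 2 * X / Y) k"

definition size_factor :: "nat \<Rightarrow> complex \<Rightarrow> nat \<Rightarrow> complex" where
  "size_factor N b K = q ^ K * ef b K * ef (q / b) K * ef2 (1 / q ^ (2 * N)) K"

definition rhs_factor :: "nat \<Rightarrow> complex \<Rightarrow> complex \<Rightarrow> complex \<Rightarrow> complex \<Rightarrow> complex" where
  "rhs_factor N a b A c = ef (A * q) (2 * N) / ef (a / c * q) (2 * N)
     * ef2 (a * b * q / c) N * ef2 (a * q ^ 2 / (b * c)) N"

text \<open>\<open>V * th (U / V)\<close> is antisymmetric in U and V, and the two signs cancel in
  the quotient. The symmetry lets the shifted index be treated as the first one of every pair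
  containing it.\<close>

lemma pair_factor_commute:
  assumes "X \<noteq> 0" "Y \<noteq> 0"
  shows "pair_factor N a X Y k l = pair_factor N a Y X l k"
proof -
  have flip: "V * th (U / V) = - (U * th (V / U))" if "U \<noteq> 0" "V \<noteq> 0" for U V
    using theta_minus[of "V / U"] that by simp
  have "Y * q ^ (2 * l) * th (X * q ^ (2 * k) / (Y * q ^ (2 * l)))
      = - (X * q ^ (2 * k) * th (Y * q ^ (2 * l) / (X * q ^ (2 * k))))"
    using flip[of "X * q ^ (2 * k)" "Y * q ^ (2 * l)"] assms q by simp
  moreover have "Y * th (X / Y) = - (X * th (Y / X))"
    using flip assms by blast
  moreover have "a ^ 2 * X * Y * q ^ (2 * N + 1) = a ^ 2 * Y * X * q ^ (2 * N + 1)"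
    by (simp add: mult_ac)
  moreover have "k + l = l + k" "k * l = l * k"
    by simp_all
  ultimately show ?thesis
    unfolding pair_factor_def by (simp only: minus_divide_divide)
qed

text \<open>The power \<open>q ^ (J * h)\<close> compensates the part of e_2 that depends on h. Over
  all other indices these powers multiply to \<open>q ^ (J * (L - l))\<close>, which the shifted
  index supplies in \<open>self_shift\<close>.\<close>

lemma pair_factor_shift:
  assumes "Y \<noteq> 0" "th (X * q ^ (2 * J) / Y) \<noteq> 0" "J \<le> N"
  shows "pair_factor N a X Y (l + J) h * q ^ (J * h)
    = th (X * q ^ (2 * J) / Y) / th (X / Y) / ef2 (a ^ 2 * X * Y * q ^ (2 * N + 1)) J
      * pair_factor (N - J) (a * q ^ J) (X * q ^ (2 * J)) Y l h"
proof -
  have cancel: "S / (Y * w) / (v * u) / (e1 * e2) * u = t / w / e1 * (S / (Y * t) / v / e2)"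
    if "u \<noteq> 0" "t \<noteq> 0" for S w v u e1 e2 t :: complex
    using that by simp
  have e1: "X * q ^ (2 * (l + J)) = X * q ^ (2 * J) * q ^ (2 * l)"
    by (simp add: power_add algebra_simps)
  have e2: "(a * q ^ J) ^ 2 * (X * q ^ (2 * J)) * Y * q ^ (2 * (N - J) + 1)
      = a ^ 2 * X * Y * q ^ (2 * N + 1) * q ^ (2 * J)"
  proof -
    have "2 * J + (2 * (N - J) + 1) = 2 * N + 1" using assms by simp
    then have E: "q ^ (2 * N + 1) = q ^ (2 * J) * q ^ (2 * (N - J) + 1)"
      by (metis power_add)
    have "(a * q ^ J) ^ 2 = a ^ 2 * q ^ (2 * J)"
      by (simp only: power_mult_distrib power_even_eq)
    then show ?thesis
      unfolding E by (simp only: mult_ac)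
  qed
  have e3: "ef2 (a ^ 2 * X * Y * q ^ (2 * N + 1)) (l + J + h)
      = ef2 (a ^ 2 * X * Y * q ^ (2 * N + 1)) J * ef2 (a ^ 2 * X * Y * q ^ (2 * N + 1) * q ^ (2 * J)) (l + h)"
    by (rule ef2_split) auto
  have e4: "q ^ ((l + J) * h) = q ^ (l * h) * q ^ (J * h)"
    by (simp add: power_add[symmetric] algebra_simps)
  show ?thesis
    unfolding pair_factor_def e1 e2 e3 e4 by (rule cancel) (use assms q in auto)
qed

lemma inner_factor_shift_other:
  assumes A: "th (A * q ^ J) \<noteq> 0" and J: "h \<le> L" "L + J \<le> N"
  shows "inner_factor N A C h (L + J)
    = th (A * q ^ J) / th A * ef A J * ef (1 / (A * q ^ (2 * N))) J
        / (ef (C * q) J * ef (1 / (C * q ^ (2 * N))) J)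
      * inner_factor (N - J) (A * q ^ J) (C * q ^ J) h L"
proof -
  have e1: "A * q ^ J * q ^ (2 * h + L) = A * q ^ (2 * h + (L + J))"
    by (simp add: power_add mult_ac)
  have e2: "ef A (L + J) = ef A J * ef (A * q ^ J) L"
    by (rule ef_split) auto
  have inv: "1 / (Z * q ^ J * q ^ (2 * (N - J))) = 1 / (Z * q ^ (2 * N)) * q ^ J" for Z
  proof -
    have "2 * N = 2 * (N - J) + J + J" using J by simp
    then have "q ^ (2 * N) = q ^ (2 * (N - J)) * q ^ J * q ^ J"
      by (simp only: power_add)
    then show ?thesis using q by simp
  qed
  have e3: "ef (1 / (A * q ^ (2 * N))) (L + J - h)
      = ef (1 / (A * q ^ (2 * N))) J * ef (1 / (A * q ^ J * q ^ (2 * (N - J)))) (L - h)"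
    by (rule ef_split) (use J inv in auto)
  have e4: "ef (1 / (C * q ^ (2 * N))) (L + J)
      = ef (1 / (C * q ^ (2 * N))) J * ef (1 / (C * q ^ J * q ^ (2 * (N - J)))) L"
    by (rule ef_split) (use J inv in auto)
  have e5: "ef (C * q) (L + J) = ef (C * q) J * ef (C * q ^ J * q) L"
    by (rule ef_split) auto
  have e6: "A * q ^ (2 * N + 1 - (L + J - h)) = A * q ^ J * q ^ (2 * (N - J) + 1 - (L - h))"
  proof -
    have "2 * N + 1 - (L + J - h) = J + (2 * (N - J) + 1 - (L - h))" using J by simp
    then show ?thesis by (simp only: power_add mult.assoc)
  qed
  have e7: "th (A * q ^ (2 * h + (L + J))) / th A
      = (th (A * q ^ J) / th A) * (th (A * q ^ (2 * h + (L + J))) / th (A * q ^ J))"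
    using assms by simp
  show ?thesis
    unfolding inner_factor_def e2 e3 e4 e5 e6 e7 e1
    by (simp only: divide_inverse inverse_mult_distrib mult_ac)
qed

text \<open>The first factorial is cut at its start and the second at its end, which makes the
  second block of length J independent of h. The first block still depends on h; at the nodes it is
  absorbed by \<open>x_factor_shift_right\<close>.\<close>

lemma b_factor_shift_other:
  assumes J: "h + J \<le> N"
  shows "b_factor N A b h = ef2 (A * b * q ^ (1 + 2 * h)) J * ef2 (A * q ^ (2 + 2 * (N - J)) / b) J
    * b_factor (N - J) (A * q ^ J) (b * q ^ J) h"
proof -
  have e1: "ef2 (A * b * q ^ (1 + 2 * h)) (N - h) = ef2 (A * b * q ^ (1 + 2 * h)) J
      * ef2 (A * q ^ J * (b * q ^ J) * q ^ (1 + 2 * h)) (N - J - h)"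
  proof (rule ef2_split)
    have "q ^ (2 * J) = q ^ J * q ^ J" by (simp only: mult_2 power_add)
    then show "A * q ^ J * (b * q ^ J) * q ^ (1 + 2 * h) = A * b * q ^ (1 + 2 * h) * q ^ (2 * J)"
      by (simp only: mult_ac)
  qed (use J in auto)
  have e2: "ef2 (A * q ^ (2 + 2 * h) / b) (N - h) = ef2 (A * q ^ (2 + 2 * h) / b) (N - J - h)
      * ef2 (A * q ^ (2 + 2 * (N - J)) / b) J"
  proof (rule ef2_split)
    have "2 + 2 * (N - J) = 2 + 2 * h + 2 * (N - J - h)" using J by simp
    then have "q ^ (2 + 2 * (N - J)) = q ^ (2 + 2 * h) * q ^ (2 * (N - J - h))"
      by (simp only: power_add)
    then show "A * q ^ (2 + 2 * (N - J)) / b = A * q ^ (2 + 2 * h) / b * q ^ (2 * (N - J - h))"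
      by simp
  qed (use J in auto)
  have e3: "A * q ^ J * q ^ (2 + 2 * h) / (b * q ^ J) = A * q ^ (2 + 2 * h) / b"
    using q by simp
  show ?thesis
    unfolding b_factor_def e1 e2 e3 by (simp only: mult_ac)
qed

text \<open>This invariance is why the c_j stay fixed under the shift, and why pair and x factors
  not involving the shifted index do not change at all.\<close>

lemma x_factor_arg:
  assumes "J \<le> N"
  shows "(a * q ^ J) ^ 2 * q ^ (2 * (N - J) + 1) = a ^ 2 * q ^ (2 * N + 1)"
proof -
  have "2 * N + 1 = 2 * J + (2 * (N - J) + 1)" using assms by simp
  then have "q ^ (2 * N + 1) = q ^ (2 * J) * q ^ (2 * (N - J) + 1)"
    by (simp only: power_add)
  moreover have "(a * q ^ J) ^ 2 = a ^ 2 * q ^ (2 * J)"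
    by (simp only: power_mult_distrib power_even_eq)
  ultimately show ?thesis
    by (simp only: mult_ac)
qed

lemma x_factor_shift_left:
  assumes J: "J \<le> N"
  shows "x_factor N a c X Y (l + J)
    = ef2 (c * X) J * ef2 (a ^ 2 * q ^ (2 * N + 1) * X / c) J / ef2 (q ^ 2 * X / Y) J
      * x_factor (N - J) (a * q ^ J) c (X * q ^ (2 * J)) Y l"
proof -
  have e1: "ef2 (c * X) (l + J) = ef2 (c * X) J * ef2 (c * (X * q ^ (2 * J))) l"
    by (rule ef2_split) auto
  have e2: "ef2 (a ^ 2 * q ^ (2 * N + 1) * X / c) (l + J) = ef2 (a ^ 2 * q ^ (2 * N + 1) * X / c) J
      * ef2 (a ^ 2 * q ^ (2 * N + 1) * (X * q ^ (2 * J)) / c) l"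
    by (rule ef2_split) auto
  have e3: "ef2 (q ^ 2 * X / Y) (l + J) = ef2 (q ^ 2 * X / Y) J
      * ef2 (q ^ 2 * (X * q ^ (2 * J)) / Y) l"
    by (rule ef2_split) auto
  show ?thesis
    unfolding x_factor_def x_factor_arg[OF J] e1 e2 e3
    by (simp only: divide_inverse inverse_mult_distrib mult_ac)
qed

text \<open>The factorial of length J + h starting at \<open>?B\<close> is cut in both orders, which
  exchanges the old denominator for the shifted one. The block of length J multiplied on the left is
  the one left over by \<open>b_factor_shift_other\<close> at a node.\<close>

lemma x_factor_shift_right:
  assumes J: "J \<le> N" and nz: "X \<noteq> 0" "ef2 (q ^ 2 * Y / X) h \<noteq> 0" "ef2 (q ^ 2 * Y / (X * q ^ (2 * J))) h \<noteq> 0"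
  shows "x_factor N a c Y X h * ef2 (q ^ 2 * Y / (X * q ^ (2 * J)) * q ^ (2 * h)) J
    = ef2 (q ^ 2 * Y / (X * q ^ (2 * J))) J * x_factor (N - J) (a * q ^ J) c Y (X * q ^ (2 * J)) h"
proof -
  let ?B = "q ^ 2 * Y / (X * q ^ (2 * J))"
  have "ef2 ?B (J + h) = ef2 ?B J * ef2 (q ^ 2 * Y / X) h"
    by (rule ef2_split) (use q in auto)
  moreover have "ef2 ?B (J + h) = ef2 ?B h * ef2 (?B * q ^ (2 * h)) J"
    by (rule ef2_split) auto
  ultimately have "ef2 ?B h * ef2 (?B * q ^ (2 * h)) J = ef2 ?B J * ef2 (q ^ 2 * Y / X) h"
    by simp
  then have "ef2 (?B * q ^ (2 * h)) J / ef2 (q ^ 2 * Y / X) h = ef2 ?B J / ef2 ?B h"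
    unfolding frac_eq_eq[OF nz(2) nz(3)] by (simp only: mult_ac)
  then have "u * (ef2 (?B * q ^ (2 * h)) J / ef2 (q ^ 2 * Y / X) h) = u * (ef2 ?B J / ef2 ?B h)" for u
    by simp
  from this[of "ef2 (c * Y) h * ef2 (a ^ 2 * q ^ (2 * N + 1) * Y / c) h"] show ?thesis
    unfolding x_factor_def x_factor_arg[OF J] by (simp only: divide_inverse mult_ac)
qed

text \<open>Reversal turns the numerator into a factorial starting at the same point
  \<open>B\<close> as the denominator. Moving this common start by \<open>q ^ J\<close> costs only a
  constant, and the monomial created by the reversal contributes \<open>q ^ (J * M)\<close>. In the
  application M is |k| - k_i, which the shift leaves alone.\<close>

lemma inner_reversed_shift:
  assumes A: "A \<noteq> 0" and gen: "\<And>n. th (A * q ^ n) \<noteq> 0" and M: "M \<le> 2 * N"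
  shows "ef (1 / (A * q ^ (2 * N))) M / ef (A * q ^ (2 * N + 1 - M)) (l + J)
    = q ^ (J * M) / ef (A * q ^ (2 * N + 1)) J
      * (ef (1 / (A * q ^ (2 * N) * q ^ J)) M / ef (A * q ^ (2 * N + 1 - M) * q ^ J) l)"
proof -
  define B where "B = A * q ^ (2 * N + 1 - M)"
  have "2 * N + 1 = (2 * N + 1 - M) + M" using M by simp
  then have BM: "B * q ^ M = A * q ^ (2 * N + 1)"
    unfolding B_def by (metis power_add mult.assoc)
  have B: "B \<noteq> 0" using A q by (simp add: B_def)
  have gB: "ef (B * q ^ n) m \<noteq> 0" for n m
    using gen by (simp add: ell_fact_def B_def mult.assoc power_add[symmetric])
  have BM': "B * q ^ M = A * q ^ (2 * N) * q"
    unfolding BM by simp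
  have r1: "ef (1 / (A * q ^ (2 * N))) M = reversal_factor q M * ef B M / B ^ M"
    by (rule ef_reverse[OF B]) (use q A BM' in simp)
  have r2: "ef (1 / (A * q ^ (2 * N) * q ^ J)) M = reversal_factor q M * ef (B * q ^ J) M / (B * q ^ J) ^ M"
  proof (rule ef_reverse)
    have "B * q ^ J * q ^ M = (B * q ^ M) * q ^ J"
      by (simp only: mult_ac)
    also have "\<dots> = A * q ^ (2 * N) * q * q ^ J"
      unfolding BM' ..
    finally have e: "B * q ^ J * q ^ M = A * q ^ (2 * N) * q * q ^ J" .
    show "1 / (A * q ^ (2 * N) * q ^ J) = q / (B * q ^ J * q ^ M)"
      unfolding e using q by simp
  qed (use B q in simp)
  have s1: "ef B (l + J) = ef B J * ef (B * q ^ J) l"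
    by (rule ef_split) auto
  have s2: "ef B M * ef (B * q ^ M) J = ef B J * ef (B * q ^ J) M"
    using ell_fact_add[of B q p M J] ell_fact_add[of B q p J M] by (simp add: add.commute)
  have "ef B M = ef B J * ef (B * q ^ J) M / ef (A * q ^ (2 * N + 1)) J"
    unfolding BM[symmetric] nonzero_eq_divide_eq[OF gB] by (rule s2)
  moreover have "s * (g * x / z) / w / (g * y) = u / z * (s * x / (w * u) / y)"
    if "g \<noteq> 0" "u \<noteq> 0" for s g x y z w u :: complex
    using that by simp
  moreover have "(B * q ^ J) ^ M = B ^ M * q ^ (J * M)"
    by (simp only: power_mult_distrib power_mult)
  ultimately show ?thesis
    unfolding r1 r2 B_def[symmetric] s1 using gB[of 0 J] q by simp
qed

text \<open>
  Under \<open>N \<mapsto> N - J\<close>, \<open>a \<mapsto> a q\<^sup>J\<close>, \<open>x\<^sub>i \<mapsto> x\<^sub>i q\<^bsup>2J\<^esup>\<close>, \<open>b \<mapsto> b q\<^sup>J\<close>, the quantities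
  \<open>(q / b; q)\<^sub>K\<close> and \<open>(a x\<^sub>i; q)\<^sub>K\<close> do not change by constant factors separately,
  but their product does, because \<open>q / b = a x\<^sub>i q\<^bsup>2J\<^esup>\<close>.
\<close>

lemma self_shift:
  assumes A: "A \<noteq> 0" and gen: "\<And>n. th (A * q ^ n) \<noteq> 0" and J: "l \<le> L" "L + J \<le> N"
    and b: "b = q / (A * q ^ (2 * J))"
  shows "size_factor N b (L + J) * inner_factor N A C (l + J) (L + J)
    = q ^ J * q ^ (J * (L - l)) * ef b J * ef A J * ef (A * q ^ (2 * J)) J * ef2 (1 / q ^ (2 * N)) J
        * th (A * q ^ (3 * J)) / th A
        / (ef (C * q) J * ef (1 / (C * q ^ (2 * N))) J * ef (A * q ^ (2 * N + 1)) J)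
      * (size_factor (N - J) (b * q ^ J) L * inner_factor (N - J) (A * q ^ (3 * J)) (C * q ^ J) l L)"
proof -
  have NJ: "2 * N = 2 * (N - J) + 2 * J" using J by simp
  then have qN: "q ^ (2 * N) = q ^ (2 * (N - J)) * q ^ (2 * J)"
    by (simp only: power_add)
  have b0: "q / b = A * q ^ (2 * J)" "q / (b * q ^ J) = A * q ^ J" "b \<noteq> 0"
    unfolding b using q A by (simp_all add: mult_2 power_add)
  have e1: "ef b (L + J) = ef b J * ef (b * q ^ J) L"
    by (rule ef_split) auto
  \<comment> \<open>The tails trade places: the tail of the factorial at \<open>q / b\<close>
    becomes the inner factorial of the shifted problem, and the tail of the one at \<open>A\<close>
    becomes its factorial at \<open>q / (b * q ^ J)\<close>.\<close>
  have e2: "ef (q / b) (L + J) = ef (A * q ^ (2 * J)) J * ef (A * q ^ (3 * J)) L"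
    unfolding b0 by (rule ef_split) (auto simp: power_add[symmetric] mult.assoc)
  have e3: "ef A (L + J) = ef A J * ef (q / (b * q ^ J)) L"
    unfolding b0 by (rule ef_split) auto
  have e4: "ef2 (1 / q ^ (2 * N)) (L + J) = ef2 (1 / q ^ (2 * N)) J * ef2 (1 / q ^ (2 * (N - J))) L"
    by (rule ef2_split) (use q qN in auto)
  have e5: "A * q ^ (2 * (l + J) + (L + J)) = A * q ^ (3 * J) * q ^ (2 * l + L)"
    unfolding mult.assoc power_add[symmetric] by (simp add: algebra_simps)
  have e6: "ef (1 / (C * q ^ (2 * N))) (L + J)
      = ef (1 / (C * q ^ (2 * N))) J * ef (1 / (C * q ^ J * q ^ (2 * (N - J)))) L"
    by (rule ef_split) (use q qN in \<open>auto simp: mult_2 power_add\<close>)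
  have e7: "ef (C * q) (L + J) = ef (C * q) J * ef (C * q ^ J * q) L"
    by (rule ef_split) auto
  have e8: "L + J - (l + J) = L - l" by simp
  have e9: "A * q ^ (3 * J) * q ^ (2 * (N - J)) = A * q ^ (2 * N) * q ^ J"
  proof -
    have "3 * J + 2 * (N - J) = 2 * N + J" using J by simp
    then show ?thesis by (metis power_add mult.assoc)
  qed
  have e10: "A * q ^ (3 * J) * q ^ (2 * (N - J) + 1 - (L - l)) = A * q ^ (2 * N + 1 - (L - l)) * q ^ J"
  proof -
    have "3 * J + (2 * (N - J) + 1 - (L - l)) = (2 * N + 1 - (L - l)) + J" using J by simp
    then show ?thesis by (metis power_add mult.assoc)
  qed
  have e11: "th (A * q ^ (3 * J) * q ^ (2 * l + L)) / th A
      = (th (A * q ^ (3 * J)) / th A) * (th (A * q ^ (3 * J) * q ^ (2 * l + L)) / th (A * q ^ (3 * J)))"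
    using gen[of "3 * J"] by simp
  define U where "U = ef (1 / (A * q ^ (2 * N))) (L - l) / ef (A * q ^ (2 * N + 1 - (L - l))) (l + J)"
  define U' where "U' = ef (1 / (A * q ^ (2 * N) * q ^ J)) (L - l) / ef (A * q ^ (2 * N + 1 - (L - l)) * q ^ J) l"
  have U: "U = q ^ (J * (L - l)) / ef (A * q ^ (2 * N + 1)) J * U'"
    unfolding U_def U'_def by (rule inner_reversed_shift[OF A gen]) (use J in simp)
  have "size_factor N b (L + J) * inner_factor N A C (l + J) (L + J)
    = q ^ (L + J) * ef b (L + J) * ef (q / b) (L + J) * ef2 (1 / q ^ (2 * N)) (L + J)
      * (th (A * q ^ (2 * (l + J) + (L + J))) / th A * ef A (L + J)
          / (ef (C * q) (L + J) * ef (1 / (C * q ^ (2 * N))) (L + J))) * U"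
    unfolding size_factor_def inner_factor_def U_def e8
    by (simp only: divide_inverse inverse_mult_distrib mult_ac)
  also have "\<dots> = q ^ J * q ^ (J * (L - l)) * ef b J * ef A J * ef (A * q ^ (2 * J)) J * ef2 (1 / q ^ (2 * N)) J
        * th (A * q ^ (3 * J)) / th A
        / (ef (C * q) J * ef (1 / (C * q ^ (2 * N))) J * ef (A * q ^ (2 * N + 1)) J)
      * (q ^ L * ef (b * q ^ J) L * ef (q / (b * q ^ J)) L * ef2 (1 / q ^ (2 * (N - J))) L
      * (th (A * q ^ (3 * J) * q ^ (2 * l + L)) / th (A * q ^ (3 * J)) * ef (A * q ^ (3 * J)) L
          / (ef (C * q ^ J * q) L * ef (1 / (C * q ^ J * q ^ (2 * (N - J)))) L)) * U')"
    unfolding e1 e2 e3 e4 e5 e6 e7 e11 U power_add[of q L J]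
    by (simp only: divide_inverse inverse_mult_distrib mult_ac)
  also have "\<dots> = q ^ J * q ^ (J * (L - l)) * ef b J * ef A J * ef (A * q ^ (2 * J)) J * ef2 (1 / q ^ (2 * N)) J
        * th (A * q ^ (3 * J)) / th A
        / (ef (C * q) J * ef (1 / (C * q ^ (2 * N))) J * ef (A * q ^ (2 * N + 1)) J)
      * (size_factor (N - J) (b * q ^ J) L * inner_factor (N - J) (A * q ^ (3 * J)) (C * q ^ J) l L)"
    unfolding size_factor_def inner_factor_def U'_def e9 e10
    by (simp only: divide_inverse inverse_mult_distrib mult_ac)
  finally show ?thesis .
qed

text \<open>The divisor is the diagonal denominator of \<open>x_factor\<close>. At the node
  \<open>A * b * q ^ (2 * J) = q\<close>, so on both sides the first factorial in b is a tail of
  \<open>(q^2; q^2)\<close>. Completing these tails produces the denominators of lengths l and l + J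
  on either side, and only the lengths N - J and N distinguish them.\<close>

lemma self_b_factor_shift:
  assumes A: "A \<noteq> 0" and J: "l + J \<le> N" and b: "b = q / (A * q ^ (2 * J))"
  shows "b_factor N A b (l + J) / ef2 (q ^ 2) (l + J)
    = ef2 (q ^ 2) (N - J) / ef2 (q ^ 2) N
      * (b_factor (N - J) (A * q ^ (3 * J)) (b * q ^ J) l / ef2 (q ^ 2) l)"
proof -
  have b0: "b \<noteq> 0" "A * b * q ^ (2 * J) = q"
    unfolding b using q A by simp_all
  have a1: "A * b * q ^ (1 + 2 * (l + J)) = q ^ 2 * q ^ (2 * l)"
  proof -
    have "A * b * q ^ (1 + 2 * (l + J)) = (A * b * q ^ (2 * J)) * q * q ^ (2 * l)"
      by (simp add: power_add mult_ac)
    then show ?thesis unfolding b0 by (simp add: power2_eq_square)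
  qed
  have a2: "A * q ^ (3 * J) * (b * q ^ J) * q ^ (1 + 2 * l) = q ^ 2 * q ^ (2 * (l + J))"
  proof -
    have "3 * J + J + (1 + 2 * l) = 2 * J + 1 + 2 * (l + J)" by simp
    then have "q ^ (3 * J) * q ^ J * q ^ (1 + 2 * l) = q ^ (2 * J) * q * q ^ (2 * (l + J))"
      by (metis power_add power_one_right)
    moreover have "A * q ^ (3 * J) * (b * q ^ J) * q ^ (1 + 2 * l)
        = A * b * (q ^ (3 * J) * q ^ J * q ^ (1 + 2 * l))"
      by (simp only: mult_ac)
    ultimately have "A * q ^ (3 * J) * (b * q ^ J) * q ^ (1 + 2 * l) = (A * b * q ^ (2 * J)) * q * q ^ (2 * (l + J))"
      by (simp only: mult.assoc)
    then show ?thesis unfolding b0 by (simp add: power2_eq_square)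
  qed
  have a3: "A * q ^ (3 * J) * q ^ (2 + 2 * l) / (b * q ^ J) = A * q ^ (2 + 2 * (l + J)) / b"
  proof -
    have "3 * J + (2 + 2 * l) = J + (2 + 2 * (l + J))" by simp
    then have "q ^ (3 * J) * q ^ (2 + 2 * l) = q ^ J * q ^ (2 + 2 * (l + J))"
      by (metis power_add)
    then show ?thesis
      unfolding mult.assoc[of A] using q by (simp only: mult_divide_mult_cancel_left mult.left_commute[of _ "q ^ J"] mult.commute[of b "q ^ J"] power_not_zero not_False_eq_True)
  qed
  have s1: "ef2 (q ^ 2) (N - J) = ef2 (q ^ 2) l * ef2 (q ^ 2 * q ^ (2 * l)) (N - (l + J))"
    by (rule ef2_split) (use J in auto)
  have s2: "ef2 (q ^ 2) N = ef2 (q ^ 2) (l + J) * ef2 (q ^ 2 * q ^ (2 * (l + J))) (N - (l + J))"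
    by (rule ef2_split) (use J in auto)
  have d: "N - J - l = N - (l + J)" by simp
  show ?thesis
    unfolding b_factor_def a1 a2 a3 d s1 s2
    using ef2_q2_nonzero[of "l + J"] ef2_q2_nonzero[of l] ef2_q2_nonzero[of N, unfolded s2] by simp
qed

section \<open>Constants produced by the shift, matched with the right-hand side\<close>

text \<open>\<open>(A q; q)_{2N}\<close> is cut into lengths J, 2 (N - J), J. The first block
  absorbs the theta quotient, the middle one belongs to the smaller right-hand side, and the last is
  the reversal of \<open>(1 / (A q^{2N}); q)_J\<close>.\<close>

lemma inner_const_numerator:
  assumes A: "A \<noteq> 0" "th A \<noteq> 0" and J: "J \<le> N"
  shows "th (A * q ^ J) / th A * ef A J * ef (1 / (A * q ^ (2 * N))) J * ef (A * q ^ J * q) (2 * (N - J))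
    = reversal_factor q J / (A * q ^ (2 * N + 1 - J)) ^ J * ef (A * q) (2 * N)"
proof -
  have e1: "2 * N = J + (2 * (N - J) + J)" using J by simp
  have "ef (A * q) (2 * N) = ef (A * q) J * ef (A * q ^ J * q) (2 * (N - J) + J)"
    by (rule ef_split[OF e1]) (simp only: mult_ac)
  also have "ef (A * q ^ J * q) (2 * (N - J) + J)
      = ef (A * q ^ J * q) (2 * (N - J)) * ef (A * q ^ (2 * N + 1 - J)) J"
  proof (rule ef_split[OF refl])
    have "2 * N + 1 - J = J + 1 + 2 * (N - J)" using J by simp
    then show "A * q ^ (2 * N + 1 - J) = A * q ^ J * q * q ^ (2 * (N - J))"
      by (simp only: power_add power_one_right mult.assoc)
  qed
  finally have s: "ef (A * q) (2 * N)
      = ef (A * q) J * (ef (A * q ^ J * q) (2 * (N - J)) * ef (A * q ^ (2 * N + 1 - J)) J)" .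
  have r: "ef (1 / (A * q ^ (2 * N))) J
      = reversal_factor q J * ef (A * q ^ (2 * N + 1 - J)) J / (A * q ^ (2 * N + 1 - J)) ^ J"
  proof (rule ef_reverse)
    have "2 * N + 1 - J + J = 2 * N + 1" using J by simp
    then have e: "A * q ^ (2 * N + 1 - J) * q ^ J = A * q ^ (2 * N) * q"
      by (metis power_add power_one_right mult.assoc)
    show "1 / (A * q ^ (2 * N)) = q / (A * q ^ (2 * N + 1 - J) * q ^ J)"
      unfolding e using q by simp
  qed (use A q in simp)
  have t: "th (A * q ^ J) / th A * ef A J = ef (A * q) J"
    using ell_fact_shift[of A q p J] A by (simp add: field_simps)
  show ?thesis
    unfolding s r t by (simp only: divide_inverse mult_ac)
qed

text \<open>Reciprocal of the numerator identity, taken at C.\<close>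

lemma inner_const_denominator:
  assumes C: "C \<noteq> 0" "\<And>n. th (C * q ^ n) \<noteq> 0" and J: "J \<le> N"
  shows "1 / (ef (C * q) J * ef (1 / (C * q ^ (2 * N))) J) / ef (C * q ^ J * q) (2 * (N - J))
    = (C * q ^ (2 * N + 1 - J)) ^ J / reversal_factor q J / ef (C * q) (2 * N)"
proof -
  have C0: "th C \<noteq> 0" using C(2)[of 0] by simp
  have g: "ef (C * q ^ n) m \<noteq> 0" for n m
    using C by (simp add: ell_fact_def mult.assoc power_add[symmetric])
  have t: "th (C * q ^ J) / th C * ef C J = ef (C * q) J"
    using ell_fact_shift[of C q p J] C0 by (simp add: field_simps)
  have e: "ef (C * q) J * ef (1 / (C * q ^ (2 * N))) J * ef (C * q ^ J * q) (2 * (N - J))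
    = reversal_factor q J / (C * q ^ (2 * N + 1 - J)) ^ J * ef (C * q) (2 * N)"
    using inner_const_numerator[OF C(1) C0 J] unfolding t .
  have "1 / (ef (C * q) J * ef (1 / (C * q ^ (2 * N))) J) / ef (C * q ^ J * q) (2 * (N - J))
      = 1 / (ef (C * q) J * ef (1 / (C * q ^ (2 * N))) J * ef (C * q ^ J * q) (2 * (N - J)))"
    by simp
  also have "\<dots> = (C * q ^ (2 * N + 1 - J)) ^ J / reversal_factor q J / ef (C * q) (2 * N)"
    unfolding e by simp
  finally show ?thesis .
qed

text \<open>Reversal makes the last factorial start at y; telescoping then removes every theta value
  and leaves a monomial.\<close>

lemma theta_const:
  assumes y: "y \<noteq> 0" "th y \<noteq> 0" "ef2 (q ^ 2 * y) J \<noteq> 0"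
  shows "th (y * q ^ (2 * J)) / th y / ef2 (q ^ 2 * y) J * ef2 (q ^ 2 / (y * q ^ (2 * J))) J
    = reversal_factor (q ^ 2) J / y ^ J"
proof -
  have r: "ef2 (q ^ 2 / (y * q ^ (2 * J))) J = reversal_factor (q ^ 2) J * ef2 y J / y ^ J"
    by (rule ef2_reverse) (use y in \<open>simp_all add: power_mult\<close>)
  have "ef2 y J * th (y * q ^ (2 * J)) = th y * ef2 (q ^ 2 * y) J"
    using ell_fact_shift[of y "q ^ 2" p J] unfolding power_mult by (simp only: mult.commute)
  then have "th (y * q ^ (2 * J)) / th y / ef2 (q ^ 2 * y) J * ef2 y J = 1"
    using y by (simp add: mult.commute)
  then have "th (y * q ^ (2 * J)) / th y / ef2 (q ^ 2 * y) J * ef2 y J * (reversal_factor (q ^ 2) J / y ^ J)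
      = reversal_factor (q ^ 2) J / y ^ J"
    by simp
  then show ?thesis
    unfolding r by (simp only: divide_inverse mult_ac)
qed

text \<open>At the node \<open>a * b * q / c\<close> equals
  \<open>q ^ 2 / (c * X * q ^ (2 * J))\<close>, so the first J factors reverse to
  \<open>(c X; q^2)_J\<close>. In the second factorial it is the last J factors that match a block
  of \<open>x_factor\<close>.\<close>

lemma rhs_c_const:
  assumes nz: "a \<noteq> 0" "c \<noteq> 0" "X \<noteq> 0" and J: "J \<le> N" and b: "b = q / (a * X * q ^ (2 * J))"
  shows "ef2 (a * b * q / c) N
      = reversal_factor (q ^ 2) J * ef2 (c * X) J / (c * X) ^ J
        * ef2 (a * q ^ J * (b * q ^ J) * q / c) (N - J)"
    and "ef2 (a * q ^ 2 / (b * c)) N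
      = ef2 (a * q ^ J * q ^ 2 / (b * q ^ J * c)) (N - J) * ef2 (a ^ 2 * q ^ (2 * N + 1) * X / c) J"
proof -
  have "ef2 (a * b * q / c) N = ef2 (a * b * q / c) J * ef2 (a * q ^ J * (b * q ^ J) * q / c) (N - J)"
  proof (rule ef2_split)
    have "q ^ (2 * J) = q ^ J * q ^ J" by (simp only: mult_2 power_add)
    then show "a * q ^ J * (b * q ^ J) * q / c = a * b * q / c * q ^ (2 * J)"
      by (simp only: divide_inverse mult_ac)
  qed (use J in simp)
  also have "ef2 (a * b * q / c) J = reversal_factor (q ^ 2) J * ef2 (c * X) J / (c * X) ^ J"
    by (rule ef2_reverse) (use nz b q in \<open>simp_all add: power2_eq_square power_mult[symmetric] power_mult\<close>)
  finally show "ef2 (a * b * q / c) N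
      = reversal_factor (q ^ 2) J * ef2 (c * X) J / (c * X) ^ J
        * ef2 (a * q ^ J * (b * q ^ J) * q / c) (N - J)" .
  have e: "a * q ^ J * q ^ 2 / (b * q ^ J * c) = a * q ^ 2 / (b * c)"
    using q by simp
  show "ef2 (a * q ^ 2 / (b * c)) N
      = ef2 (a * q ^ J * q ^ 2 / (b * q ^ J * c)) (N - J) * ef2 (a ^ 2 * q ^ (2 * N + 1) * X / c) J"
    unfolding e
  proof (rule ef2_split)
    have "2 * N + 1 + 1 = 2 * J + 2 + 2 * (N - J)" using J by simp
    then have E: "q ^ (2 * N + 1) * q = q ^ (2 * J) * q ^ 2 * q ^ (2 * (N - J))"
      by (metis power_add power_one_right)
    have "a * q ^ 2 / (b * c) * q ^ (2 * (N - J)) * q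
        = a ^ 2 * X * (q ^ (2 * J) * q ^ 2 * q ^ (2 * (N - J))) / c"
      unfolding b using nz q by (simp add: power2_eq_square)
    also have "\<dots> = a ^ 2 * q ^ (2 * N + 1) * X / c * q"
      unfolding E[symmetric] by (simp only: divide_inverse mult_ac)
    finally show "a ^ 2 * q ^ (2 * N + 1) * X / c = a * q ^ 2 / (b * c) * q ^ (2 * (N - J))"
      using q by (metis mult_cancel_right)
  qed (use J in simp)
qed

text \<open>Collects, line by line, what the pair, inner, b and two x factors leave behind for the
  shifted index, with \<open>X = x i\<close>, and another index, with
  \<open>Y = x m\<close>.\<close>

definition kappa_other :: "nat \<Rightarrow> nat \<Rightarrow> complex \<Rightarrow> complex \<Rightarrow> complex \<Rightarrow> complex \<Rightarrow> complex \<Rightarrow> complex" where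
  "kappa_other N J a b c X Y =
     (th (X * q ^ (2 * J) / Y) / th (X / Y) / ef2 (a ^ 2 * X * Y * q ^ (2 * N + 1)) J)
     * (th (a * Y * q ^ J) / th (a * Y) * ef (a * Y) J * ef (1 / (a * Y * q ^ (2 * N))) J
        / (ef (a / c * q) J * ef (1 / (a / c * q ^ (2 * N))) J))
     * ef2 (a * Y * q ^ (2 + 2 * (N - J)) / b) J
     * (ef2 (c * X) J * ef2 (a ^ 2 * q ^ (2 * N + 1) * X / c) J / ef2 (q ^ 2 * X / Y) J)
     * ef2 (q ^ 2 * Y / (X * q ^ (2 * J))) J"

lemma kappa_other_rhs:
  assumes nz: "a \<noteq> 0" "c \<noteq> 0" "X \<noteq> 0" "Y \<noteq> 0" and J: "J \<le> N" and b: "b = q / (a * X * q ^ (2 * J))"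
    and gA: "th (a * Y) \<noteq> 0" and gC: "\<And>n. th (a / c * q ^ n) \<noteq> 0"
    and gXY: "th (X / Y) \<noteq> 0" "ef2 (q ^ 2 * X / Y) J \<noteq> 0" "ef2 (a ^ 2 * X * Y * q ^ (2 * N + 1)) J \<noteq> 0"
  shows "kappa_other N J a b c X Y * rhs_factor (N - J) (a * q ^ J) (b * q ^ J) (a * q ^ J * Y) c
    = rhs_factor N a b (a * Y) c"
proof -
  let ?R = "reversal_factor q J" and ?R2 = "reversal_factor (q ^ 2) J"
  have fA: "th (a * Y * q ^ J) / th (a * Y) * ef (a * Y) J * ef (1 / (a * Y * q ^ (2 * N))) J
      * ef (a * Y * q ^ J * q) (2 * (N - J)) = ?R / (a * Y * q ^ (2 * N + 1 - J)) ^ J * ef (a * Y * q) (2 * N)"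
    by (rule inner_const_numerator) (use nz gA J in auto)
  have fC: "1 / (ef (a / c * q) J * ef (1 / (a / c * q ^ (2 * N))) J) / ef (a / c * q ^ J * q) (2 * (N - J))
    = (a / c * q ^ (2 * N + 1 - J)) ^ J / ?R / ef (a / c * q) (2 * N)"
    by (rule inner_const_denominator) (use nz gC J in auto)
  have fy: "th (X * q ^ (2 * J) / Y) / th (X / Y) / ef2 (q ^ 2 * X / Y) J * ef2 (q ^ 2 * Y / (X * q ^ (2 * J))) J
      = ?R2 / (X / Y) ^ J"
    using theta_const[of "X / Y" J] nz gXY by simp
  note fd = rhs_c_const(1)[OF nz(1,2,3) J b] and fe = rhs_c_const(2)[OF nz(1,2,3) J b]
  \<comment> \<open>At the node the block left by the b factor has the same base as the denominator
    left by the pair factor.\<close>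
  have f0: "ef2 (a * Y * q ^ (2 + 2 * (N - J)) / b) J / ef2 (a ^ 2 * X * Y * q ^ (2 * N + 1)) J = 1"
  proof -
    have "2 + 2 * (N - J) + 2 * J = 2 * N + 1 + 1" using J by simp
    then have E: "q ^ (2 + 2 * (N - J)) * q ^ (2 * J) = q ^ (2 * N + 1) * q"
      by (metis power_add power_one_right)
    have "a * Y * q ^ (2 + 2 * (N - J)) / b = a ^ 2 * X * Y * (q ^ (2 + 2 * (N - J)) * q ^ (2 * J)) / q"
      unfolding b by (simp add: power2_eq_square)
    also have "\<dots> = a ^ 2 * X * Y * q ^ (2 * N + 1)"
      unfolding E using q by simp
    finally show ?thesis using gXY by simp
  qed
  \<comment> \<open>The monomials of the three reversals combine to the single one in
    \<open>rhs_c_const\<close>.\<close>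
  have fp: "?R / (a * Y * q ^ (2 * N + 1 - J)) ^ J * ((a / c * q ^ (2 * N + 1 - J)) ^ J / ?R)
      * (?R2 / (X / Y) ^ J) = ?R2 / (c * X) ^ J"
  proof -
    have "(a / c * q ^ (2 * N + 1 - J)) ^ J / (a * Y * q ^ (2 * N + 1 - J)) ^ J / (X / Y) ^ J
        = ((a / c * q ^ (2 * N + 1 - J)) / (a * Y * q ^ (2 * N + 1 - J)) / (X / Y)) ^ J"
      by (simp only: power_divide)
    also have "(a / c * q ^ (2 * N + 1 - J)) / (a * Y * q ^ (2 * N + 1 - J)) / (X / Y) = 1 / (c * X)"
      using nz q by simp
    finally have e: "(a / c * q ^ (2 * N + 1 - J)) ^ J / (a * Y * q ^ (2 * N + 1 - J)) ^ J / (X / Y) ^ J = 1 / (c * X) ^ J"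
      by (simp only: power_one_over)
    have g: "r / u * (v / r) * (w / z) = w * (v / u / z)" if "r \<noteq> 0" for r u v w z :: complex
      using that by simp
    show ?thesis
      unfolding g[OF reversal_factor_nonzero[OF q]] e by simp
  qed
  have a1: "a * q ^ J * Y * q = a * Y * q ^ J * q" "a * q ^ J / c * q = a / c * q ^ J * q"
    by (simp_all add: mult_ac)
  define D where "D = ef2 (a * q ^ J * (b * q ^ J) * q / c) (N - J)"
  define E where "E = ef2 (a * q ^ J * q ^ 2 / (b * q ^ J * c)) (N - J)"
  define G where "G = ef2 (a ^ 2 * q ^ (2 * N + 1) * X / c) J"
  have "kappa_other N J a b c X Y * rhs_factor (N - J) (a * q ^ J) (b * q ^ J) (a * q ^ J * Y) c
    = (th (a * Y * q ^ J) / th (a * Y) * ef (a * Y) J * ef (1 / (a * Y * q ^ (2 * N))) J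
        * ef (a * Y * q ^ J * q) (2 * (N - J)))
      * (1 / (ef (a / c * q) J * ef (1 / (a / c * q ^ (2 * N))) J) / ef (a / c * q ^ J * q) (2 * (N - J)))
      * (th (X * q ^ (2 * J) / Y) / th (X / Y) / ef2 (q ^ 2 * X / Y) J * ef2 (q ^ 2 * Y / (X * q ^ (2 * J))) J)
      * (ef2 (a * Y * q ^ (2 + 2 * (N - J)) / b) J / ef2 (a ^ 2 * X * Y * q ^ (2 * N + 1)) J)
      * ef2 (c * X) J * G * D * E"
    unfolding kappa_other_def rhs_factor_def a1 D_def[symmetric] E_def[symmetric] G_def[symmetric]
    by (simp only: divide_inverse inverse_mult_distrib mult_ac mult_1_left)
  also have "\<dots> = (?R / (a * Y * q ^ (2 * N + 1 - J)) ^ J * ((a / c * q ^ (2 * N + 1 - J)) ^ J / ?R)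
      * (?R2 / (X / Y) ^ J)) * ef (a * Y * q) (2 * N) / ef (a / c * q) (2 * N) * ef2 (c * X) J * G * D * E"
    unfolding fA fC fy f0
    by (simp only: divide_inverse mult_ac mult_1_left)
  also have "\<dots> = rhs_factor N a b (a * Y) c"
    unfolding fp rhs_factor_def fd fe D_def[symmetric] E_def[symmetric] G_def[symmetric]
    by (simp only: divide_inverse mult_ac)
  finally show ?thesis .
qed

definition kappa_self :: "nat \<Rightarrow> nat \<Rightarrow> complex \<Rightarrow> complex \<Rightarrow> complex \<Rightarrow> complex \<Rightarrow> complex" where
  "kappa_self N J a b c X =
     q ^ J * ef b J * ef (a * X) J * ef (a * X * q ^ (2 * J)) J * ef2 (1 / q ^ (2 * N)) J
        * th (a * X * q ^ (3 * J)) / th (a * X)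
        / (ef (a / c * q) J * ef (1 / (a / c * q ^ (2 * N))) J * ef (a * X * q ^ (2 * N + 1)) J)
     * (ef2 (q ^ 2) (N - J) / ef2 (q ^ 2) N)
     * (ef2 (c * X) J * ef2 (a ^ 2 * q ^ (2 * N + 1) * X / c) J)"

lemma kappa_self_rhs:
  assumes nz: "a \<noteq> 0" "c \<noteq> 0" "X \<noteq> 0" and J: "J \<le> N" and b: "b = q / (a * X * q ^ (2 * J))"
    and gA: "\<And>n. th (a * X * q ^ n) \<noteq> 0" and gC: "\<And>n. th (a / c * q ^ n) \<noteq> 0"
  shows "kappa_self N J a b c X * rhs_factor (N - J) (a * q ^ J) (b * q ^ J) (a * X * q ^ (3 * J)) c
    = rhs_factor N a b (a * X) c"
proof -
  let ?R = "reversal_factor q J" and ?R2 = "reversal_factor (q ^ 2) J"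
  define A where "A = a * X"
  have A: "A \<noteq> 0" using nz by (simp add: A_def)
  have gA: "th (A * q ^ n) \<noteq> 0" for n using gA by (simp add: A_def)
  then have A0: "th A \<noteq> 0" using gA[of 0] by simp
  have gfA: "ef (A * q ^ n) m \<noteq> 0" for n m
    using gA by (simp add: ell_fact_def mult.assoc power_add[symmetric])
  have fb: "ef b J = ?R * ef (A * q ^ J) J / (A * q ^ J) ^ J"
    by (rule ef_reverse) (use A q in \<open>simp_all add: b A_def mult_2 power_add\<close>)
  \<comment> \<open>Both sides are \<open>(A; q)_{2N + 1 + J}\<close>, cut once into lengths J, J,
    J, 1, 2 (N - J) and once into 1, 2 N, J.\<close>
  have fA: "ef A J * ef (A * q ^ J) J * ef (A * q ^ (2 * J)) J * th (A * q ^ (3 * J))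
      * ef (A * q ^ (3 * J) * q) (2 * (N - J)) = th A * ef (A * q) (2 * N) * ef (A * q ^ (2 * N + 1)) J"
  proof -
    have "2 * N + 1 + J = J + (J + (J + (1 + 2 * (N - J))))" using J by simp
    then have "ef A (2 * N + 1 + J) = ef A J * ef (A * q ^ J) (J + (J + (1 + 2 * (N - J))))"
      by (rule ef_split) simp
    also have "ef (A * q ^ J) (J + (J + (1 + 2 * (N - J)))) = ef (A * q ^ J) J * ef (A * q ^ (2 * J)) (J + (1 + 2 * (N - J)))"
      by (rule ef_split) (simp_all add: mult_2 power_add)
    also have "ef (A * q ^ (2 * J)) (J + (1 + 2 * (N - J))) = ef (A * q ^ (2 * J)) J * ef (A * q ^ (3 * J)) (1 + 2 * (N - J))"
      by (rule ef_split) (simp_all add: mult.assoc power_add[symmetric])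
    also have "ef (A * q ^ (3 * J)) (1 + 2 * (N - J)) = ef (A * q ^ (3 * J)) 1 * ef (A * q ^ (3 * J) * q) (2 * (N - J))"
      by (rule ef_split) simp_all
    finally have 1: "ef A (2 * N + 1 + J) = ef A J * (ef (A * q ^ J) J * (ef (A * q ^ (2 * J)) J
       * (th (A * q ^ (3 * J)) * ef (A * q ^ (3 * J) * q) (2 * (N - J)))))"
      by simp
    have "2 * N + 1 + J = 1 + (2 * N + J)" by simp
    then have "ef A (2 * N + 1 + J) = ef A 1 * ef (A * q) (2 * N + J)"
      by (rule ef_split) simp
    also have "ef (A * q) (2 * N + J) = ef (A * q) (2 * N) * ef (A * q ^ (2 * N + 1)) J"
      by (rule ef_split) (simp_all add: mult_ac)
    finally show ?thesis
      using 1 by (simp add: mult.assoc)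
  qed
  have fA': "ef A J * ef (A * q ^ J) J * ef (A * q ^ (2 * J)) J * th (A * q ^ (3 * J))
      * ef (A * q ^ (3 * J) * q) (2 * (N - J)) / th A / ef (A * q ^ (2 * N + 1)) J = ef (A * q) (2 * N)"
    unfolding fA using A0 gfA[of "2 * N + 1" J] by simp
  have fC: "1 / (ef (a / c * q) J * ef (1 / (a / c * q ^ (2 * N))) J) / ef (a / c * q ^ J * q) (2 * (N - J))
    = (a / c * q ^ (2 * N + 1 - J)) ^ J / ?R / ef (a / c * q) (2 * N)"
    by (rule inner_const_denominator) (use nz gC J in auto)
  define Z where "Z = q ^ (2 * (N - J) + 2)"
  have fN: "ef2 (1 / q ^ (2 * N)) J = ?R2 * ef2 Z J / Z ^ J"
  proof (rule ef2_reverse)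
    have "2 * (N - J) + 2 + 2 * J = 2 + 2 * N" using J by simp
    then have "Z * q ^ (2 * J) = q ^ 2 * q ^ (2 * N)"
      unfolding Z_def by (metis power_add)
    then show "1 / q ^ (2 * N) = q ^ 2 / (Z * (q ^ 2) ^ J)"
      using q by (simp add: power_mult[symmetric])
  qed (use q in \<open>simp add: Z_def\<close>)
  have fN': "ef2 (q ^ 2) (N - J) * ef2 Z J / ef2 (q ^ 2) N = 1"
  proof -
    have "ef2 (q ^ 2) N = ef2 (q ^ 2) (N - J) * ef2 Z J"
      by (rule ef2_split) (use J in \<open>simp_all add: Z_def power_add power2_eq_square mult_ac\<close>)
    then show ?thesis
      using ef2_q2_nonzero[of N] by simp
  qed
  note fd = rhs_c_const(1)[OF nz J b] and fe = rhs_c_const(2)[OF nz J b]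
  \<comment> \<open>The leading \<open>q ^ J\<close>, the share of q^|k| taken by the shift, is what
    balances the exponents: \<open>q ^ J * Z = q * q ^ (2 * N + 1 - J)\<close>.\<close>
  have fp: "q ^ J * (?R / (A * q ^ J) ^ J) * (?R2 / Z ^ J) * ((a / c * q ^ (2 * N + 1 - J)) ^ J / ?R)
      = ?R2 / (c * X) ^ J"
  proof -
    have "q ^ J * (a / c * q ^ (2 * N + 1 - J)) ^ J / (A * q ^ J) ^ J / Z ^ J
        = (q * (a / c * q ^ (2 * N + 1 - J)) / (A * q ^ J) / Z) ^ J"
      by (simp only: power_divide power_mult_distrib)
    also have "q * (a / c * q ^ (2 * N + 1 - J)) / (A * q ^ J) / Z = 1 / (c * X)"
    proof -
      have "J + (2 * (N - J) + 2) = 1 + (2 * N + 1 - J)" using J by simp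
      then have E: "q ^ J * Z = q * q ^ (2 * N + 1 - J)"
        unfolding Z_def by (metis power_add power_one_right)
      have "q * (a / c * q ^ (2 * N + 1 - J)) / (A * q ^ J) / Z = (a / c) * (q * q ^ (2 * N + 1 - J)) / (A * (q ^ J * Z))"
        by (simp only: divide_inverse inverse_mult_distrib mult_ac)
      also have "\<dots> = 1 / (c * X)"
        unfolding E A_def using nz q by simp
      finally show ?thesis .
    qed
    finally have e: "q ^ J * (a / c * q ^ (2 * N + 1 - J)) ^ J / (A * q ^ J) ^ J / Z ^ J = 1 / (c * X) ^ J"
      by (simp only: power_one_over)
    have g: "x * (r / u) * (w / z) * (v / r) = w * (x * v / u / z)" if "r \<noteq> 0" for r u v w z x :: complex
      using that by simp
    show ?thesis
      unfolding g[OF reversal_factor_nonzero[OF q]] e by simp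
  qed
  have a1: "a * q ^ J / c * q = a / c * q ^ J * q"
    by (simp add: mult_ac)
  define D where "D = ef2 (a * q ^ J * (b * q ^ J) * q / c) (N - J)"
  define E where "E = ef2 (a * q ^ J * q ^ 2 / (b * q ^ J * c)) (N - J)"
  define G where "G = ef2 (a ^ 2 * q ^ (2 * N + 1) * X / c) J"
  have "kappa_self N J a b c X * rhs_factor (N - J) (a * q ^ J) (b * q ^ J) (a * X * q ^ (3 * J)) c
    = (ef A J * ef (A * q ^ J) J * ef (A * q ^ (2 * J)) J * th (A * q ^ (3 * J))
      * ef (A * q ^ (3 * J) * q) (2 * (N - J)) / th A / ef (A * q ^ (2 * N + 1)) J)
      * (1 / (ef (a / c * q) J * ef (1 / (a / c * q ^ (2 * N))) J) / ef (a / c * q ^ J * q) (2 * (N - J)))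
      * (ef2 (q ^ 2) (N - J) * ef2 Z J / ef2 (q ^ 2) N)
      * (q ^ J * (?R / (A * q ^ J) ^ J) * (?R2 / Z ^ J))
      * ef2 (c * X) J * G * D * E"
    unfolding kappa_self_def rhs_factor_def a1 D_def[symmetric] E_def[symmetric] G_def[symmetric]
      A_def[symmetric] fb fN
    by (simp only: divide_inverse inverse_mult_distrib mult_ac mult_1_left)
  also have "\<dots> = (q ^ J * (?R / (A * q ^ J) ^ J) * (?R2 / Z ^ J) * ((a / c * q ^ (2 * N + 1 - J)) ^ J / ?R))
      * ef (A * q) (2 * N) / ef (a / c * q) (2 * N) * ef2 (c * X) J * G * D * E"
    unfolding fA' fC fN'
    by (simp only: divide_inverse mult_ac mult_1_left)
  also have "\<dots> = rhs_factor N a b (a * X) c"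
    unfolding fp rhs_factor_def fd fe D_def[symmetric] E_def[symmetric] G_def[symmetric] A_def[symmetric]
    by (simp only: divide_inverse mult_ac)
  finally show ?thesis .
qed

section \<open>Assembling the shift of all factors attached to an index\<close>

lemma other_shift:
  assumes nz: "a \<noteq> 0" "c \<noteq> 0" "X \<noteq> 0" "Y \<noteq> 0" and J: "h \<le> L" "L + J \<le> N" and b: "b = q / (a * X * q ^ (2 * J))"
    and gA: "th (a * Y * q ^ J) \<noteq> 0"
    and gXY: "th (X * q ^ (2 * J) / Y) \<noteq> 0" "ef2 (q ^ 2 * Y / X) h \<noteq> 0" "ef2 (q ^ 2 * Y / (X * q ^ (2 * J))) h \<noteq> 0"
  shows "pair_factor N a X Y (l + J) h * inner_factor N (a * Y) (a / c) h (L + J) * b_factor N (a * Y) b h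
      * x_factor N a c X Y (l + J) * x_factor N a d Y X h * q ^ (J * h)
    = kappa_other N J a b c X Y
      * (pair_factor (N - J) (a * q ^ J) (X * q ^ (2 * J)) Y l h
         * inner_factor (N - J) (a * q ^ J * Y) (a * q ^ J / c) h L
         * b_factor (N - J) (a * q ^ J * Y) (b * q ^ J) h
         * x_factor (N - J) (a * q ^ J) c (X * q ^ (2 * J)) Y l
         * x_factor (N - J) (a * q ^ J) d Y (X * q ^ (2 * J)) h)"
proof -
  have JN: "J \<le> N" using J by simp
  have a1: "a * q ^ J * Y = a * Y * q ^ J" "a * q ^ J / c = a / c * q ^ J"
    by simp_all
  \<comment> \<open>Here the node enters: the h-dependent block left by the b factor acquires the
    base that \<open>x_factor_shift_right\<close> absorbs.\<close>
  have a2: "a * Y * b * q ^ (1 + 2 * h) = q ^ 2 * Y / (X * q ^ (2 * J)) * q ^ (2 * h)"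
    unfolding b using nz by (simp add: power_add power2_eq_square)
  have p: "pair_factor N a X Y (l + J) h * q ^ (J * h)
    = th (X * q ^ (2 * J) / Y) / th (X / Y) / ef2 (a ^ 2 * X * Y * q ^ (2 * N + 1)) J
      * pair_factor (N - J) (a * q ^ J) (X * q ^ (2 * J)) Y l h"
    by (rule pair_factor_shift) (use nz gXY JN in auto)
  have i: "inner_factor N (a * Y) (a / c) h (L + J)
    = th (a * Y * q ^ J) / th (a * Y) * ef (a * Y) J * ef (1 / (a * Y * q ^ (2 * N))) J
        / (ef (a / c * q) J * ef (1 / (a / c * q ^ (2 * N))) J)
      * inner_factor (N - J) (a * q ^ J * Y) (a * q ^ J / c) h L"
    unfolding a1 by (rule inner_factor_shift_other) (use nz gA J in auto)
  have bf: "b_factor N (a * Y) b h = ef2 (a * Y * b * q ^ (1 + 2 * h)) J * ef2 (a * Y * q ^ (2 + 2 * (N - J)) / b) J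
    * b_factor (N - J) (a * q ^ J * Y) (b * q ^ J) h"
    unfolding a1 by (rule b_factor_shift_other) (use J in auto)
  note x1 = x_factor_shift_left[OF JN, of a c X Y l]
  have x2: "x_factor N a d Y X h * ef2 (a * Y * b * q ^ (1 + 2 * h)) J
    = ef2 (q ^ 2 * Y / (X * q ^ (2 * J))) J * x_factor (N - J) (a * q ^ J) d Y (X * q ^ (2 * J)) h"
    unfolding a2 by (rule x_factor_shift_right) (use nz gXY JN in auto)
  define P I B X1 X2 where "P = pair_factor (N - J) (a * q ^ J) (X * q ^ (2 * J)) Y l h"
    and "I = inner_factor (N - J) (a * q ^ J * Y) (a * q ^ J / c) h L"
    and "B = b_factor (N - J) (a * q ^ J * Y) (b * q ^ J) h"
    and "X1 = x_factor (N - J) (a * q ^ J) c (X * q ^ (2 * J)) Y l"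
    and "X2 = x_factor (N - J) (a * q ^ J) d Y (X * q ^ (2 * J)) h"
  note defs = P_def[symmetric] I_def[symmetric] B_def[symmetric] X1_def[symmetric] X2_def[symmetric]
  have "pair_factor N a X Y (l + J) h * inner_factor N (a * Y) (a / c) h (L + J) * b_factor N (a * Y) b h
      * x_factor N a c X Y (l + J) * x_factor N a d Y X h * q ^ (J * h)
    = (pair_factor N a X Y (l + J) h * q ^ (J * h)) * inner_factor N (a * Y) (a / c) h (L + J)
      * ef2 (a * Y * q ^ (2 + 2 * (N - J)) / b) J * B
      * x_factor N a c X Y (l + J) * (x_factor N a d Y X h * ef2 (a * Y * b * q ^ (1 + 2 * h)) J)"
    unfolding bf defs by (simp only: mult_ac)
  also have "\<dots> = kappa_other N J a b c X Y * (P * I * B * X1 * X2)"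
    unfolding p i x1 x2 kappa_other_def defs by (simp only: mult_ac)
  finally show ?thesis
    unfolding defs .
qed

lemma self_total_shift:
  assumes nz: "a \<noteq> 0" "c \<noteq> 0" "X \<noteq> 0" and J: "l \<le> L" "L + J \<le> N" and b: "b = q / (a * X * q ^ (2 * J))"
    and gA: "\<And>n. th (a * X * q ^ n) \<noteq> 0"
  shows "size_factor N b (L + J) * inner_factor N (a * X) (a / c) (l + J) (L + J)
      * b_factor N (a * X) b (l + J) * x_factor N a c X X (l + J)
    = kappa_self N J a b c X * q ^ (J * (L - l))
      * (size_factor (N - J) (b * q ^ J) L
         * inner_factor (N - J) (a * X * q ^ (3 * J)) (a * q ^ J / c) l L
         * b_factor (N - J) (a * X * q ^ (3 * J)) (b * q ^ J) l
         * x_factor (N - J) (a * q ^ J) c (X * q ^ (2 * J)) (X * q ^ (2 * J)) l)"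
proof -
  have JN: "J \<le> N" "l + J \<le> N" using J by simp_all
  have s: "size_factor N b (L + J) * inner_factor N (a * X) (a / c) (l + J) (L + J)
    = q ^ J * q ^ (J * (L - l)) * ef b J * ef (a * X) J * ef (a * X * q ^ (2 * J)) J * ef2 (1 / q ^ (2 * N)) J
        * th (a * X * q ^ (3 * J)) / th (a * X)
        / (ef (a / c * q) J * ef (1 / (a / c * q ^ (2 * N))) J * ef (a * X * q ^ (2 * N + 1)) J)
      * (size_factor (N - J) (b * q ^ J) L * inner_factor (N - J) (a * X * q ^ (3 * J)) (a / c * q ^ J) l L)"
    by (rule self_shift) (use nz J b gA in auto)
  have bf: "b_factor N (a * X) b (l + J) / ef2 (q ^ 2) (l + J)
    = ef2 (q ^ 2) (N - J) / ef2 (q ^ 2) N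
      * (b_factor (N - J) (a * X * q ^ (3 * J)) (b * q ^ J) l / ef2 (q ^ 2) l)"
    by (rule self_b_factor_shift) (use nz JN b in auto)
  have e1: "ef2 (c * X) (l + J) = ef2 (c * X) J * ef2 (c * (X * q ^ (2 * J))) l"
    by (rule ef2_split) auto
  have e2: "ef2 (a ^ 2 * q ^ (2 * N + 1) * X / c) (l + J) = ef2 (a ^ 2 * q ^ (2 * N + 1) * X / c) J
      * ef2 (a ^ 2 * q ^ (2 * N + 1) * (X * q ^ (2 * J)) / c) l"
    by (rule ef2_split) auto
  have e3: "q ^ 2 * X / X = q ^ 2" "q ^ 2 * (X * q ^ (2 * J)) / (X * q ^ (2 * J)) = q ^ 2"
    using nz q by simp_all
  have a1: "a * q ^ J / c = a / c * q ^ J" by simp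
  define S I B where "S = size_factor (N - J) (b * q ^ J) L"
    and "I = inner_factor (N - J) (a * X * q ^ (3 * J)) (a / c * q ^ J) l L"
    and "B = b_factor (N - J) (a * X * q ^ (3 * J)) (b * q ^ J) l"
  note defs = S_def[symmetric] I_def[symmetric] B_def[symmetric]
  have "size_factor N b (L + J) * inner_factor N (a * X) (a / c) (l + J) (L + J)
      * b_factor N (a * X) b (l + J) * x_factor N a c X X (l + J)
    = (size_factor N b (L + J) * inner_factor N (a * X) (a / c) (l + J) (L + J))
      * (b_factor N (a * X) b (l + J) / ef2 (q ^ 2) (l + J))
      * (ef2 (c * X) (l + J) * ef2 (a ^ 2 * q ^ (2 * N + 1) * X / c) (l + J))"
    unfolding x_factor_def e3 by (simp only: divide_inverse mult_ac)
  also have "\<dots> = kappa_self N J a b c X * q ^ (J * (L - l))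
      * (S * I * B * (ef2 (c * (X * q ^ (2 * J))) l
          * ef2 (a ^ 2 * q ^ (2 * N + 1) * (X * q ^ (2 * J)) / c) l / ef2 (q ^ 2) l))"
    unfolding s bf e1 e2 kappa_self_def defs by (simp only: divide_inverse mult_ac)
  finally show ?thesis
    unfolding x_factor_def e3 x_factor_arg[OF JN(1)] a1 defs .
qed

end

section \<open>Isolating one index in finite products\<close>

lemma prod_pairs_remove:
  fixes f :: "nat \<Rightarrow> nat \<Rightarrow> complex"
  assumes i: "i \<in> {1..r}" and sym: "\<And>m j. \<lbrakk>m \<in> {1..r}; j \<in> {1..r}\<rbrakk> \<Longrightarrow> f m j = f j m"
  shows "(\<Prod>m\<in>{1..r}. \<Prod>j\<in>{m<..r}. f m j)
    = (\<Prod>z\<in>{(m, j). m \<in> {1..r} - {i} \<and> j \<in> {m<..r} - {i}}. f (fst z) (snd z))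
      * (\<Prod>m\<in>{1..r} - {i}. f i m)"
proof -
  let ?S = "Sigma {1..r} (\<lambda>m. {m<..r})"
  let ?P = "{(m, j). m \<in> {1..r} - {i} \<and> j \<in> {m<..r} - {i}}"
  let ?Q = "Pair i ` {i<..r}" and ?R = "(\<lambda>m. (m, i)) ` {1..<i}"
  have S: "?S = ?P \<union> (?Q \<union> ?R)"
    using i by auto
  have fin: "finite ?P" by (rule finite_subset[of _ ?S]) auto
  have "(\<Prod>m\<in>{1..r}. \<Prod>j\<in>{m<..r}. f m j) = (\<Prod>z\<in>?S. f (fst z) (snd z))"
    by (subst prod.Sigma) (auto simp: case_prod_beta)
  also have "\<dots> = (\<Prod>z\<in>?P. f (fst z) (snd z)) * (\<Prod>z\<in>?Q \<union> ?R. f (fst z) (snd z))"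
    unfolding S by (rule prod.union_disjoint[OF fin]) auto
  also have "(\<Prod>z\<in>?Q \<union> ?R. f (fst z) (snd z)) = (\<Prod>z\<in>?Q. f (fst z) (snd z)) * (\<Prod>z\<in>?R. f (fst z) (snd z))"
    by (rule prod.union_disjoint) auto
  also have "(\<Prod>z\<in>?Q. f (fst z) (snd z)) = (\<Prod>m\<in>{i<..r}. f i m)"
    by (subst prod.reindex) (auto simp: inj_on_def)
  also have "(\<Prod>z\<in>?R. f (fst z) (snd z)) = (\<Prod>m\<in>{1..<i}. f i m)"
    by (subst prod.reindex) (use i in \<open>auto simp: inj_on_def intro!: prod.cong sym\<close>)
  also have "(\<Prod>m\<in>{i<..r}. f i m) * (\<Prod>m\<in>{1..<i}. f i m) = (\<Prod>m\<in>{i<..r} \<union> {1..<i}. f i m)"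
    by (subst prod.union_disjoint) auto
  also have "{i<..r} \<union> {1..<i} = {1..r} - {i}"
    using i by auto
  finally show ?thesis .
qed

lemma prod_square_remove:
  fixes f :: "nat \<Rightarrow> nat \<Rightarrow> complex"
  assumes i: "i \<in> {1..r}"
  shows "(\<Prod>m\<in>{1..r}. \<Prod>j\<in>{1..r}. f m j)
    = f i i * (\<Prod>m\<in>{1..r} - {i}. f i m * f m i) * (\<Prod>m\<in>{1..r} - {i}. \<Prod>j\<in>{1..r} - {i}. f m j)"
proof -
  have r: "(\<Prod>j\<in>{1..r}. g j) = g i * (\<Prod>j\<in>{1..r} - {i}. g j)" for g :: "nat \<Rightarrow> complex"
    using i by (simp add: prod.remove)
  show ?thesis
    unfolding r by (simp add: prod.distrib mult_ac)
qed

lemma vsum_remove: "i \<in> {1..r} \<Longrightarrow> vsum r l = l i + (\<Sum>m\<in>{1..r} - {i}. l m)"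
  by (simp add: vsum_def sum.remove)

lemma vsum_upd: "i \<in> {1..r} \<Longrightarrow> vsum r (l(i := l i + J)) = vsum r l + J"
  by (simp add: vsum_remove[of i])

lemma le_vsum: "i \<in> {1..r} \<Longrightarrow> l i \<le> vsum r l"
  by (simp add: vsum_remove)

context elliptic_base
begin

text \<open>
  The summand and the right-hand side after multiplication by
  \<open>\<Prod>\<^sub>m (a b x\<^sub>m q, a x\<^sub>m q\<^sup>2 / b; q\<^sup>2)\<^sub>N\<close>, which clears the denominators depending on \<open>b\<close>.
\<close>

definition cterm :: "nat \<Rightarrow> nat \<Rightarrow> complex \<Rightarrow> complex \<Rightarrow> (nat \<Rightarrow> complex) \<Rightarrow> (nat \<Rightarrow> complex) \<Rightarrow> (nat \<Rightarrow> nat) \<Rightarrow> complex" where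
  "cterm r N a b c x k =
     size_factor N b (vsum r k)
     * (\<Prod>m\<in>{1..r}. \<Prod>j\<in>{m<..r}. pair_factor N a (x m) (x j) (k m) (k j))
     * (\<Prod>m\<in>{1..r}. inner_factor N (a * x m) (a / c m) (k m) (vsum r k))
     * (\<Prod>m\<in>{1..r}. b_factor N (a * x m) b (k m))
     * (\<Prod>m\<in>{1..r}. \<Prod>j\<in>{1..r}. x_factor N a (c j) (x m) (x j) (k m))"

definition crhs :: "nat \<Rightarrow> nat \<Rightarrow> complex \<Rightarrow> complex \<Rightarrow> (nat \<Rightarrow> complex) \<Rightarrow> (nat \<Rightarrow> complex) \<Rightarrow> complex" where
  "crhs r N a b c x = (\<Prod>m\<in>{1..r}. rhs_factor N a b (a * x m) (c m))"

text \<open>The bound N makes this a consequence of nonvanishing denominators. It survives the shift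
  because the J powers of q^2 moved into x_i are compensated by the smaller bound N - J.\<close>

definition generic_x :: "nat \<Rightarrow> nat \<Rightarrow> (nat \<Rightarrow> complex) \<Rightarrow> bool" where
  "generic_x r N x \<longleftrightarrow> (\<forall>i\<in>{1..r}. x i \<noteq> 0)
     \<and> (\<forall>i\<in>{1..r}. \<forall>j\<in>{1..r}. \<forall>n\<le>N. i \<noteq> j \<or> n \<noteq> 0 \<longrightarrow> th (x i / x j * q ^ (2 * n)) \<noteq> 0)"

text \<open>Quantified over all n, hence stable under every shift, and for fixed nonzero x_i and c_i
  still violated by only countably many a. The last condition keeps the nodes apart from each
  other's reflections under b -> q / b.\<close>

definition generic_a :: "nat \<Rightarrow> complex \<Rightarrow> (nat \<Rightarrow> complex) \<Rightarrow> (nat \<Rightarrow> complex) \<Rightarrow> bool" where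
  "generic_a r a c x \<longleftrightarrow> a \<noteq> 0 \<and> (\<forall>i\<in>{1..r}. c i \<noteq> 0)
     \<and> (\<forall>i\<in>{1..r}. \<forall>n. th (a * x i * q ^ n) \<noteq> 0 \<and> th (a / c i * q ^ n) \<noteq> 0)
     \<and> (\<forall>i\<in>{1..r}. \<forall>j\<in>{1..r}. \<forall>n. th (a ^ 2 * x i * x j * q ^ n) \<noteq> 0)"

lemma generic_xD:
  "\<lbrakk>generic_x r N x; i \<in> {1..r}; j \<in> {1..r}; n \<le> N; i \<noteq> j \<or> n \<noteq> 0\<rbrakk> \<Longrightarrow> th (x i / x j * q ^ (2 * n)) \<noteq> 0"
  unfolding generic_x_def by blast

lemma generic_x_diff:
  assumes g: "generic_x r N x" and ij: "i \<in> {1..r}" "j \<in> {1..r}" "m \<le> N" "n \<le> N" "i \<noteq> j \<or> m \<noteq> n"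
  shows "th (x i * q ^ (2 * m) / (x j * q ^ (2 * n))) \<noteq> 0"
proof -
  have x: "x i \<noteq> 0" "x j \<noteq> 0" using g ij by (auto simp: generic_x_def)
  show ?thesis
  proof (cases "n \<le> m")
    case True
    then have "2 * m = 2 * (m - n) + 2 * n" by simp
    then have "q ^ (2 * m) = q ^ (2 * (m - n)) * q ^ (2 * n)" by (metis power_add)
    then have e: "x i * q ^ (2 * m) / (x j * q ^ (2 * n)) = x i / x j * q ^ (2 * (m - n))"
      using q by simp
    show ?thesis
      unfolding e by (rule generic_xD[OF g]) (use ij True in auto)
  next
    case False
    then have "2 * n = 2 * (n - m) + 2 * m" by simp
    then have "q ^ (2 * n) = q ^ (2 * (n - m)) * q ^ (2 * m)" by (metis power_add)
    then have "x i * q ^ (2 * m) / (x j * q ^ (2 * n)) = 1 / (x j / x i * q ^ (2 * (n - m)))"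
      using q x by simp
    moreover have "th (x j / x i * q ^ (2 * (n - m))) \<noteq> 0"
      by (rule generic_xD[OF g]) (use ij False in auto)
    ultimately show ?thesis
      using theta_inverse_eq_0[of "x j / x i * q ^ (2 * (n - m))"] q x by simp
  qed
qed

lemma generic_x_upd:
  assumes g: "generic_x r N x" and i: "i \<in> {1..r}" and J: "J \<le> N"
  shows "generic_x r (N - J) (x(i := x i * q ^ (2 * J)))"
  unfolding generic_x_def
proof (intro conjI ballI allI impI)
  fix m assume "m \<in> {1..r}"
  then show "(x(i := x i * q ^ (2 * J))) m \<noteq> 0"
    using g q i by (auto simp: generic_x_def)
next
  fix m j n assume m: "m \<in> {1..r}" and j: "j \<in> {1..r}" and n: "n \<le> N - J" "m \<noteq> j \<or> n \<noteq> 0"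
  let ?s = "\<lambda>m. if m = i then J else 0"
  have e: "(x(i := x i * q ^ (2 * J))) m = x m * q ^ (2 * ?s m)" for m
    by simp
  have "q ^ (2 * (?s m + n)) = q ^ (2 * ?s m) * q ^ (2 * n)"
    by (simp only: distrib_left power_add)
  then have e': "(x(i := x i * q ^ (2 * J))) m / (x(i := x i * q ^ (2 * J))) j * q ^ (2 * n)
      = x m * q ^ (2 * (?s m + n)) / (x j * q ^ (2 * ?s j))"
    unfolding e by simp
  have "?s m + n \<le> N" "?s j \<le> N" "m \<noteq> j \<or> ?s m + n \<noteq> ?s j"
    using n J by auto
  then show "th ((x(i := x i * q ^ (2 * J))) m / (x(i := x i * q ^ (2 * J))) j * q ^ (2 * n)) \<noteq> 0"
    unfolding e' by (rule generic_x_diff[OF g m j])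
qed

lemma generic_a_upd:
  assumes g: "generic_a r a c x"
  shows "generic_a r (a * q ^ J) c (x(i := x i * q ^ (2 * J)))"
  unfolding generic_a_def
proof (intro conjI ballI allI)
  let ?s = "\<lambda>m. if m = i then 2 * J else 0"
  have e: "(x(i := x i * q ^ (2 * J))) m = x m * q ^ ?s m" for m
    by simp
  show "a * q ^ J \<noteq> 0" using g q by (simp add: generic_a_def)
  fix m assume m: "m \<in> {1..r}"
  show "c m \<noteq> 0" using g m by (simp add: generic_a_def)
  fix n
  have "a * q ^ J * (x m * q ^ ?s m) * q ^ n = a * x m * q ^ (J + ?s m + n)"
    by (simp only: power_add mult_ac)
  then show "th (a * q ^ J * (x(i := x i * q ^ (2 * J))) m * q ^ n) \<noteq> 0"
    unfolding e using g m by (simp only: generic_a_def) blast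
  have "a * q ^ J / c m * q ^ n = a / c m * q ^ (J + n)"
    by (simp add: power_add)
  then show "th (a * q ^ J / c m * q ^ n) \<noteq> 0"
    using g m by (simp only: generic_a_def) blast
  fix j assume j: "j \<in> {1..r}"
  have "(a * q ^ J) ^ 2 * (x m * q ^ ?s m) * (x j * q ^ ?s j) * q ^ n
      = a ^ 2 * x m * x j * q ^ (2 * J + ?s m + ?s j + n)"
  proof -
    have "(a * q ^ J) ^ 2 = a ^ 2 * q ^ (2 * J)"
      by (simp only: power_mult_distrib power_even_eq)
    then show ?thesis
      by (simp only: power_add mult_ac)
  qed
  then show "th ((a * q ^ J) ^ 2 * (x(i := x i * q ^ (2 * J))) m * (x(i := x i * q ^ (2 * J))) j * q ^ n) \<noteq> 0"
    unfolding e using g m j by (simp only: generic_a_def) blast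
qed

lemma ef2_nonzeroI: "(\<And>n. n < k \<Longrightarrow> th (A * q ^ (2 * n)) \<noteq> 0) \<Longrightarrow> ef2 A k \<noteq> 0"
  by (simp add: ell_fact_def power_mult)

lemma generic_x_ef2:
  assumes g: "generic_x r N x" and ij: "i \<in> {1..r}" "j \<in> {1..r}" and k: "k \<le> N"
  shows "ef2 (q ^ 2 * x i / x j) k \<noteq> 0"
proof (rule ef2_nonzeroI)
  fix n assume n: "n < k"
  have e: "q ^ 2 * x i / x j * q ^ (2 * n) = x i * q ^ (2 * Suc n) / (x j * q ^ (2 * 0))"
    by (simp add: power2_eq_square mult_ac)
  show "th (q ^ 2 * x i / x j * q ^ (2 * n)) \<noteq> 0"
    unfolding e by (rule generic_x_diff[OF g ij]) (use n k in auto)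
qed

definition kappa :: "nat \<Rightarrow> nat \<Rightarrow> nat \<Rightarrow> nat \<Rightarrow> complex \<Rightarrow> complex \<Rightarrow> (nat \<Rightarrow> complex) \<Rightarrow> (nat \<Rightarrow> complex) \<Rightarrow> complex" where
  "kappa r N i J a b c x = kappa_self N J a b (c i) (x i)
     * (\<Prod>m\<in>{1..r} - {i}. kappa_other N J a b (c m) (x i) (x m))"

lemma crhs_shift:
  assumes gx: "generic_x r N x" and ga: "generic_a r a c x" and i: "i \<in> {1..r}" and J: "J \<le> N"
    and b: "b = q / (a * x i * q ^ (2 * J))"
  shows "kappa r N i J a b c x * crhs r (N - J) (a * q ^ J) (b * q ^ J) c (x(i := x i * q ^ (2 * J)))
    = crhs r N a b c x"
proof -
  have nz: "a \<noteq> 0" "\<And>m. m \<in> {1..r} \<Longrightarrow> c m \<noteq> 0" "\<And>m. m \<in> {1..r} \<Longrightarrow> x m \<noteq> 0"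
    using gx ga by (auto simp: generic_x_def generic_a_def)
  have e: "a * q ^ J * (x i * q ^ (2 * J)) = a * x i * q ^ (3 * J)"
  proof -
    have "3 * J = J + 2 * J" by simp
    then have "q ^ (3 * J) = q ^ J * q ^ (2 * J)" by (simp only: power_add)
    then show ?thesis by (simp only: mult_ac)
  qed
  have s: "kappa_self N J a b (c i) (x i) * rhs_factor (N - J) (a * q ^ J) (b * q ^ J) (a * q ^ J * (x i * q ^ (2 * J))) (c i)
    = rhs_factor N a b (a * x i) (c i)"
    unfolding e by (rule kappa_self_rhs) (use nz i J b ga in \<open>auto simp: generic_a_def\<close>)
  have o: "kappa_other N J a b (c m) (x i) (x m) * rhs_factor (N - J) (a * q ^ J) (b * q ^ J) (a * q ^ J * x m) (c m)
    = rhs_factor N a b (a * x m) (c m)" if m: "m \<in> {1..r} - {i}" for m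
  proof (rule kappa_other_rhs)
    show "th (a * x m) \<noteq> 0"
      using ga m by (auto simp: generic_a_def dest!: bspec[of _ _ m] spec[of _ 0])
    show "th (x i / x m) \<noteq> 0"
      using generic_x_diff[OF gx i, of m 0 0] m by simp
    show "ef2 (q ^ 2 * x i / x m) J \<noteq> 0"
      by (rule generic_x_ef2[OF gx]) (use i m J in auto)
    show "ef2 (a ^ 2 * x i * x m * q ^ (2 * N + 1)) J \<noteq> 0"
    proof (rule ef2_nonzeroI)
      fix n
      show "th (a ^ 2 * x i * x m * q ^ (2 * N + 1) * q ^ (2 * n)) \<noteq> 0"
        unfolding mult.assoc[of _ "q ^ (2 * N + 1)"] power_add[symmetric]
        using ga i m by (auto simp only: generic_a_def)
    qed
  qed (use nz i J b ga m in \<open>auto simp: generic_a_def\<close>)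
  have r: "(\<Prod>j\<in>{1..r}. g j) = g i * (\<Prod>j\<in>{1..r} - {i}. g j)" for g :: "nat \<Rightarrow> complex"
    using i by (simp add: prod.remove)
  let ?x = "x(i := x i * q ^ (2 * J))"
  have "kappa r N i J a b c x * crhs r (N - J) (a * q ^ J) (b * q ^ J) c ?x
    = (kappa_self N J a b (c i) (x i) * rhs_factor (N - J) (a * q ^ J) (b * q ^ J) (a * q ^ J * (x i * q ^ (2 * J))) (c i))
      * (\<Prod>m\<in>{1..r} - {i}. kappa_other N J a b (c m) (x i) (x m) * rhs_factor (N - J) (a * q ^ J) (b * q ^ J) (a * q ^ J * ?x m) (c m))"
    unfolding kappa_def crhs_def r by (simp add: prod.distrib mult_ac)
  also have "\<dots> = crhs r N a b c x"
    unfolding s crhs_def r by (rule arg_cong2[of _ _ _ _ "(*)"], rule refl, rule prod.cong) (use o in auto)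
  finally show ?thesis .
qed

text \<open>The factors are grouped by their relation to i. \<open>F\<close> holds the size factor
  and those of i alone, \<open>E m\<close> the inner and b factors of another index m and its
  couplings to i. \<open>P0\<close> and \<open>V0\<close> do not involve i and see a and N only
  through the invariant \<open>a ^ 2 * q ^ (2 * N + 1)\<close>.\<close>

lemma cterm_shift:
  assumes gx: "generic_x r N x" and ga: "generic_a r a c x" and i: "i \<in> {1..r}" and J: "vsum r l + J \<le> N"
    and b: "b = q / (a * x i * q ^ (2 * J))"
  shows "cterm r N a b c x (l(i := l i + J))
    = kappa r N i J a b c x * cterm r (N - J) (a * q ^ J) (b * q ^ J) c (x(i := x i * q ^ (2 * J))) l"
proof -
  let ?k = "l(i := l i + J)" and ?x = "x(i := x i * q ^ (2 * J))" and ?O = "{1..r} - {i}"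
  let ?a = "a * q ^ J" and ?b = "b * q ^ J" and ?N = "N - J"
  define L where "L = vsum r l"
  have K: "vsum r ?k = L + J" unfolding L_def by (rule vsum_upd[OF i])
  have JN: "J \<le> N" using J by simp
  have nz: "a \<noteq> 0" "\<And>m. m \<in> {1..r} \<Longrightarrow> c m \<noteq> 0" "\<And>m. m \<in> {1..r} \<Longrightarrow> x m \<noteq> 0"
    using gx ga by (auto simp: generic_x_def generic_a_def)
  have nz': "?x m \<noteq> 0" if "m \<in> {1..r}" for m using nz(3)[OF that] nz(3)[OF i] q by simp
  have gA: "th (a * x m * q ^ n) \<noteq> 0" if "m \<in> {1..r}" for m n
    using ga that by (auto simp: generic_a_def)
  have lL: "l m \<le> L" if "m \<in> {1..r}" for m
    unfolding L_def using that by (rule le_vsum)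
  have r: "(\<Prod>j\<in>{1..r}. g j) = g i * (\<Prod>j\<in>?O. g j)" for g :: "nat \<Rightarrow> complex"
    using i by (simp add: prod.remove)
  have e: "?a * (x i * q ^ (2 * J)) = a * x i * q ^ (3 * J)"
  proof -
    have "3 * J = J + 2 * J" by simp
    then have "q ^ (3 * J) = q ^ J * q ^ (2 * J)" by (simp only: power_add)
    then show ?thesis by (simp only: mult_ac)
  qed
  have pa: "pair_factor N a X Y m n = pair_factor ?N ?a X Y m n" for X Y m n
  proof -
    have "?a ^ 2 * X * Y * q ^ (2 * ?N + 1) = (?a ^ 2 * q ^ (2 * ?N + 1)) * X * Y"
      by (simp only: mult_ac)
    also have "\<dots> = a ^ 2 * X * Y * q ^ (2 * N + 1)"
      unfolding x_factor_arg[OF JN] by (simp only: mult_ac)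
    finally have e: "?a ^ 2 * X * Y * q ^ (2 * ?N + 1) = a ^ 2 * X * Y * q ^ (2 * N + 1)" .
    show ?thesis
      unfolding pair_factor_def e ..
  qed
  have xa: "x_factor N a d X Y n = x_factor ?N ?a d X Y n" for d X Y n
    unfolding x_factor_def x_factor_arg[OF JN] ..
  let ?PP = "{(m, j). m \<in> {1..r} - {i} \<and> j \<in> {m<..r} - {i}}"
  define P0 where "P0 = (\<Prod>z\<in>?PP. pair_factor N a (x (fst z)) (x (snd z)) (l (fst z)) (l (snd z)))"
  define V0 where "V0 = (\<Prod>m\<in>?O. \<Prod>j\<in>?O. x_factor N a (c j) (x m) (x j) (l m))"
  have P: "(\<Prod>m\<in>{1..r}. \<Prod>j\<in>{m<..r}. pair_factor N a (x m) (x j) (?k m) (?k j))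
      = P0 * (\<Prod>m\<in>?O. pair_factor N a (x i) (x m) (l i + J) (l m))"
    by (subst prod_pairs_remove[OF i]) (auto simp: P0_def nz intro!: pair_factor_commute arg_cong2[of _ _ _ _ "(*)"] prod.cong)
  have P': "(\<Prod>m\<in>{1..r}. \<Prod>j\<in>{m<..r}. pair_factor ?N ?a (?x m) (?x j) (l m) (l j))
      = P0 * (\<Prod>m\<in>?O. pair_factor ?N ?a (x i * q ^ (2 * J)) (x m) (l i) (l m))"
    unfolding P0_def pa
    by (subst prod_pairs_remove[OF i, where f = "\<lambda>m j. pair_factor ?N ?a (?x m) (?x j) (l m) (l j)"])
       (rule pair_factor_commute, use nz' in blast, use nz' in blast,
        auto intro!: arg_cong2[of _ _ _ _ "(*)"] prod.cong)
  have V: "(\<Prod>m\<in>{1..r}. \<Prod>j\<in>{1..r}. x_factor N a (c j) (x m) (x j) (?k m))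
      = x_factor N a (c i) (x i) (x i) (l i + J)
        * (\<Prod>m\<in>?O. x_factor N a (c m) (x i) (x m) (l i + J) * x_factor N a (c i) (x m) (x i) (l m)) * V0"
    by (subst prod_square_remove[OF i]) (auto simp: V0_def intro!: arg_cong2[of _ _ _ _ "(*)"] prod.cong)
  have V': "(\<Prod>m\<in>{1..r}. \<Prod>j\<in>{1..r}. x_factor ?N ?a (c j) (?x m) (?x j) (l m))
      = x_factor ?N ?a (c i) (x i * q ^ (2 * J)) (x i * q ^ (2 * J)) (l i)
        * (\<Prod>m\<in>?O. x_factor ?N ?a (c m) (x i * q ^ (2 * J)) (x m) (l i)
              * x_factor ?N ?a (c i) (x m) (x i * q ^ (2 * J)) (l m)) * V0"
    unfolding V0_def xa
    by (subst prod_square_remove[OF i]) (auto intro!: arg_cong2[of _ _ _ _ "(*)"] prod.cong)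
  have rk: "(\<Prod>m\<in>{1..r}. g m (?k m)) = g i (l i + J) * (\<Prod>m\<in>?O. g m (l m))" for g :: "nat \<Rightarrow> nat \<Rightarrow> complex"
    unfolding r by (auto intro!: prod.cong)
  have rx: "(\<Prod>m\<in>{1..r}. g m (?x m)) = g i (x i * q ^ (2 * J)) * (\<Prod>m\<in>?O. g m (x m))" for g :: "nat \<Rightarrow> complex \<Rightarrow> complex"
    unfolding r by (auto intro!: prod.cong)
  define E where "E m = pair_factor N a (x i) (x m) (l i + J) (l m)
      * inner_factor N (a * x m) (a / c m) (l m) (L + J) * b_factor N (a * x m) b (l m)
      * x_factor N a (c m) (x i) (x m) (l i + J) * x_factor N a (c i) (x m) (x i) (l m)" for m
  define E' where "E' m = pair_factor ?N ?a (x i * q ^ (2 * J)) (x m) (l i) (l m)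
      * inner_factor ?N (?a * x m) (?a / c m) (l m) L * b_factor ?N (?a * x m) ?b (l m)
      * x_factor ?N ?a (c m) (x i * q ^ (2 * J)) (x m) (l i)
      * x_factor ?N ?a (c i) (x m) (x i * q ^ (2 * J)) (l m)" for m
  define F where "F = size_factor N b (L + J) * inner_factor N (a * x i) (a / c i) (l i + J) (L + J)
      * b_factor N (a * x i) b (l i + J) * x_factor N a (c i) (x i) (x i) (l i + J)"
  define F' where "F' = size_factor ?N ?b L * inner_factor ?N (a * x i * q ^ (3 * J)) (?a / c i) (l i) L
      * b_factor ?N (a * x i * q ^ (3 * J)) ?b (l i)
      * x_factor ?N ?a (c i) (x i * q ^ (2 * J)) (x i * q ^ (2 * J)) (l i)"
  have T: "cterm r N a b c x ?k = F * (\<Prod>m\<in>?O. E m) * (P0 * V0)"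
    unfolding cterm_def K P V rk[of "\<lambda>m n. inner_factor N (a * x m) (a / c m) n (L + J)"]
      rk[of "\<lambda>m n. b_factor N (a * x m) b n"] F_def E_def prod.distrib
    by (simp only: mult_ac)
  have T': "cterm r ?N ?a ?b c ?x l = F' * (\<Prod>m\<in>?O. E' m) * (P0 * V0)"
    unfolding cterm_def L_def[symmetric] P' V'
      rx[of "\<lambda>m y. inner_factor ?N (?a * y) (?a / c m) (l m) L"]
      rx[of "\<lambda>m y. b_factor ?N (?a * y) ?b (l m)"] F'_def E'_def prod.distrib e
    by (simp only: mult_ac)
  have F: "F = kappa_self N J a b (c i) (x i) * q ^ (J * (L - l i)) * F'"
    unfolding F_def F'_def
    by (rule self_total_shift) (use nz i J b gA lL in \<open>auto simp: L_def\<close>)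
  have Em: "E m * q ^ (J * l m) = kappa_other N J a b (c m) (x i) (x m) * E' m" if m: "m \<in> ?O" for m
    unfolding E_def E'_def
  proof (rule other_shift)
    have lm: "l m \<le> N" "l m \<le> ?N" using lL[of m] m J by (auto simp: L_def)
    show "th (x i * q ^ (2 * J) / x m) \<noteq> 0"
      using generic_x_diff[OF gx i, of m J 0] m JN by simp
    show "ef2 (q ^ 2 * x m / x i) (l m) \<noteq> 0"
      by (rule generic_x_ef2[OF gx]) (use i m lm in auto)
    show "ef2 (q ^ 2 * x m / (x i * q ^ (2 * J))) (l m) \<noteq> 0"
      using generic_x_ef2[OF generic_x_upd[OF gx i JN], of m i "l m"] i m lm by simp
  qed (use nz i J b m gA lL in \<open>auto simp: L_def\<close>)
  \<comment> \<open>The powers of q required by \<open>other_shift\<close> at the other indices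
    recombine to the one delivered by \<open>self_total_shift\<close>.\<close>
  have "L - l i = (\<Sum>m\<in>?O. l m)"
    unfolding L_def vsum_remove[OF i] by simp
  then have "(\<Prod>m\<in>?O. q ^ (J * l m)) = q ^ (J * (L - l i))"
    by (simp add: power_sum[symmetric] sum_distrib_left)
  then have "(\<Prod>m\<in>?O. E m) * q ^ (J * (L - l i)) = (\<Prod>m\<in>?O. kappa_other N J a b (c m) (x i) (x m)) * (\<Prod>m\<in>?O. E' m)"
    using prod.cong[OF refl Em, of ?O "\<lambda>x. x"] by (simp add: prod.distrib)
  then have "F' * kappa_self N J a b (c i) (x i) * ((\<Prod>m\<in>?O. E m) * q ^ (J * (L - l i)))
    = F' * kappa_self N J a b (c i) (x i) * ((\<Prod>m\<in>?O. kappa_other N J a b (c m) (x i) (x m)) * (\<Prod>m\<in>?O. E' m))"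
    by simp
  then show ?thesis
    unfolding T T' F kappa_def by (simp only: mult_ac)
qed

section \<open>Interpolation in b\<close>

definition csum :: "nat \<Rightarrow> nat \<Rightarrow> complex \<Rightarrow> complex \<Rightarrow> (nat \<Rightarrow> complex) \<Rightarrow> (nat \<Rightarrow> complex) \<Rightarrow> complex" where
  "csum r N a b c x = (\<Sum>k\<in>multi_indices r N. cterm r N a b c x k)"

lemma theta_pairs_form:
  assumes "\<And>j. j < n \<Longrightarrow> A j \<noteq> 0"
  shows "binary_form (- {0}) uform vform n (\<lambda>b. \<Prod>j<n. th (A j * b) * th (A j * q / b))"
  using binary_form_prod[of "{..<n}" "- {0}" uform vform "\<lambda>_. 1" "\<lambda>j b. th (A j * b) * th (A j * q / b)"]
    binary_form_theta_pair assms by simp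

lemma size_factor_form: "binary_form (- {0}) uform vform K (\<lambda>b. size_factor N b K)"
proof -
  have "size_factor N b K = (q ^ K * ef2 (1 / q ^ (2 * N)) K) * (\<Prod>j<K. th (q ^ j * b) * th (q ^ j * q / b))" for b
    by (simp add: size_factor_def ell_fact_def prod.distrib mult_ac)
  then show ?thesis
    using binary_form_cmult[OF theta_pairs_form[of K "\<lambda>j. q ^ j"]] q by simp
qed

lemma b_factor_form:
  assumes "A \<noteq> 0"
  shows "binary_form (- {0}) uform vform (N - k) (\<lambda>b. b_factor N A b k)"
proof -
  have "b_factor N A b k = (\<Prod>j<N - k. th (A * q ^ (1 + 2 * k) * (q ^ 2) ^ j * b) * th (A * q ^ (1 + 2 * k) * (q ^ 2) ^ j * q / b))" for b
    by (simp add: b_factor_def ell_fact_def prod.distrib mult_ac)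
  then show ?thesis
    using theta_pairs_form[of "N - k" "\<lambda>j. A * q ^ (1 + 2 * k) * (q ^ 2) ^ j"] q assms by simp
qed

lemma rhs_factor_form:
  assumes "a \<noteq> 0" "c \<noteq> 0"
  shows "binary_form (- {0}) uform vform N (\<lambda>b. rhs_factor N a b A c)"
proof -
  have eq: "rhs_factor N a b A c = ef (A * q) (2 * N) / ef (a / c * q) (2 * N)
      * (\<Prod>j<N. th (a / c * q * (q ^ 2) ^ j * b) * th (a / c * q * (q ^ 2) ^ j * q / b))" for b
  proof -
    have e: "a * b * q / c * (q ^ 2) ^ j = a / c * q * (q ^ 2) ^ j * b"
      "a * q ^ 2 / (b * c) * (q ^ 2) ^ j = a / c * q * (q ^ 2) ^ j * q / b" for j
      by (simp_all add: power2_eq_square mult_ac)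
    show ?thesis
      unfolding rhs_factor_def ell_fact_def[of _ "q ^ 2"] e prod.distrib by (simp only: mult_ac)
  qed
  show ?thesis
    unfolding eq by (rule binary_form_cmult[OF theta_pairs_form]) (use q assms in auto)
qed

lemma crhs_form:
  assumes "a \<noteq> 0" "\<And>i. i \<in> {1..r} \<Longrightarrow> c i \<noteq> 0"
  shows "binary_form (- {0}) uform vform (r * N) (\<lambda>b. crhs r N a b c x)"
  using binary_form_prod[of "{1..r}" "- {0}" uform vform "\<lambda>_. N" "\<lambda>m b. rhs_factor N a b (a * x m) (c m)"]
    rhs_factor_form assms by (simp add: crhs_def)

lemma cterm_form:
  assumes nz: "a \<noteq> 0" "\<And>i. i \<in> {1..r} \<Longrightarrow> x i \<noteq> 0" and k: "k \<in> multi_indices r N"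
  shows "binary_form (- {0}) uform vform (r * N) (\<lambda>b. cterm r N a b c x k)"
proof -
  have kK: "vsum r k \<le> N" using k by (simp add: multi_indices_def)
  have km: "k m \<le> N" if "m \<in> {1..r}" for m using le_vsum[OF that, of k] kK by simp
  have "binary_form (- {0}) uform vform (\<Sum>m\<in>{1..r}. N - k m) (\<lambda>b. \<Prod>m\<in>{1..r}. b_factor N (a * x m) b (k m))"
    by (rule binary_form_prod) (use b_factor_form nz in auto)
  from binary_form_mult[OF size_factor_form this]
  have "binary_form (- {0}) uform vform (vsum r k + (\<Sum>m\<in>{1..r}. N - k m))
      (\<lambda>b. size_factor N b (vsum r k) * (\<Prod>m\<in>{1..r}. b_factor N (a * x m) b (k m)))" .
  \<comment> \<open>All terms have the same degree: an index contributes k_m through the size factor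
    and N - k_m through its b factor.\<close>
  moreover have "vsum r k + (\<Sum>m\<in>{1..r}. N - k m) = r * N"
  proof -
    have "vsum r k + (\<Sum>m\<in>{1..r}. N - k m) = (\<Sum>m\<in>{1..r}. k m + (N - k m))"
      by (simp add: vsum_def sum.distrib)
    also have "\<dots> = (\<Sum>m\<in>{1..r}. N)"
      by (rule sum.cong) (use km in auto)
    finally show ?thesis by simp
  qed
  ultimately have "binary_form (- {0}) uform vform (r * N)
      (\<lambda>b. size_factor N b (vsum r k) * (\<Prod>m\<in>{1..r}. b_factor N (a * x m) b (k m)))"
    by simp
  from binary_form_cmult[OF this, of "(\<Prod>m\<in>{1..r}. \<Prod>j\<in>{m<..r}. pair_factor N a (x m) (x j) (k m) (k j))
     * (\<Prod>m\<in>{1..r}. inner_factor N (a * x m) (a / c m) (k m) (vsum r k))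
     * (\<Prod>m\<in>{1..r}. \<Prod>j\<in>{1..r}. x_factor N a (c j) (x m) (x j) (k m))"]
  show ?thesis
    by (rule binary_form_cong) (simp only: cterm_def mult_ac)
qed

text \<open>The factor with index \<open>J - Suc k\<close> of the first factorial is
  \<open>th 1\<close>, and \<open>J \<le> N\<close> places this index within the length N -
  k.\<close>

lemma b_factor_eq_0:
  assumes A: "A \<noteq> 0" and k: "k < J" "J \<le> N" and b: "b = q / (A * q ^ (2 * J))"
  shows "b_factor N A b k = 0"
proof -
  let ?t = "J - Suc k"
  have "2 * J = 2 + 2 * k + 2 * ?t" using k by simp
  then have "q ^ (2 * J) = q ^ 2 * q ^ (2 * k) * q ^ (2 * ?t)"
    by (metis power_add)
  then have "A * b * q ^ (1 + 2 * k) * (q ^ 2) ^ ?t = 1"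
    using A q unfolding b power_mult[symmetric] by (simp add: power_add power2_eq_square)
  moreover have "?t < N - k" using k by simp
  ultimately have "ef2 (A * b * q ^ (1 + 2 * k)) (N - k) = 0"
    using p unfolding ell_fact_def by (intro prod_zero) (auto intro!: bexI[of _ ?t])
  then show ?thesis by (simp add: b_factor_def)
qed

lemma csum_at_point:
  assumes gx: "generic_x r N x" and ga: "generic_a r a c x" and i: "i \<in> {1..r}" and J: "J \<le> N"
    and b: "b = q / (a * x i * q ^ (2 * J))"
  shows "csum r N a b c x
    = kappa r N i J a b c x * csum r (N - J) (a * q ^ J) (b * q ^ J) c (x(i := x i * q ^ (2 * J)))"
proof -
  have nz: "a * x i \<noteq> 0" using gx ga i by (auto simp: generic_x_def generic_a_def)
  have z: "cterm r N a b c x k = 0" if "k i < J" for k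
  proof -
    have "b_factor N (a * x i) b (k i) = 0"
      by (rule b_factor_eq_0[OF nz that J b])
    then have "(\<Prod>m\<in>{1..r}. b_factor N (a * x m) b (k m)) = 0"
      using i by (intro prod_zero) auto
    then show ?thesis by (simp only: cterm_def mult_zero_right mult_zero_left)
  qed
  have "csum r N a b c x = (\<Sum>k\<in>{k \<in> multi_indices r N. J \<le> k i}. cterm r N a b c x k)"
    unfolding csum_def by (rule sum.mono_neutral_right) (auto simp: finite_multi_indices intro: z leI)
  also have "\<dots> = (\<Sum>l\<in>multi_indices r (N - J). cterm r N a b c x (l(i := l i + J)))"
  proof (rule sum.reindex_bij_witness[of _ "\<lambda>l. l(i := l i + J)" "\<lambda>k. k(i := k i - J)"])
    fix k assume k: "k \<in> {k \<in> multi_indices r N. J \<le> k i}"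
    show e: "(k(i := k i - J))(i := (k(i := k i - J)) i + J) = k"
      using k by auto
    have "vsum r k = vsum r (k(i := k i - J)) + J"
      using vsum_upd[OF i, of "k(i := k i - J)" J] unfolding e .
    then show "k(i := k i - J) \<in> multi_indices r (N - J)"
      using k i by (auto simp: multi_indices_def PiE_iff extensional_def)
    show "cterm r N a b c x ((k(i := k i - J))(i := (k(i := k i - J)) i + J)) = cterm r N a b c x k"
      unfolding e ..
  next
    fix l assume l: "l \<in> multi_indices r (N - J)"
    show "(l(i := l i + J))(i := (l(i := l i + J)) i - J) = l"
      by auto
    show "l(i := l i + J) \<in> {k \<in> multi_indices r N. J \<le> k i}"
      using l i J vsum_upd[OF i, of l J] by (auto simp: multi_indices_def PiE_iff extensional_def)
  qed
  also have "\<dots> = (\<Sum>l\<in>multi_indices r (N - J). kappa r N i J a b c x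
      * cterm r (N - J) (a * q ^ J) (b * q ^ J) c (x(i := x i * q ^ (2 * J))) l)"
    by (rule sum.cong[OF refl], rule cterm_shift[OF gx ga i _ b]) (use J in \<open>auto simp: multi_indices_def\<close>)
  finally show ?thesis
    by (simp add: csum_def sum_distrib_left)
qed

text \<open>For b = 1: there the two factorials of base q^2 merge into one of base q and length 2 N,
  both in the surviving term and on the right-hand side.\<close>

lemma ef_double: "ef B (2 * n) = ef2 B n * ef2 (B * q) n"
proof (induction n)
  case (Suc n)
  have e: "q ^ (2 * n) = (q ^ 2) ^ n" "q ^ (2 * n + 1) = (q ^ 2) ^ n * q"
    by (simp_all only: power_add power_mult power_one_right)
  have "ef B (2 * Suc n) = ef B (2 * n) * th (B * q ^ (2 * n)) * th (B * q ^ (2 * n + 1))"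
    by (simp add: ell_fact_def mult_ac)
  also have "\<dots> = ef2 B (Suc n) * ef2 (B * q) (Suc n)"
    unfolding Suc.IH e by (simp add: ell_fact_def mult_ac)
  finally show ?case .
qed simp

lemma csum_at_one:
  assumes gx: "generic_x r N x" and ga: "generic_a r a c x"
  shows "csum r N a 1 c x = crhs r N a 1 c x"
proof -
  let ?o = "\<lambda>m\<in>{1..r}. 0 :: nat"
  have o: "?o \<in> multi_indices r N" by (simp add: multi_indices_def vsum_def)
  have z: "cterm r N a 1 c x k = 0" if k: "k \<in> multi_indices r N" "k \<noteq> ?o" for k
  proof -
    have "\<exists>m\<in>{1..r}. k m \<noteq> 0"
    proof (rule ccontr)
      assume "\<not> ?thesis"
      then have "k m = ?o m" for m
        using k by (auto simp: multi_indices_def PiE_iff extensional_def)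
      then show False using k by auto
    qed
    then have "vsum r k > 0"
      unfolding vsum_def by (auto intro: sum_pos2)
    then have "ef 1 (vsum r k) = 0"
      using p unfolding ell_fact_def by (intro prod_zero) (auto intro!: bexI[of _ 0])
    then show ?thesis
      by (simp add: cterm_def size_factor_def)
  qed
  have nz: "x m \<noteq> 0" "th (a * x m) \<noteq> 0" "\<And>n. th (a / c m * q ^ n) \<noteq> 0" if "m \<in> {1..r}" for m
    using gx ga that by (auto simp: generic_x_def generic_a_def dest!: bspec[of _ _ m] spec[of _ 0])
  have "csum r N a 1 c x = (\<Sum>k\<in>{?o}. cterm r N a 1 c x k)"
    unfolding csum_def by (rule sum.mono_neutral_right) (use o z in \<open>auto simp: finite_multi_indices\<close>)
  also have "\<dots> = cterm r N a 1 c x ?o"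
    by simp
  also have "\<dots> = (\<Prod>m\<in>{1..r}. rhs_factor N a 1 (a * x m) (c m))"
  proof -
    have v: "vsum r ?o = 0" by (simp add: vsum_def)
    have "(\<Prod>m\<in>{1..r}. \<Prod>j\<in>{m<..r}. pair_factor N a (x m) (x j) (?o m) (?o j)) = 1"
    proof (intro prod.neutral ballI)
      fix m j assume "m \<in> {1..r}" "j \<in> {m<..r}"
      then show "pair_factor N a (x m) (x j) (?o m) (?o j) = 1"
        using generic_x_diff[OF gx, of m j 0 0] nz[of j] by (simp add: pair_factor_def)
    qed
    moreover have "(\<Prod>m\<in>{1..r}. inner_factor N (a * x m) (a / c m) (?o m) 0) = 1"
      by (intro prod.neutral ballI) (use nz in \<open>simp add: inner_factor_def\<close>)
    moreover have "(\<Prod>m\<in>{1..r}. \<Prod>j\<in>{1..r}. x_factor N a (c j) (x m) (x j) (?o m)) = 1"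
      by (intro prod.neutral ballI) (simp add: x_factor_def)
    moreover have "b_factor N (a * x m) 1 (?o m) = rhs_factor N a 1 (a * x m) (c m)" if m: "m \<in> {1..r}" for m
    proof -
      have e: "a * 1 * q / c m = a / c m * q" "a * q ^ 2 / (1 * c m) = a / c m * q * q"
        "a * x m * 1 * q ^ (1 + 2 * 0) = a * x m * q" "a * x m * q ^ (2 + 2 * 0) / 1 = a * x m * q * q"
        by (simp_all add: power2_eq_square)
      have "ef (a / c m * q) (2 * N) \<noteq> 0"
        using nz(3)[OF m] by (simp add: ell_fact_def mult.assoc power_Suc[symmetric] del: power_Suc)
      moreover have o0: "?o m = 0" using m by simp
      ultimately show ?thesis
        unfolding o0 rhs_factor_def b_factor_def e diff_zero ef_double by simp
    qed
    ultimately show ?thesis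
      unfolding cterm_def v by (simp add: size_factor_def)
  qed
  finally show ?thesis by (simp add: crhs_def)
qed

section \<open>Nodes and interpolation\<close>

definition node :: "complex \<Rightarrow> (nat \<Rightarrow> complex) \<Rightarrow> nat \<times> nat \<Rightarrow> complex" where
  "node a x z = q / (a * x (fst z) * q ^ (2 * snd z))"

lemma node_generic:
  assumes gx: "generic_x r N x" and ga: "generic_a r a c x" and z: "z \<in> {1..r} \<times> {1..N}"
  shows "node a x z \<noteq> 0" and "th (node a x z) \<noteq> 0" and "th (1 / node a x z) \<noteq> 0" and "th (q / node a x z) \<noteq> 0"
proof -
  obtain i J where iJ: "z = (i, J)" "i \<in> {1..r}" "1 \<le> J" using z by auto
  have nz: "a \<noteq> 0" "x i \<noteq> 0" using gx ga iJ by (auto simp: generic_x_def generic_a_def)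
  show n0: "node a x z \<noteq> 0" using nz q iJ by (simp add: node_def)
  have "q ^ (2 * J) = q * q ^ (2 * J - 1)" using iJ by (simp add: power_Suc[symmetric] del: power_Suc)
  then have "1 / node a x z = a * x i * q ^ (2 * J - 1)"
    using q iJ by (simp add: node_def)
  then show th: "th (1 / node a x z) \<noteq> 0"
    using ga iJ by (simp add: generic_a_def)
  show "th (node a x z) \<noteq> 0"
    using th theta_inverse_eq_0[OF n0] by simp
  have "q / node a x z = a * x i * q ^ (2 * J)"
    using q iJ by (simp add: node_def)
  then show "th (q / node a x z) \<noteq> 0"
    using ga iJ by (simp add: generic_a_def)
qed

text \<open>The first condition separates distinct nodes, the second separates a node from the
  reflection b -> q / b of another one. The latter leads to \<open>a ^ 2 * x i * x i'\<close> times
  an odd power of q, whose theta value \<open>generic_a\<close> controls.\<close>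

lemma node_pair_generic:
  assumes gx: "generic_x r N x" and ga: "generic_a r a c x"
    and z: "z \<in> {1..r} \<times> {1..N}" "w \<in> {1..r} \<times> {1..N}" "z \<noteq> w"
  shows "th (node a x w / node a x z) \<noteq> 0" and "th (q / (node a x z * node a x w)) \<noteq> 0"
proof -
  obtain i J where iJ: "z = (i, J)" "i \<in> {1..r}" "1 \<le> J" "J \<le> N" using z by auto
  obtain i' J' where iJ': "w = (i', J')" "i' \<in> {1..r}" "1 \<le> J'" "J' \<le> N" using z by auto
  have nz: "a \<noteq> 0" "x i \<noteq> 0" "x i' \<noteq> 0" using gx ga iJ iJ' by (auto simp: generic_x_def generic_a_def)
  have e: "node a x w / node a x z = x i * q ^ (2 * J) / (x i' * q ^ (2 * J'))"
    using nz q iJ iJ' by (simp add: node_def)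
  show "th (node a x w / node a x z) \<noteq> 0"
    unfolding e by (rule generic_x_diff[OF gx]) (use iJ iJ' z in auto)
  have "2 * J + 2 * J' = 1 + (2 * J + 2 * J' - 1)" using iJ by simp
  then have "q ^ (2 * J) * q ^ (2 * J') = q * q ^ (2 * J + 2 * J' - 1)"
    by (metis power_add power_one_right)
  then have "a ^ 2 * x i * x i' * (q ^ (2 * J) * q ^ (2 * J')) / q = a ^ 2 * x i * x i' * q ^ (2 * J + 2 * J' - 1)"
    using q by simp
  moreover have "q / (node a x z * node a x w) = a ^ 2 * x i * x i' * (q ^ (2 * J) * q ^ (2 * J')) / q"
    using nz q iJ iJ' by (simp add: node_def power2_eq_square)
  ultimately have e2: "q / (node a x z * node a x w) = a ^ 2 * x i * x i' * q ^ (2 * J + 2 * J' - 1)"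
    by simp
  show "th (q / (node a x z * node a x w)) \<noteq> 0"
    unfolding e2 using ga iJ iJ' by (simp add: generic_a_def)
qed

text \<open>
  In \<open>b\<close>, both sides are binary forms of degree \<open>r N\<close>. They agree at \<open>b = 1\<close>, where only
  \<open>\<^bold>k = 0\<close> contributes, and at the \<open>r N\<close> nodes, where the identity reduces to a smaller \<open>N\<close>.
\<close>

theorem csum_eq_crhs_generic:
  assumes "generic_x r N x" "generic_a r a c x" "b \<noteq> 0"
  shows "csum r N a b c x = crhs r N a b c x"
  using assms
proof (induction N arbitrary: a b x rule: less_induct)
  case (less N)
  note gx = less.prems(1) and ga = less.prems(2)
  have nz: "a \<noteq> 0" "\<And>m. m \<in> {1..r} \<Longrightarrow> c m \<noteq> 0" "\<And>m. m \<in> {1..r} \<Longrightarrow> x m \<noteq> 0"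
    using gx ga by (auto simp: generic_x_def generic_a_def)
  define f where "f b = csum r N a b c x + (-1) * crhs r N a b c x" for b
  let ?Z = "{1..r} \<times> {1..N}"
  define T where "T = insert 1 (node a x ` ?Z)"
  have form: "binary_form (- {0}) uform vform (r * N) f"
    unfolding f_def csum_def
    by (intro binary_form_add binary_form_sum binary_form_cmult cterm_form crhs_form) (use nz in auto)
  have inj: "inj_on (node a x) ?Z"
  proof (rule inj_onI, rule ccontr)
    fix z w assume zw: "z \<in> ?Z" "w \<in> ?Z" "node a x z = node a x w" "z \<noteq> w"
    then show False
      using node_pair_generic(1)[OF gx ga zw(1,2,4)] node_generic(1)[OF gx ga zw(2)] p by simp
  qed
  have not1: "node a x z \<noteq> 1" if "z \<in> ?Z" for z
    using node_generic(2)[OF gx ga that] p by auto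
  have "f b = 0"
  proof (rule binary_form_eq_0[OF form])
    show "finite T" by (simp add: T_def)
    have "card T = Suc (card (node a x ` ?Z))"
      unfolding T_def by (rule card_insert_disjoint) (use not1 in auto)
    then show "card T = Suc (r * N)"
      unfolding card_image[OF inj] by (simp add: card_cartesian_product)
    show "T \<subseteq> - {0}"
      using node_generic(1)[OF gx ga] by (auto simp: T_def)
    show "f t = 0" if "t \<in> T" for t
    proof (cases "t = 1")
      case True
      then show ?thesis by (simp add: f_def csum_at_one[OF gx ga])
    next
      case False
      then obtain i J where iJ: "i \<in> {1..r}" "1 \<le> J" "J \<le> N" and t: "t = q / (a * x i * q ^ (2 * J))"
      proof -
        obtain z where z: "z \<in> ?Z" "t = node a x z"
          using False \<open>t \<in> T\<close> by (auto simp: T_def)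
        then show thesis
          by (intro that[of "fst z" "snd z"]) (auto simp: node_def)
      qed
      have t0: "t * q ^ J \<noteq> 0" using t nz iJ q by simp
      have "csum r (N - J) (a * q ^ J) (t * q ^ J) c (x(i := x i * q ^ (2 * J)))
          = crhs r (N - J) (a * q ^ J) (t * q ^ J) c (x(i := x i * q ^ (2 * J)))"
        by (rule less.IH[OF _ generic_x_upd[OF gx iJ(1,3)] generic_a_upd[OF ga] t0]) (use iJ in simp)
      then show ?thesis
        unfolding f_def csum_at_point[OF gx ga iJ(1,3) t] using crhs_shift[OF gx ga iJ(1,3) t] by simp
    qed
    show "uform s * vform t \<noteq> uform t * vform s" if st: "s \<in> T" "t \<in> T" "s \<noteq> t" for s t
    proof (rule form_indep)
      show "s \<noteq> 0" "t \<noteq> 0"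
        using st node_generic(1)[OF gx ga] by (auto simp: T_def)
      consider (1) z where "s = 1" "z \<in> ?Z" "t = node a x z"
        | (2) z where "t = 1" "z \<in> ?Z" "s = node a x z"
        | (3) z w where "z \<in> ?Z" "w \<in> ?Z" "s = node a x z" "t = node a x w"
        using st unfolding T_def by blast
      then have "th (t / s) \<noteq> 0 \<and> th (q / (s * t)) \<noteq> 0"
      proof cases
        case 1
        then show ?thesis using node_generic(2,4)[OF gx ga 1(2)] by simp
      next
        case 2
        then show ?thesis using node_generic(3,4)[OF gx ga 2(2)] by simp
      next
        case 3
        then have "z \<noteq> w" using st by auto
        with 3 show ?thesis using node_pair_generic[OF gx ga 3(1,2)] by simp
      qed
      then show "th (t / s) \<noteq> 0" "th (q / (s * t)) \<noteq> 0"
        by auto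
    qed
  qed (use less.prems in simp)
  then show ?case by (simp add: f_def)
qed

end

section \<open>Nongeneric a\<close>

text \<open>Balls in the plane are uncountable, so points outside S accumulate at a and give a
  sequence along which f and g agree.\<close>

lemma isCont_eq_off_countable:
  fixes f g :: "complex \<Rightarrow> complex"
  assumes f: "isCont f a" and g: "isCont g a" and S: "countable S" and eq: "\<And>z. z \<notin> S \<Longrightarrow> f z = g z"
  shows "f a = g a"
proof -
  have "\<exists>z\<in>ball a (1 / real (Suc n)). z \<notin> S" for n
  proof (rule ccontr)
    assume "\<not> ?thesis"
    then have "ball a (1 / real (Suc n)) \<subseteq> S" by blast
    then have "countable (ball a (1 / real (Suc n)))"
      using S countable_subset by blast
    then show False
      using uncountable_ball[of "1 / real (Suc n)" a] by simp
  qed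
  then obtain s where s: "\<And>n. s n \<in> ball a (1 / real (Suc n))" "\<And>n. s n \<notin> S"
    by metis
  have "s \<longlonglongrightarrow> a"
    unfolding lim_sequentially
  proof (intro allI impI)
    fix e :: real assume "e > 0"
    then obtain n0 where n0: "1 / real (Suc n0) < e"
      using nat_approx_posE by blast
    have "dist (s n) a < e" if "n \<ge> n0" for n
    proof -
      have "dist (s n) a < 1 / real (Suc n)"
        using s(1)[of n] by (simp add: dist_commute)
      also have "\<dots> \<le> 1 / real (Suc n0)"
        using that by (simp add: frac_le)
      finally show ?thesis using n0 by simp
    qed
    then show "\<exists>no. \<forall>n\<ge>no. dist (s n) a < e" by blast
  qed
  then have "(\<lambda>n. f (s n)) \<longlonglongrightarrow> f a" "(\<lambda>n. g (s n)) \<longlonglongrightarrow> g a"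
    using isCont_tendsto_compose[OF f] isCont_tendsto_compose[OF g] by auto
  moreover have "(\<lambda>n. f (s n)) = (\<lambda>n. g (s n))"
    using eq s(2) by auto
  ultimately show ?thesis
    using LIMSEQ_unique by metis
qed

context elliptic_base
begin

lemma countable_theta_zeros_scaled: "s \<noteq> 0 \<Longrightarrow> countable {a. a \<noteq> 0 \<and> th (a * s) = 0}"
  by (rule countable_subset[of _ "(\<lambda>z. z / s) ` {z. z \<noteq> 0 \<and> th z = 0}"])
     (auto simp: image_iff intro!: exI[of _ "_ * s"] countable_image countable_theta_zeros)

lemma countable_theta_zeros_square:
  assumes "s \<noteq> 0"
  shows "countable {a. a \<noteq> 0 \<and> th (a ^ 2 * s) = 0}"
proof (rule countable_subset)
  let ?Z = "{z. z \<noteq> 0 \<and> th (z * s) = 0}"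
  show "{a. a \<noteq> 0 \<and> th (a ^ 2 * s) = 0} \<subseteq> csqrt ` ?Z \<union> (\<lambda>z. - csqrt z) ` ?Z"
  proof
    fix a assume a: "a \<in> {a. a \<noteq> 0 \<and> th (a ^ 2 * s) = 0}"
    have eq: "a = csqrt (a ^ 2) \<or> a = - csqrt (a ^ 2)"
      using power2_csqrt[of "a ^ 2"] by (metis power2_eq_iff)
    have mem: "a \<in> S" if "a = y" "y \<in> S" for y S
      using that by simp
    have "a ^ 2 \<in> ?Z"
      using a by simp
    then have "csqrt (a ^ 2) \<in> csqrt ` ?Z" "- csqrt (a ^ 2) \<in> (\<lambda>z. - csqrt z) ` ?Z"
      by (rule imageI)+
    then show "a \<in> csqrt ` ?Z \<union> (\<lambda>z. - csqrt z) ` ?Z"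
      using eq by (elim disjE) (auto intro: mem)
  qed
  show "countable (csqrt ` ?Z \<union> (\<lambda>z. - csqrt z) ` ?Z)"
    using countable_theta_zeros_scaled[OF assms] by auto
qed

lemma countable_nongeneric_a:
  assumes nz: "\<And>i. i \<in> {1..r} \<Longrightarrow> x i \<noteq> 0" "\<And>i. i \<in> {1..r} \<Longrightarrow> c i \<noteq> 0"
  shows "countable {a. \<not> generic_a r a c x}"
proof (rule countable_subset)
  let ?S = "insert 0 ((\<Union>i\<in>{1..r}. \<Union>n. {a. a \<noteq> 0 \<and> th (a * (x i * q ^ n)) = 0})
     \<union> (\<Union>i\<in>{1..r}. \<Union>n. {a. a \<noteq> 0 \<and> th (a * (q ^ n / c i)) = 0})
     \<union> (\<Union>i\<in>{1..r}. \<Union>j\<in>{1..r}. \<Union>n. {a. a \<noteq> 0 \<and> th (a ^ 2 * (x i * x j * q ^ n)) = 0}))"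
  show "{a. \<not> generic_a r a c x} \<subseteq> ?S"
    using nz by (auto simp: generic_a_def mult.assoc)
  show "countable ?S"
    by (intro countable_insert countable_Un countable_UN countable_theta_zeros_scaled countable_theta_zeros_square)
       (use nz q in auto)
qed

section \<open>Continuity of both sides in a\<close>

lemma isCont_ell_fact:
  assumes "isCont f a" "f a \<noteq> 0" "Q \<noteq> 0"
  shows "isCont (\<lambda>a. ell_fact (f a) Q p n) a"
  unfolding ell_fact_def
proof (intro continuous_intros)
  fix j
  show "isCont (\<lambda>a. theta (f a * Q ^ j) p) a"
    by (rule isCont_o2[where g = "\<lambda>z. theta z p"]) (use assms in \<open>auto intro!: continuous_intros isCont_theta p\<close>)
qed

lemma isCont_theta_comp:
  assumes "isCont f a" "f a \<noteq> 0"
  shows "isCont (\<lambda>a. theta (f a) p) a"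
  using isCont_ell_fact[OF assms, of 1 1] by simp

lemma isCont_pair_factor:
  assumes "a \<noteq> 0" "X \<noteq> 0" "Y \<noteq> 0" "th (X / Y) \<noteq> 0" "ef2 (a ^ 2 * X * Y * q ^ (2 * N + 1)) (k + l) \<noteq> 0"
  shows "isCont (\<lambda>a. pair_factor N a X Y k l) a"
  unfolding pair_factor_def
  by (intro continuous_intros isCont_ell_fact) (use assms q in auto)

lemma isCont_inner_factor:
  assumes "a \<noteq> 0" "X \<noteq> 0" "c \<noteq> 0" "th (a * X) \<noteq> 0"
    "ef (a / c * q) K * ef (1 / (a / c * q ^ (2 * N))) K * ef (a * X * q ^ (2 * N + 1 - (K - k))) k \<noteq> 0"
  shows "isCont (\<lambda>a. inner_factor N (a * X) (a / c) k K) a"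
  unfolding inner_factor_def
  by (intro continuous_intros isCont_ell_fact isCont_theta_comp) (use assms q in auto)

lemma isCont_b_factor:
  assumes "a \<noteq> 0" "X \<noteq> 0" "b \<noteq> 0"
  shows "isCont (\<lambda>a. b_factor N (a * X) b k) a"
  unfolding b_factor_def
  by (intro continuous_intros isCont_ell_fact) (use assms q in auto)

lemma isCont_x_factor:
  assumes "a \<noteq> 0" "X \<noteq> 0" "c \<noteq> 0" "ef2 (q ^ 2 * X / Y) k \<noteq> 0"
  shows "isCont (\<lambda>a. x_factor N a c X Y k) a"
  unfolding x_factor_def
  by (intro continuous_intros isCont_ell_fact) (use assms q in auto)

lemma isCont_rhs_factor:
  assumes "a \<noteq> 0" "X \<noteq> 0" "b \<noteq> 0" "c \<noteq> 0" "ef (a / c * q) (2 * N) \<noteq> 0"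
  shows "isCont (\<lambda>a. rhs_factor N a b (a * X) c) a"
  unfolding rhs_factor_def
  by (intro continuous_intros isCont_ell_fact) (use assms q in auto)

text \<open>
  Both sides are continuous in \<open>a\<close> wherever no denominator vanishes, and all but countably
  many \<open>a\<close> are generic.
\<close>

lemma csum_eq_crhs:
  assumes gx: "generic_x r N x" and nz: "a \<noteq> 0" "b \<noteq> 0" "\<And>i. i \<in> {1..r} \<Longrightarrow> c i \<noteq> 0"
    and pair: "\<And>k m j. \<lbrakk>k \<in> multi_indices r N; m \<in> {1..r}; j \<in> {m<..r}\<rbrakk> \<Longrightarrow>
      ef2 (a ^ 2 * x m * x j * q ^ (2 * N + 1)) (k m + k j) \<noteq> 0"
    and th: "\<And>m. m \<in> {1..r} \<Longrightarrow> th (a * x m) \<noteq> 0"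
    and inner: "\<And>k m. \<lbrakk>k \<in> multi_indices r N; m \<in> {1..r}\<rbrakk> \<Longrightarrow>
      ef (a / c m * q) (vsum r k) * ef (1 / (a / c m * q ^ (2 * N))) (vsum r k)
        * ef (a * x m * q ^ (2 * N + 1 - (vsum r k - k m))) (k m) \<noteq> 0"
    and rhs: "\<And>m. m \<in> {1..r} \<Longrightarrow> ef (a / c m * q) (2 * N) \<noteq> 0"
  shows "csum r N a b c x = crhs r N a b c x"
proof (rule isCont_eq_off_countable[where f = "\<lambda>a. csum r N a b c x" and g = "\<lambda>a. crhs r N a b c x"
      and S = "{a. \<not> generic_a r a c x}"])
  have x: "x m \<noteq> 0" if "m \<in> {1..r}" for m
    using gx that by (simp add: generic_x_def)
  have thx: "th (x m / x j) \<noteq> 0" if "m \<in> {1..r}" "j \<in> {m<..r}" for m j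
    using generic_xD[OF gx, of m j 0] that by auto
  have qx: "ef2 (q ^ 2 * x m / x j) (k m) \<noteq> 0"
    if "k \<in> multi_indices r N" "m \<in> {1..r}" "j \<in> {1..r}" for k m j
    using that le_vsum[of m r k] by (intro generic_x_ef2[OF gx]) (auto simp: multi_indices_def)
  show "isCont (\<lambda>a. csum r N a b c x) a"
    unfolding csum_def cterm_def
    by (intro continuous_intros isCont_pair_factor isCont_inner_factor isCont_b_factor isCont_x_factor)
       (use nz x thx pair th inner qx in auto)
  show "isCont (\<lambda>a. crhs r N a b c x) a"
    unfolding crhs_def
    by (intro continuous_intros isCont_rhs_factor) (use nz x rhs in auto)
  show "countable {a. \<not> generic_a r a c x}"
    by (rule countable_nongeneric_a) (use x nz in auto)
  show "csum r N z b c x = crhs r N z b c x" if "z \<notin> {a. \<not> generic_a r a c x}" for z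
    using csum_eq_crhs_generic[OF gx, of z c b] that nz by simp
qed

section \<open>Translation between the stated and the cleared identity\<close>

lemma generic_xI:
  assumes x: "\<And>i. i \<in> {1..r} \<Longrightarrow> x i \<noteq> 0" and D: "Delta r x p \<noteq> 0"
    and den: "\<And>k i j. \<lbrakk>k \<in> multi_indices r N; i \<in> {1..r}; j \<in> {1..r}\<rbrakk> \<Longrightarrow> ef2 (q ^ 2 * x i / x j) (k i) \<noteq> 0"
  shows "generic_x r N x"
  unfolding generic_x_def
proof (intro conjI ballI allI impI)
  have lt: "th (x i / x j) \<noteq> 0" if "i \<in> {1..r}" "j \<in> {i<..r}" for i j
  proof -
    have "x j * th (x i / x j) \<noteq> 0"
      using D that unfolding Delta_def prod_zero_iff[OF finite_atLeastAtMost]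
        prod_zero_iff[OF finite_greaterThanAtMost] by blast
    then show ?thesis by simp
  qed
  fix i j n assume i: "i \<in> {1..r}" and j: "j \<in> {1..r}" and n: "n \<le> N" "i \<noteq> j \<or> n \<noteq> 0"
  show "th (x i / x j * q ^ (2 * n)) \<noteq> 0"
  proof (cases "n = 0")
    case True
    show ?thesis
    proof (cases "i < j")
      case True
      then show ?thesis using lt[OF i, of j] j \<open>n = 0\<close> by simp
    next
      case False
      then have "th (x j / x i) \<noteq> 0"
        using lt[OF j, of i] i n True by simp
      then show ?thesis
        using theta_inverse_eq_0[of "x j / x i"] x[OF i] x[OF j] True by simp
    qed
  next
    case False
    then obtain n' where n': "n = Suc n'" by (cases n) auto
    \<comment> \<open>For the multi-index concentrated at i, the last factor of the denominator
      factorial is the required theta value.\<close>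
    let ?k = "\<lambda>m\<in>{1..r}. if m = i then n else 0"
    have "vsum r ?k = n"
      using i by (simp add: vsum_def)
    then have "?k \<in> multi_indices r N"
      using n by (simp add: multi_indices_def)
    from den[OF this i j] have "ef2 (q ^ 2 * x i / x j) n \<noteq> 0"
      using i by simp
    then have "th (q ^ 2 * x i / x j * (q ^ 2) ^ n') \<noteq> 0"
      by (simp add: ell_fact_def n')
    moreover have "q ^ 2 * x i / x j * (q ^ 2) ^ n' = x i / x j * q ^ (2 * n)"
      unfolding n' power_mult by (simp add: mult_ac)
    ultimately show ?thesis by metis
  qed
qed (use x in auto)

text \<open>An integer power is used because e_2(k) may exceed |k|. Its part q^|k| goes to the size
  factor, and the rest spreads over the pairs just as Delta does.\<close>

lemma Delta_pair_factor:
  "Delta r (\<lambda>i. x i * q ^ (2 * k i)) p / Delta r x p * q powi (int (vsum r k) - int (e2 r k))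
     * (\<Prod>i\<in>{1..r}. \<Prod>j\<in>{i<..r}. 1 / ef2 (a ^ 2 * x i * x j * q ^ (2 * N + 1)) (k i + k j))
   = q ^ vsum r k * (\<Prod>i\<in>{1..r}. \<Prod>j\<in>{i<..r}. pair_factor N a (x i) (x j) (k i) (k j))"
proof -
  have e: "q ^ e2 r k = (\<Prod>i\<in>{1..r}. \<Prod>j\<in>{i<..r}. q ^ (k i * k j))"
    by (simp add: e2_def power_sum)
  have "q powi (int (vsum r k) - int (e2 r k)) = q ^ vsum r k * (1 / q ^ e2 r k)"
    using q by (simp add: power_int_diff)
  also have "1 / q ^ e2 r k = (\<Prod>i\<in>{1..r}. \<Prod>j\<in>{i<..r}. 1 / q ^ (k i * k j))"
    unfolding e by (simp add: prod_dividef)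
  finally have q: "q powi (int (vsum r k) - int (e2 r k))
      = q ^ vsum r k * (\<Prod>i\<in>{1..r}. \<Prod>j\<in>{i<..r}. 1 / q ^ (k i * k j))" .
  have "pair_factor N a (x i) (x j) (k i) (k j)
      = (x j * q ^ (2 * k j) * th (x i * q ^ (2 * k i) / (x j * q ^ (2 * k j)))) / (x j * th (x i / x j))
        * (1 / q ^ (k i * k j)) * (1 / ef2 (a ^ 2 * x i * x j * q ^ (2 * N + 1)) (k i + k j))" for i j
    by (simp add: pair_factor_def)
  then show ?thesis
    unfolding q by (simp only: Delta_def prod.distrib prod_dividef mult_ac)
qed

text \<open>The bounds on k and K make the integer exponent of q equal to a natural one. The two
  denominators are treated separately so that their nonvanishing can be transferred as well.\<close>

lemma inner_factor_eq:
  assumes k: "k \<le> K" "K \<le> N"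
  shows "theta (a * X * q ^ (2 * k + K)) p / theta (a * X) p
       * (ell_fact (a * X) q p K * ell_fact (q powi (- 2 * int N) / (a * X)) q p (K - k)
          / (ell_facts [a * q / c, c * q powi (- 2 * int N) / a] q p K
             * ell_fact (q powi (2 * int N + 1 + int k - int K) * a * X) q p k))
     = inner_factor N (a * X) (a / c) k K" (is ?eq)
    and "ell_facts [a * q / c, c * q powi (- 2 * int N) / a] q p K
        = ef (a / c * q) K * ef (1 / (a / c * q ^ (2 * N))) K" (is ?eq2)
    and "ell_fact (q powi (2 * int N + 1 + int k - int K) * a * X) q p k
        = ef (a * X * q ^ (2 * N + 1 - (K - k))) k" (is ?eq3)
proof -
  have e1: "q powi (- 2 * int N) = 1 / q ^ (2 * N)"
    using power_int_minus[of q "int (2 * N)"] by (simp only: power_int_of_nat inverse_eq_divide) simp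
  have e2: "q powi (2 * int N + 1 + int k - int K) = q ^ (2 * N + 1 - (K - k))"
  proof -
    have "2 * int N + 1 + int k - int K = int (2 * N + 1 - (K - k))" using k by simp
    then show ?thesis by (simp only: power_int_of_nat)
  qed
  have e3: "a * q / c = a / c * q" "c * (1 / q ^ (2 * N)) / a = 1 / (a / c * q ^ (2 * N))"
    "1 / q ^ (2 * N) / (a * X) = 1 / (a * X * q ^ (2 * N))"
    "q ^ (2 * N + 1 - (K - k)) * a * X = a * X * q ^ (2 * N + 1 - (K - k))"
    by simp_all
  show 2: ?eq2
    unfolding e1 e3 by (simp add: ell_facts_def)
  show 3: ?eq3
    unfolding e2 e3 ..
  show ?eq
    unfolding 2 3 inner_factor_def unfolding e1 e3 ..
qed

lemma b_factor_eq:
  assumes k: "k \<le> N" and nz: "ell_facts [A * b * q, A * q ^ 2 / b] (q ^ 2) p k \<noteq> 0"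
  shows "ell_facts [A * b * q, A * q ^ 2 / b] (q ^ 2) p N / ell_facts [A * b * q, A * q ^ 2 / b] (q ^ 2) p k
    = b_factor N A b k"
proof -
  have "ef2 (A * b * q) N = ef2 (A * b * q) k * ef2 (A * b * q ^ (1 + 2 * k)) (N - k)"
    by (rule ef2_split) (use k in auto)
  moreover have "ef2 (A * q ^ 2 / b) N = ef2 (A * q ^ 2 / b) k * ef2 (A * q ^ (2 + 2 * k) / b) (N - k)"
    by (rule ef2_split) (use k in \<open>auto simp: power_add power2_eq_square\<close>)
  ultimately show ?thesis
    using nz by (simp add: ell_facts_def b_factor_def)
qed

end

theorem corollary4p9:
  fixes p q a b :: complex and c x :: "nat \<Rightarrow> complex" and r N :: nat
  assumes p: "norm p < 1"
    and q: "q \<noteq> 0"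
    and q_generic: "\<And>k::nat. k > 0 \<Longrightarrow>
          (if p = 0 then q ^ k \<noteq> 1 else (\<forall>m::int. q ^ k \<noteq> p powi m))"
    and r: "r \<ge> 1"
    and a: "a \<noteq> 0" and b: "b \<noteq> 0"
    and c: "\<And>i. i \<in> {1..r} \<Longrightarrow> c i \<noteq> 0"
    and x: "\<And>i. i \<in> {1..r} \<Longrightarrow> x i \<noteq> 0"
    \<comment> \<open>genericity: no denominator on either side vanishes\<close>
    and den_Delta: "Delta r x p \<noteq> 0"
    and den_pair: "\<And>k i j. \<lbrakk>k \<in> multi_indices r N; i \<in> {1..r}; j \<in> {i<..r}\<rbrakk> \<Longrightarrow>
          ell_fact (a ^ 2 * x i * x j * q ^ (2 * N + 1)) (q ^ 2) p (k i + k j) \<noteq> 0"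
    and den_theta: "\<And>i. i \<in> {1..r} \<Longrightarrow> theta (a * x i) p \<noteq> 0"
    and den_c: "\<And>k i. \<lbrakk>k \<in> multi_indices r N; i \<in> {1..r}\<rbrakk> \<Longrightarrow>
          ell_facts [a * q / c i, c i * q powi (- 2 * int N) / a] q p (vsum r k) \<noteq> 0"
    and den_shift: "\<And>k i. \<lbrakk>k \<in> multi_indices r N; i \<in> {1..r}\<rbrakk> \<Longrightarrow>
          ell_fact (q powi (2 * int N + 1 + int (k i) - int (vsum r k)) * a * x i) q p (k i) \<noteq> 0"
    and den_b: "\<And>k i. \<lbrakk>k \<in> multi_indices r N; i \<in> {1..r}\<rbrakk> \<Longrightarrow>
          ell_facts [a * b * x i * q, a * x i * q ^ 2 / b] (q ^ 2) p (k i) \<noteq> 0"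
    and den_x: "\<And>k i j. \<lbrakk>k \<in> multi_indices r N; i \<in> {1..r}; j \<in> {1..r}\<rbrakk> \<Longrightarrow>
          ell_fact (q ^ 2 * x i / x j) (q ^ 2) p (k i) \<noteq> 0"
    and den_rhs: "\<And>i. i \<in> {1..r} \<Longrightarrow>
          ell_fact (a * q / c i) q p (2 * N)
            * ell_facts [a * x i * q ^ 2 / b, a * b * x i * q] (q ^ 2) p N \<noteq> 0"
  shows
    "(\<Sum>k\<in>multi_indices r N.
        Delta r (\<lambda>i. x i * q ^ (2 * k i)) p / Delta r x p
        * q powi (int (vsum r k) - int (e2 r k))
        * (\<Prod>i\<in>{1..r}. \<Prod>j\<in>{i<..r}.
             1 / ell_fact (a ^ 2 * x i * x j * q ^ (2 * N + 1)) (q ^ 2) p (k i + k j))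
        * (\<Prod>i\<in>{1..r}.
             theta (a * x i * q ^ (2 * k i + vsum r k)) p / theta (a * x i) p
             * (ell_fact (a * x i) q p (vsum r k)
                * ell_fact (q powi (- 2 * int N) / (a * x i)) q p (vsum r k - k i)
                / (ell_facts [a * q / c i, c i * q powi (- 2 * int N) / a] q p (vsum r k)
                   * ell_fact (q powi (2 * int N + 1 + int (k i) - int (vsum r k)) * a * x i)
                       q p (k i))))
        * (ell_facts [b, q / b] q p (vsum r k)
           * ell_fact (q powi (- 2 * int N)) (q ^ 2) p (vsum r k)
           / (\<Prod>i\<in>{1..r}.
                ell_facts [a * b * x i * q, a * x i * q ^ 2 / b] (q ^ 2) p (k i)))
        * (\<Prod>i\<in>{1..r}. \<Prod>j\<in>{1..r}.
             ell_facts [c j * x i, a ^ 2 * q ^ (2 * N + 1) * x i / c j] (q ^ 2) p (k i)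
             / ell_fact (q ^ 2 * x i / x j) (q ^ 2) p (k i)))
     = (\<Prod>i\<in>{1..r}.
          ell_fact (a * x i * q) q p (2 * N)
          * ell_facts [a * b * q / c i, a * q ^ 2 / (b * c i)] (q ^ 2) p N
          / (ell_fact (a * q / c i) q p (2 * N)
             * ell_facts [a * x i * q ^ 2 / b, a * b * x i * q] (q ^ 2) p N))"
proof -
  interpret E: elliptic_base p q
    by unfold_locales (use p q q_generic in blast)+
  define B where "B i n = ell_facts [a * x i * b * q, a * x i * q ^ 2 / b] (q ^ 2) p n" for i n
  have ab: "ell_facts [a * b * x i * q, a * x i * q ^ 2 / b] (q ^ 2) p n = B i n"
    "ell_facts [a * x i * q ^ 2 / b, a * b * x i * q] (q ^ 2) p n = B i n" for i n
    by (simp_all add: B_def ell_facts_def mult_ac)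
  \<comment> \<open>The common b-dependent denominator: dividing the cleared identity by it restores
    the stated one.\<close>
  define D where "D = (\<Prod>i\<in>{1..r}. B i N)"
  have B0: "B i N \<noteq> 0" "ell_fact (a * q / c i) q p (2 * N) \<noteq> 0" if "i \<in> {1..r}" for i
    using den_rhs[OF that] unfolding ab by auto
  then have D0: "D \<noteq> 0"
    by (simp add: D_def)
  have gx: "E.generic_x r N x"
    by (rule E.generic_xI[OF x den_Delta]) (use den_x in auto)
  have k: "vsum r k \<le> N" "i \<in> {1..r} \<Longrightarrow> k i \<le> vsum r k" if "k \<in> multi_indices r N" for k i
    using that le_vsum[of i r k] by (auto simp: multi_indices_def)
  have eq: "E.csum r N a b c x = E.crhs r N a b c x"
  proof (rule E.csum_eq_crhs[OF gx a b])
    fix k m assume "k \<in> multi_indices r N" "m \<in> {1..r}"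
    then show "ell_fact (a / c m * q) q p (vsum r k) * ell_fact (1 / (a / c m * q ^ (2 * N))) q p (vsum r k)
        * ell_fact (a * x m * q ^ (2 * N + 1 - (vsum r k - k m))) q p (k m) \<noteq> 0"
      using den_c[of k m] den_shift[of k m] E.inner_factor_eq(2,3)[of "k m" "vsum r k" N a]
        k(1)[of k] k(2)[of k m] by auto
  qed (use c den_pair den_theta B0 in auto)
  have summand: "Delta r (\<lambda>i. x i * q ^ (2 * k i)) p / Delta r x p
        * q powi (int (vsum r k) - int (e2 r k))
        * (\<Prod>i\<in>{1..r}. \<Prod>j\<in>{i<..r}.
             1 / ell_fact (a ^ 2 * x i * x j * q ^ (2 * N + 1)) (q ^ 2) p (k i + k j))
        * (\<Prod>i\<in>{1..r}.
             theta (a * x i * q ^ (2 * k i + vsum r k)) p / theta (a * x i) p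
             * (ell_fact (a * x i) q p (vsum r k)
                * ell_fact (q powi (- 2 * int N) / (a * x i)) q p (vsum r k - k i)
                / (ell_facts [a * q / c i, c i * q powi (- 2 * int N) / a] q p (vsum r k)
                   * ell_fact (q powi (2 * int N + 1 + int (k i) - int (vsum r k)) * a * x i)
                       q p (k i))))
        * (ell_facts [b, q / b] q p (vsum r k)
           * ell_fact (q powi (- 2 * int N)) (q ^ 2) p (vsum r k)
           / (\<Prod>i\<in>{1..r}.
                ell_facts [a * b * x i * q, a * x i * q ^ 2 / b] (q ^ 2) p (k i)))
        * (\<Prod>i\<in>{1..r}. \<Prod>j\<in>{1..r}.
             ell_facts [c j * x i, a ^ 2 * q ^ (2 * N + 1) * x i / c j] (q ^ 2) p (k i)
             / ell_fact (q ^ 2 * x i / x j) (q ^ 2) p (k i))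
      = E.cterm r N a b c x k / D" (is "?Del * ?Inn * ?Siz * ?X = _") if kM: "k \<in> multi_indices r N" for k
  proof -
    have Inn: "?Inn = (\<Prod>i\<in>{1..r}. E.inner_factor N (a * x i) (a / c i) (k i) (vsum r k))"
      by (rule prod.cong[OF refl], rule E.inner_factor_eq(1)) (use k[OF kM] in auto)
    have "(\<Prod>i\<in>{1..r}. B i N / B i (k i)) = (\<Prod>i\<in>{1..r}. E.b_factor N (a * x i) b (k i))"
    proof (rule prod.cong[OF refl])
      fix i assume i: "i \<in> {1..r}"
      show "B i N / B i (k i) = E.b_factor N (a * x i) b (k i)"
        unfolding B_def
        by (rule E.b_factor_eq) (use k(1)[OF kM] k(2)[OF kM, of i] i den_b[OF kM i] in \<open>auto simp: ab B_def\<close>)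
    qed
    then have "D / (\<Prod>i\<in>{1..r}. B i (k i)) = (\<Prod>i\<in>{1..r}. E.b_factor N (a * x i) b (k i))"
      by (simp only: prod_dividef D_def)
    then have bf: "1 / (\<Prod>i\<in>{1..r}. B i (k i)) = (\<Prod>i\<in>{1..r}. E.b_factor N (a * x i) b (k i)) / D"
      using D0 by (metis (no_types, lifting) divide_divide_eq_right mult.commute nonzero_mult_div_cancel_left
        times_divide_eq_left divide_self mult_1_left)
    have e1: "q powi (- 2 * int N) = 1 / q ^ (2 * N)"
      using power_int_minus[of q "int (2 * N)"] by (simp only: power_int_of_nat inverse_eq_divide) simp
    have "?Siz = ell_fact b q p (vsum r k) * ell_fact (q / b) q p (vsum r k)
        * ell_fact (1 / q ^ (2 * N)) (q ^ 2) p (vsum r k) * (1 / (\<Prod>i\<in>{1..r}. B i (k i)))"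
      unfolding e1 ab by (simp add: ell_facts_def)
    note Siz = this[unfolded bf]
    have X: "?X = (\<Prod>i\<in>{1..r}. \<Prod>j\<in>{1..r}. E.x_factor N a (c j) (x i) (x j) (k i))"
      by (simp add: E.x_factor_def ell_facts_def)
    show ?thesis
      unfolding E.Delta_pair_factor Inn Siz X E.cterm_def E.size_factor_def
      by (simp only: divide_inverse mult_ac)
  qed
  have "E.csum r N a b c x / D = E.crhs r N a b c x / D"
    unfolding eq ..
  also have "\<dots> = (\<Prod>i\<in>{1..r}. E.rhs_factor N a b (a * x i) (c i) / B i N)"
    by (simp only: E.crhs_def D_def prod_dividef)
  also have "\<dots> = (\<Prod>i\<in>{1..r}. ell_fact (a * x i * q) q p (2 * N)
          * ell_facts [a * b * q / c i, a * q ^ 2 / (b * c i)] (q ^ 2) p N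
          / (ell_fact (a * q / c i) q p (2 * N)
             * ell_facts [a * x i * q ^ 2 / b, a * b * x i * q] (q ^ 2) p N))"
    unfolding ab by (simp add: E.rhs_factor_def ell_facts_def mult.assoc)
  finally show ?thesis
    by (simp only: summand E.csum_def sum_divide_distrib cong: sum.cong)
qed

end
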